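(* Let $b\in L^\infty(0,T;C^{0,\beta}_b(\mathbb R^n;\mathbb R^n))$, $\beta\in(0,1)$, $\sigma:[0,\infty)\to\mathbb R^{n\times d}$ Borel and locally bounded, $A\in\mathbb R^{n\times n}$, and let $L$ have generating triplet $(Q,0,\nu)$ with $\mathbb E[|L_1|^\theta]<\infty$ for some $\theta\in(0,1)$. Assume Hypothesis (H1) holds for (E). Then there exists a $\mathcal B([0,T]\times[0,T]\times\mathbb R^n)\otimes\mathcal F$-measurable map $\psi:[0,T]\times[0,T]\times\mathbb R^n\times\Omega\to\mathbb R^n$ such that for each $s,x$ the process $(\psi(s,t,x,\cdot))_{t\in[0,T]}$ is a strong solution of (E) starting from $x$ at time $s$, and there is an event $\Omega'$ with $\mathbb P(\Omega')=1$ such that for every $\omega\in\Omega'$: (i) for every $x$, $s\mapsto\psi(s,t,x,\omega)$ is càdlàg on $[0,T]$ uniformly in $t$ and locally uniformly in $x$: for $s\in(0,T)$, $r_m\to s^+$, $s_j\to s^-$ and every $R>0$, $\lim_m\sup_{|x|\le R}\sup_{t\in[0,T]}|\psi(r_m,t,x,\omega)-\psi(s,t,x,\omega)|=0$ and $\lim_j\sup_{|x|\le R}\sup_{t\in[0,T]}|\psi(s_j,t,x,\omega)-\psi(s-,t,x,\omega)|=0$ (with analogous one-sided statements at $s=0$ and $s=T$); (ii) for all $x\in\mathbb R^n$, $s\in[0,T]$: $\psi(s,t,x,\omega)=x$ for $0\le t\le s$ and, for $t\in[s,T]$, $\psi(s,t,x,\omega)=x+\int_s^t[b(r,\psi(s,r,x,\omega))+A\psi(s,r,x,\omega)]\,dr+M_t(\omega)-M_s(\omega)$;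 (iii) for every $s$, $x\mapsto\psi(s,t,x,\omega)$ is continuous uniformly in $t$; moreover for each integer $m>2n$ there is a $\mathcal B([0,T])\otimes\mathcal F$-measurable $V_m:[0,T]\times\Omega\to[0,\infty]$ with $\int_0^TV_m(s,\omega)\,ds<\infty$ and $\sup_{t\in[0,T]}|\psi(s,t,x,\omega)-\psi(s,t,y,\omega)|\le V_m(s,\omega)|x-y|^{\frac{m-2n}{m}}[(|x|\vee|y|)^{\frac{2n+1}{m}}\vee1]$ for all $x,y\in\mathbb R^n$, $s\in[0,T]$; (iv) for all $0\le s<r\le t\le T$ and $x\in\mathbb R^n$: $\psi(s,t,x,\omega)=\psi(r,t,\psi(s,r,x,\omega),\omega)$; (v) for every $s_0\in[0,T)$, $\tau=\tau(\omega)\in(s_0,T]$, $x\in\mathbb R^n$: if a càdlàg $g:[s_0,\tau)\to\mathbb R^n$ satisfies $g(t)=x+\int_{s_0}^t[b(r,g(r))+Ag(r)]\,dr+M_t(\omega)-M_{s_0}(\omega)$ for $t\in[s_0,\tau)$, then $g(r)=\psi(s_0,r,x,\omega)$ for all $r\in[s_0,\tau)$.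
   Context: Fix $T>0$ and integers $1\le d\le n$. $(\Omega,\mathcal F,\mathbb P)$ is a complete probability space and $L$ an $\mathbb R^d$-valued Lévy process on it, with generating triplet $(Q,a,\nu)$ in the Lévy–Khintchine formula $\mathbb E[e^{i\langle L_t,k\rangle}]=e^{-t\phi(k)}$, $\phi(k)=\frac12\langle Qk,k\rangle-i\langle a,k\rangle-\int(e^{i\langle k,y\rangle}-1-i\langle k,y\rangle1_{\{|y|\le1\}})\nu(dy)$. $\mathcal F^L_{s,t}$ is the completion of the $\sigma$-algebra generated by $L_r-L_s$, $s\le r\le t$. $M_t=\int_0^t\sigma(r)\,dL_r$ (càdlàg version). $L^\infty(0,T;C^{0,\beta}_b(\mathbb R^n;\mathbb R^n))$ is the set of Borel bounded $b:[0,T]\times\mathbb R^n\to\mathbb R^n$ with $\sup_t\sup_{x\ne x'}|b(t,x)-b(t,x')|/|x-x'|^\beta<\infty$. Equation (E): $Z_t=x+\int_s^t[b(r,Z_r)+AZ_r]\,dr+M_t-M_s$, $t\in[s,T]$. A strong solution of (E) starting from $x$ at time $s$ is a process $(V_t)_{t\in[0,T]}$ with $V_t=x$ for $t\le s$, $V_t$ $\mathcal F^L_{s,t}$-measurable for $t\in[s,T]$, such that on an event $\Omega_{s,x}$ of probability one: $t\mapsto V_t$ is càdlàg on $[s,T]$, $t\mapsto L_t$ is càdlàg with $L_0=0$, and (E) holds for all $t\in[s,T]$. Hypothesis (H1) for (E): (i) strong solutions of (E) exist for every $s\in[0,T]$, $x\in\mathbb R^n$; (ii) for every $p\ge2$ there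 is $C_T>0$ (depending only on the law of $L$, $A$, $\sigma$, $b$, $\beta$, $n$, $p$, $T$) such that for all $s$, $x,y$ and any two strong solutions $Z^{s,x},Z^{s,y}$: $\mathbb E[\sup_{s\le t\le T}|Z^{s,x}_t-Z^{s,y}_t|^p]\le C_T|x-y|^p$. *)

theory Defs
  imports "HOL-Probability.Probability"
begin

definition cadlag_on :: "real set \<Rightarrow> (real \<Rightarrow> 'b::metric_space) \<Rightarrow> bool" where
  "cadlag_on I f \<longleftrightarrow>
     (\<forall>t\<in>I. (f \<longlongrightarrow> f t) (at t within (I \<inter> {t<..})) \<and>
             (\<exists>l. (f \<longlongrightarrow> l) (at t within (I \<inter> {..<t}))))"

definition tendsto_in_prob ::
  "'a measure \<Rightarrow> (nat \<Rightarrow> 'a \<Rightarrow> 'b::metric_space) \<Rightarrow> ('a \<Rightarrow> 'b) \<Rightarrow> bool" where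
  "tendsto_in_prob P X Y \<longleftrightarrow>
     (\<forall>\<epsilon>>0. (\<lambda>j. measure P {\<omega>\<in>space P. \<epsilon> < dist (X j \<omega>) (Y \<omega>)}) \<longlonglongrightarrow> 0)"

definition levy_process :: "'a measure \<Rightarrow> (real \<Rightarrow> 'a \<Rightarrow> real^'d) \<Rightarrow> bool" where
  "levy_process P L \<longleftrightarrow>
     (\<forall>t\<ge>0. L t \<in> borel_measurable P) \<and>
     (AE \<omega> in P. L 0 \<omega> = 0) \<and>
     (\<forall>(ts::nat \<Rightarrow> real) k. 0 \<le> ts 0 \<and> (\<forall>i<k. ts i < ts (Suc i)) \<longrightarrow>
        prob_space.indep_vars P (\<lambda>_. borel) (\<lambda>i \<omega>. L (ts (Suc i)) \<omega> - L (ts i) \<omega>) {..<k}) \<and>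
     (\<forall>s\<ge>0. \<forall>t\<ge>0. distr P borel (\<lambda>\<omega>. L (s + t) \<omega> - L s \<omega>) = distr P borel (L t)) \<and>
     (\<forall>t\<ge>0. \<forall>\<epsilon>>0. ((\<lambda>h. measure P {\<omega>\<in>space P. \<epsilon> < dist (L h \<omega>) (L t \<omega>)}) \<longlongrightarrow> 0)
                      (at t within {0..})) \<and>
     (AE \<omega> in P. cadlag_on {0..} (\<lambda>t. L t \<omega>))"

definition levy_measure :: "(real^'d) measure \<Rightarrow> bool" where
  "levy_measure \<nu> \<longleftrightarrow> sets \<nu> = sets borel \<and> emeasure \<nu> {0} = 0 \<and>
     (\<integral>\<^sup>+ y. ennreal (min 1 (norm y ^ 2)) \<partial>\<nu>) < \<infinity>"

definition levy_exponent ::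
  "real^'d^'d \<Rightarrow> real^'d \<Rightarrow> (real^'d) measure \<Rightarrow> real^'d \<Rightarrow> complex" where
  "levy_exponent Q a \<nu> k =
     complex_of_real ((1/2) * ((Q *v k) \<bullet> k)) - \<i> * complex_of_real (a \<bullet> k)
     - (\<integral>y. (cis (k \<bullet> y) - 1 - \<i> * complex_of_real (k \<bullet> y) * indicator (cball 0 1) y) \<partial>\<nu>)"

definition generating_triplet ::
  "'a measure \<Rightarrow> (real \<Rightarrow> 'a \<Rightarrow> real^'d) \<Rightarrow> real^'d^'d \<Rightarrow> real^'d \<Rightarrow> (real^'d) measure \<Rightarrow> bool" where
  "generating_triplet P L Q a \<nu> \<longleftrightarrow>
     transpose Q = Q \<and> (\<forall>k. 0 \<le> (Q *v k) \<bullet> k) \<and> levy_measure \<nu> \<and>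
     (\<forall>t\<ge>0. \<forall>k. (\<integral>\<omega>. cis (L t \<omega> \<bullet> k) \<partial>P) = exp (- (complex_of_real t * levy_exponent Q a \<nu> k)))"

definition step_fn :: "nat \<Rightarrow> (nat \<Rightarrow> real) \<Rightarrow> (nat \<Rightarrow> real^'d^'n) \<Rightarrow> real \<Rightarrow> real^'d^'n" where
  "step_fn K ts cs r = (\<Sum>k<K. indicator {ts k<..ts (Suc k)} r *\<^sub>R cs k)"

definition step_int ::
  "(real \<Rightarrow> 'a \<Rightarrow> real^'d) \<Rightarrow> nat \<Rightarrow> (nat \<Rightarrow> real) \<Rightarrow> (nat \<Rightarrow> real^'d^'n) \<Rightarrow> 'a \<Rightarrow> real^'n" where
  "step_int L K ts cs \<omega> = (\<Sum>k<K. cs k *v (L (ts (Suc k)) \<omega> - L (ts k) \<omega>))"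

definition stoch_integral ::
  "'a measure \<Rightarrow> (real \<Rightarrow> 'a \<Rightarrow> real^'d) \<Rightarrow> (real \<Rightarrow> real^'d^'n) \<Rightarrow> real \<Rightarrow> ('a \<Rightarrow> real^'n) \<Rightarrow> bool" where
  "stoch_integral P L \<sigma> t Y \<longleftrightarrow>
     Y \<in> borel_measurable P \<and>
     (\<forall>(Ks::nat \<Rightarrow> nat) (tss::nat \<Rightarrow> nat \<Rightarrow> real) (css::nat \<Rightarrow> nat \<Rightarrow> real^'d^'n).
        (\<forall>j. tss j 0 = 0 \<and> tss j (Ks j) = t \<and> (\<forall>i<Ks j. tss j i < tss j (Suc i))) \<and>
        (\<exists>C. \<forall>j. \<forall>r\<in>{0<..t}. norm (step_fn (Ks j) (tss j) (css j) r) \<le> C) \<and>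
        (\<forall>r\<in>{0<..t}. (\<lambda>j. step_fn (Ks j) (tss j) (css j) r) \<longlonglongrightarrow> \<sigma> r)
        \<longrightarrow> tendsto_in_prob P (\<lambda>j. step_int L (Ks j) (tss j) (css j)) Y)"

definition cadlag_stoch_integral ::
  "'a measure \<Rightarrow> (real \<Rightarrow> 'a \<Rightarrow> real^'d) \<Rightarrow> (real \<Rightarrow> real^'d^'n) \<Rightarrow> real \<Rightarrow> (real \<Rightarrow> 'a \<Rightarrow> real^'n) \<Rightarrow> bool" where
  "cadlag_stoch_integral P L \<sigma> T M \<longleftrightarrow>
     (\<forall>t\<in>{0..T}. stoch_integral P L \<sigma> t (M t)) \<and>
     (AE \<omega> in P. cadlag_on {0..T} (\<lambda>t. M t \<omega>))"

definition FL_gen :: "'a measure \<Rightarrow> (real \<Rightarrow> 'a \<Rightarrow> real^'d) \<Rightarrow> real \<Rightarrow> real \<Rightarrow> 'a measure" where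
  "FL_gen P L s t = sigma (space P)
     (\<Union>r\<in>{s..t}. {(\<lambda>\<omega>. L r \<omega> - L s \<omega>) -` B \<inter> space P | B. B \<in> sets borel})"

text \<open>Completion (with respect to \<open>P\<close>) of the generated sigma-algebra.\<close>
definition FL :: "'a measure \<Rightarrow> (real \<Rightarrow> 'a \<Rightarrow> real^'d) \<Rightarrow> real \<Rightarrow> real \<Rightarrow> 'a measure" where
  "FL P L s t = sigma (space P)
     {A. A \<subseteq> space P \<and> (\<exists>B\<in>sets (FL_gen P L s t). \<exists>N\<in>null_sets P. (A - B) \<union> (B - A) \<subseteq> N)}"

definition solves_E ::
  "(real \<Rightarrow> real^'n \<Rightarrow> real^'n) \<Rightarrow> real^'n^'n \<Rightarrow> (real \<Rightarrow> 'a \<Rightarrow> real^'n) \<Rightarrow>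
   real \<Rightarrow> real^'n \<Rightarrow> real set \<Rightarrow> (real \<Rightarrow> real^'n) \<Rightarrow> 'a \<Rightarrow> bool" where
  "solves_E b A M s x I f \<omega> \<longleftrightarrow>
     (\<forall>t\<in>I. set_integrable lborel {s..t} (\<lambda>r. b r (f r) + A *v f r) \<and>
            f t = x + (LINT r:{s..t}|lborel. b r (f r) + A *v f r) + M t \<omega> - M s \<omega>)"

definition strong_solution ::
  "'a measure \<Rightarrow> (real \<Rightarrow> 'a \<Rightarrow> real^'d) \<Rightarrow> (real \<Rightarrow> real^'n \<Rightarrow> real^'n) \<Rightarrow> real^'n^'n \<Rightarrow>
   (real \<Rightarrow> 'a \<Rightarrow> real^'n) \<Rightarrow> real \<Rightarrow> real \<Rightarrow> real^'n \<Rightarrow> (real \<Rightarrow> 'a \<Rightarrow> real^'n) \<Rightarrow> bool" where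
  "strong_solution P L b A M T s x V \<longleftrightarrow>
     (\<forall>t\<in>{0..s}. \<forall>\<omega>\<in>space P. V t \<omega> = x) \<and>
     (\<forall>t\<in>{s..T}. V t \<in> borel_measurable (FL P L s t)) \<and>
     (\<exists>\<Omega>\<^sub>0\<in>sets P. measure P \<Omega>\<^sub>0 = 1 \<and>
        (\<forall>\<omega>\<in>\<Omega>\<^sub>0. cadlag_on {s..T} (\<lambda>t. V t \<omega>) \<and> cadlag_on {0..T} (\<lambda>t. L t \<omega>) \<and>
                  L 0 \<omega> = 0 \<and> solves_E b A M s x {s..T} (\<lambda>t. V t \<omega>) \<omega>))"

definition H1 ::
  "'a measure \<Rightarrow> (real \<Rightarrow> 'a \<Rightarrow> real^'d) \<Rightarrow> (real \<Rightarrow> real^'n \<Rightarrow> real^'n) \<Rightarrow> real^'n^'n \<Rightarrow>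
   (real \<Rightarrow> 'a \<Rightarrow> real^'n) \<Rightarrow> real \<Rightarrow> bool" where
  "H1 P L b A M T \<longleftrightarrow>
     (\<forall>s\<in>{0..T}. \<forall>x. \<exists>V. strong_solution P L b A M T s x V) \<and>
     (\<forall>p\<ge>2. \<exists>C>0. \<forall>s\<in>{0..T}. \<forall>x y Z1 Z2.
        strong_solution P L b A M T s x Z1 \<longrightarrow> strong_solution P L b A M T s y Z2 \<longrightarrow>
        (\<integral>\<^sup>+\<omega>. (\<Squnion>t\<in>{s..T}. ennreal (norm (Z1 t \<omega> - Z2 t \<omega>) powr p)) \<partial>P)
          \<le> ennreal (C * norm (x - y) powr p))"

end

theory Submission
  imports Defs "HOL-Complex_Analysis.Great_Picard"
begin

text \<open>
  The equation has additive noise, so for a fixed outcome it is an ordinary integral equation driven by a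
  cadlag path and limits of solutions are solutions (Arzela--Ascoli). It therefore suffices to prove that
  almost surely the integral equation is uniquely solvable for all initial data at once: existence,
  regularity in the initial time and point, and the cocycle identity then follow by compactness.

  Uniqueness is Davie's argument on the dyadic times only. By (H1) and a chaining argument the solutions
  started at a dyadic time \<open>s\<close> extend to a flow \<open>\<psi>(s,t,x)\<close> which is Hoelder in \<open>x\<close> of any exponent
  \<open>\<alpha> < 1\<close>, with a random constant \<open>H(s)\<close> whose mean is bounded in \<open>s\<close>; uniqueness in (H1) gives the
  cocycle property on the dyadic times. If \<open>g\<close> is any solution, then over a dyadic step from \<open>r\<close> to \<open>r'\<close> it
  differs from \<open>\<psi>(r,r',g(r))\<close> by at most \<open>c \<bar>r' - r\<bar>^(1+\<beta>)\<close>, so \<open>r \<mapsto> \<psi>(r,t,g(r))\<close> moves by at most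
  \<open>H(r') c' \<bar>r' - r\<bar>^(\<alpha>(1+\<beta>))\<close>. For \<open>\<alpha>(1+\<beta>) > 1\<close> the sum of these bounds over the grid of mesh
  \<open>T/2^k\<close> tends to \<open>0\<close> almost surely, hence \<open>\<psi>(r,t,g(r))\<close> does not depend on \<open>r\<close>.
\<close>

section \<open>Pathwise integral equations\<close>

text \<open>Two obstacles shape the construction. The null set outside which (H1) gives information
  depends on the initial data, so identities between strong solutions may be used only for countably
  many times and points; all other data are reached by limits, and in time from the right, since the
  noise is merely cadlag. Moreover, only the mean of \<open>H(s)\<close> is bounded uniformly in
  \<open>s\<close>, not its supremum: hence a sum over a whole grid, whose mean is of order 2^k
  2^(-k \<alpha>(1+\<beta>)). The gain 1+\<beta> of one step comes from inserting a Lipschitz bound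
  for the difference of two solutions with a common start into the Hoelder drift. The condition
  \<alpha>(1+\<beta>) > 1 can be met because moments of every order push \<alpha> = (m-2n)/m towards
  1. Finally, the cocycle identity restarts at a random point, whereas (H1) speaks of deterministic
  starts: the pasted process is shown to be itself a strong solution from the old start, and its
  adaptedness rests on rounding the random point to countably many values.\<close>

definition driven_sol ::
  "(real \<Rightarrow> 'v::euclidean_space \<Rightarrow> 'v) \<Rightarrow> (real \<Rightarrow> 'v) \<Rightarrow> real \<Rightarrow> 'v \<Rightarrow> real set \<Rightarrow> (real \<Rightarrow> 'v) \<Rightarrow> bool" where
  "driven_sol F m s x I g \<longleftrightarrow>
     (\<forall>t\<in>I. set_integrable lborel {s..t} (\<lambda>r. F r (g r)) \<and>
            g t = x + (LINT r:{s..t}|lborel. F r (g r)) + m t - m s)"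

lemma solves_E_iff_driven_sol:
  "solves_E b A M s x I f \<omega> \<longleftrightarrow>
     driven_sol (\<lambda>r z. b r z + A *v z) (\<lambda>t. M t \<omega>) s x I f"
  by (simp add: solves_E_def driven_sol_def)

text \<open>Each fact is recorded for the Lebesgue integral, in which the equation is posed, and for
  the gauge integral, whose splitting and subinterval rules are used below.\<close>

lemma driven_solD:
  assumes "driven_sol F m s x I g" "t \<in> I"
  shows "set_integrable lborel {s..t} (\<lambda>r. F r (g r))"
    and "g t = x + (LINT r:{s..t}|lborel. F r (g r)) + m t - m s"
    and "(\<lambda>r. F r (g r)) integrable_on {s..t}"
    and "g t = x + integral {s..t} (\<lambda>r. F r (g r)) + m t - m s"
proof -
  show i: "set_integrable lborel {s..t} (\<lambda>r. F r (g r))"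
    and e: "g t = x + (LINT r:{s..t}|lborel. F r (g r)) + m t - m s"
    using assms unfolding driven_sol_def by blast+
  show "(\<lambda>r. F r (g r)) integrable_on {s..t}"
    and "g t = x + integral {s..t} (\<lambda>r. F r (g r)) + m t - m s"
    using set_borel_integral_eq_integral[OF i] e by simp_all
qed

lemma driven_sol_subset:
  assumes "driven_sol F m s x J g" "I \<subseteq> J"
  shows "driven_sol F m s x I g"
  using assms unfolding driven_sol_def by blast

lemma driven_sol_start:
  assumes "driven_sol F m s x I g" "s \<in> I"
  shows "g s = x"
  using driven_solD(4)[OF assms] by simp

lemma driven_sol_cong:
  assumes "driven_sol F m s x {s..t} g" "\<And>r. r \<in> {s..t} \<Longrightarrow> g r = h r"
  shows "driven_sol F m s x {s..t} h"
  unfolding driven_sol_def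
proof (intro ballI conjI)
  fix u assume u: "u \<in> {s..t}"
  have i: "set_integrable lborel {s..u} (\<lambda>r. F r (g r))"
    and e: "g u = x + (LINT r:{s..u}|lborel. F r (g r)) + m u - m s"
    using driven_solD(1,2)[OF assms(1) u] .
  show "set_integrable lborel {s..u} (\<lambda>r. F r (h r))"
    using i u assms(2) by (subst set_integrable_cong[where f'="\<lambda>r. F r (g r)"]) auto
  have "(LINT r:{s..u}|lborel. F r (h r)) = (LINT r:{s..u}|lborel. F r (g r))"
    using u assms(2) by (intro set_lebesgue_integral_cong) auto
  then show "h u = x + (LINT r:{s..u}|lborel. F r (h r)) + m u - m s"
    using e assms(2)[OF u] by simp
qed

lemma driven_sol_increment:
  assumes "driven_sol F m s x {s..t} g" "s \<le> u" "u \<le> v" "v \<le> t"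
  shows "(\<lambda>r. F r (g r)) integrable_on {u..v}"
    and "g v = g u + integral {u..v} (\<lambda>r. F r (g r)) + m v - m u"
proof -
  have uv: "u \<in> {s..t}" "v \<in> {s..t}" using assms by auto
  note v = driven_solD(3,4)[OF assms(1) uv(2)] and u = driven_solD(4)[OF assms(1) uv(1)]
  show "(\<lambda>r. F r (g r)) integrable_on {u..v}"
    by (rule integrable_subinterval_real[OF v(1)]) (use assms(2) in auto)
  show "g v = g u + integral {u..v} (\<lambda>r. F r (g r)) + m v - m u"
    unfolding v(2) u Henstock_Kurzweil_Integration.integral_combine[OF assms(2,3) v(1), symmetric] by simp
qed

lemma driven_sol_restart:
  assumes "driven_sol F m s x {s..t} g" "s \<le> u" "u \<le> t"
  shows "driven_sol F m u (g u) {u..t} g"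
  unfolding driven_sol_def
proof (intro ballI conjI)
  fix v assume v: "v \<in> {u..t}"
  show i: "set_integrable lborel {u..v} (\<lambda>r. F r (g r))"
    by (rule set_integrable_subset[OF driven_solD(1)[OF assms(1)], of v]) (use assms v in auto)
  show "g v = g u + (LINT r:{u..v}|lborel. F r (g r)) + m v - m u"
    unfolding set_borel_integral_eq_integral(2)[OF i]
    by (rule driven_sol_increment(2)[OF assms(1,2)]) (use v in auto)
qed

text \<open>The two pieces share the value at \<open>u\<close>, so the integral splits there and the
  noise increments telescope. This is the pathwise part of the cocycle identity: the pasted path
  solves the equation from the original start.\<close>

lemma driven_sol_concat:
  assumes g: "driven_sol F m s x {s..u} g" and h: "driven_sol F m u (g u) {u..t} h" and "s \<le> u" "u \<le> t"
  shows "driven_sol F m s x {s..t} (\<lambda>r. if r \<le> u then g r else h r)"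
proof -
  define k where "k = (\<lambda>r. if r \<le> u then g r else h r)"
  have hu: "h u = g u"
    using driven_sol_start[OF h] \<open>u \<le> t\<close> by simp
  have k1: "driven_sol F m s x {s..u} k"
    by (rule driven_sol_cong[OF g]) (simp add: k_def)
  have k2: "driven_sol F m u (g u) {u..t} k"
    by (rule driven_sol_cong[OF h]) (use hu in \<open>auto simp: k_def\<close>)
  have "driven_sol F m s x {s..t} k"
    unfolding driven_sol_def
  proof (intro ballI conjI)
    fix v assume v: "v \<in> {s..t}"
    show i: "set_integrable lborel {s..v} (\<lambda>r. F r (k r))"
    proof (cases "v \<le> u")
      case True
      then show ?thesis using driven_solD(1,2)[OF k1, of v] v by simp
    next
      case False
      have "set_integrable lborel {s..u} (\<lambda>r. F r (k r))" "set_integrable lborel {u..v} (\<lambda>r. F r (k r))"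
        using driven_solD(1)[OF k1, of u] driven_solD(1)[OF k2, of v] v False \<open>s \<le> u\<close> by simp_all
      then have "set_integrable lborel ({s..u} \<union> {u..v}) (\<lambda>r. F r (k r))"
        by (rule set_integrable_Un) auto
      moreover have "{s..u} \<union> {u..v} = {s..v}"
        using False \<open>s \<le> u\<close> by auto
      ultimately show ?thesis by simp
    qed
    show "k v = x + (LINT r:{s..v}|lborel. F r (k r)) + m v - m s"
    proof (cases "v \<le> u")
      case True
      then show ?thesis using driven_solD(1,2)[OF k1, of v] v by simp
    next
      case False
      have 1: "k v = k u + integral {u..v} (\<lambda>r. F r (k r)) + m v - m u"
        by (rule driven_sol_increment(2)[OF k2]) (use False v in auto)
      have 2: "k u = k s + integral {s..u} (\<lambda>r. F r (k r)) + m u - m s"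
        by (rule driven_sol_increment(2)[OF k1]) (use \<open>s \<le> u\<close> in auto)
      have 3: "k s = x"
        by (rule driven_sol_start[OF k1]) (use \<open>s \<le> u\<close> in auto)
      have 4: "integral {s..v} (\<lambda>r. F r (k r)) = integral {s..u} (\<lambda>r. F r (k r)) + integral {u..v} (\<lambda>r. F r (k r))"
        by (rule Henstock_Kurzweil_Integration.integral_combine[symmetric])
          (use False \<open>s \<le> u\<close> set_borel_integral_eq_integral(1)[OF i] in auto)
      show ?thesis
        unfolding set_borel_integral_eq_integral(2)[OF i] 4 1 2 3 by simp
    qed
  qed
  then show ?thesis
    by (simp only: k_def)
qed

section \<open>Bounds for cadlag paths and for solutions\<close>

lemma norm_integral_le_const:
  fixes f :: "real \<Rightarrow> 'v::euclidean_space"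
  assumes "f integrable_on {u..v}" "u \<le> v" "\<And>r. r \<in> {u..v} \<Longrightarrow> norm (f r) \<le> B"
  shows "norm (integral {u..v} f) \<le> B * (v - u)"
proof -
  have "norm (integral {u..v} f) \<le> integral {u..v} (\<lambda>_. B)"
    using assms by (intro integral_norm_bound_integral) auto
  then show ?thesis using assms(2) by (simp add: mult.commute)
qed

text \<open>One-sided limits bound the path near each point, and compactness leaves finitely many
  neighbourhoods. The sum of the local bounds, rather than their maximum, also covers an empty
  interval.\<close>

lemma cadlag_on_bounded:
  fixes m :: "real \<Rightarrow> 'v::real_normed_vector"
  assumes "cadlag_on {a..b} m"
  shows "\<exists>B\<ge>0. \<forall>t\<in>{a..b}. norm (m t) \<le> B"
proof -
  have loc: "\<exists>U B. open U \<and> t \<in> U \<and> (\<forall>u\<in>U \<inter> {a..b}. norm (m u) \<le> B)" if t: "t \<in> {a..b}" for t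
  proof -
    have r: "(m \<longlongrightarrow> m t) (at t within ({a..b} \<inter> {t<..}))"
      using assms t by (auto simp: cadlag_on_def)
    obtain l where l: "(m \<longlongrightarrow> l) (at t within ({a..b} \<inter> {..<t}))"
      using assms t unfolding cadlag_on_def by blast
    have "eventually (\<lambda>u. norm (m u) \<le> norm (m t) + 1) (at t within ({a..b} \<inter> {t<..}))"
      using order_tendstoD(2)[OF tendsto_norm[OF r], of "norm (m t) + 1"]
      by (auto elim: eventually_mono)
    then obtain d1 where d1: "d1 > 0"
      "\<And>u. u \<in> {a..b} \<Longrightarrow> u > t \<Longrightarrow> dist u t < d1 \<Longrightarrow> norm (m u) \<le> norm (m t) + 1"
      by (auto simp: eventually_at)
    have "eventually (\<lambda>u. norm (m u) \<le> norm l + 1) (at t within ({a..b} \<inter> {..<t}))"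
      using order_tendstoD(2)[OF tendsto_norm[OF l], of "norm l + 1"]
      by (auto elim: eventually_mono)
    then obtain d2 where d2: "d2 > 0"
      "\<And>u. u \<in> {a..b} \<Longrightarrow> u < t \<Longrightarrow> dist u t < d2 \<Longrightarrow> norm (m u) \<le> norm l + 1"
      by (auto simp: eventually_at)
    have "\<forall>u\<in>ball t (min d1 d2) \<inter> {a..b}. norm (m u) \<le> norm (m t) + norm l + 1"
    proof
      fix u assume u: "u \<in> ball t (min d1 d2) \<inter> {a..b}"
      show "norm (m u) \<le> norm (m t) + norm l + 1"
        using d1(2)[of u] d2(2)[of u] u norm_ge_zero[of l] norm_ge_zero[of "m t"]
        by (cases u t rule: linorder_cases) (simp_all add: dist_commute del: norm_ge_zero)
    qed
    then show ?thesis
      using d1(1) d2(1) by (intro exI[of _ "ball t (min d1 d2)"] exI) auto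
  qed
  then obtain U B where UB: "\<And>t. t \<in> {a..b} \<Longrightarrow> open (U t) \<and> t \<in> U t \<and> (\<forall>u\<in>U t \<inter> {a..b}. norm (m u) \<le> B t)"
    by metis
  obtain C where C: "C \<subseteq> {a..b}" "finite C" "{a..b} \<subseteq> (\<Union>c\<in>C. U c)"
    by (rule compactE_image[OF compact_Icc[of a b], of "{a..b}" U]) (use UB in auto)
  show ?thesis
  proof (intro exI[of _ "\<Sum>c\<in>C. \<bar>B c\<bar>"] conjI ballI sum_nonneg)
    fix t assume t: "t \<in> {a..b}"
    then obtain c where c: "c \<in> C" "t \<in> U c" using C by auto
    then have "norm (m t) \<le> B c" using UB[of c] t C(1) by blast
    then have "norm (m t) \<le> \<bar>B c\<bar>" by simp
    also have "\<dots> \<le> (\<Sum>c\<in>C. \<bar>B c\<bar>)" by (rule member_le_sum) (use c C in auto)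
    finally show "norm (m t) \<le> (\<Sum>c\<in>C. \<bar>B c\<bar>)" .
  qed auto
qed

text \<open>The summand \<open>a * norm (z - z')\<close> stands for the linear term of the drift:
  for \<beta> < 1 no \<beta>-Hoelder bound covers a nonzero linear map on all of space.\<close>

locale driven_ode =
  fixes T :: real and F :: "real \<Rightarrow> 'v::euclidean_space \<Rightarrow> 'v" and m :: "real \<Rightarrow> 'v"
    and K a C \<beta> :: real
  assumes T_pos: "0 < T" and K_nonneg: "0 \<le> K" and a_nonneg: "0 \<le> a" and C_nonneg: "0 \<le> C"
    and growth: "\<And>t z. t \<in> {0..T} \<Longrightarrow> norm (F t z) \<le> K + a * norm z"
    and holder: "\<And>t z z'. t \<in> {0..T} \<Longrightarrow> norm (F t z - F t z') \<le> C * norm (z - z') powr \<beta> + a * norm (z - z')"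
    and \<beta>_pos: "0 < \<beta>" and \<beta>_le_1: "\<beta> \<le> 1"
    and m_cadlag: "cadlag_on {0..T} m"
begin

abbreviation "sol \<equiv> driven_sol F m"

text \<open>A Gronwall estimate through the weighted supremum \<open>N\<close> of
  \<open>exp (- \<Lambda> * (v - s)) * norm (g v)\<close>: the drift integral contributes at most
  \<open>N / 2\<close>, which is absorbed. The resulting bound is the same for all solutions and
  intervals, as the compactness and uniqueness arguments require.\<close>

lemma sol_bound:
  assumes "0 \<le> R"
  shows "\<exists>G\<ge>0. \<forall>s t x g u. 0 \<le> s \<longrightarrow> t \<le> T \<longrightarrow> sol s x {s..t} g \<longrightarrow> norm x \<le> R \<longrightarrow> u \<in> {s..t} \<longrightarrow> norm (g u) \<le> G"
proof -
  obtain B where B: "B \<ge> 0" "\<And>t. t \<in> {0..T} \<Longrightarrow> norm (m t) \<le> B"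
    using cadlag_on_bounded[OF m_cadlag] by blast
  \<comment> \<open>This rate makes \<open>a / \<Lambda> \<le> 1/2\<close>, the factor in front of
    \<open>N\<close>; the added 1 keeps it positive when \<open>a = 0\<close>.\<close>
  define \<Lambda> where "\<Lambda> = 2 * a + 1"
  have \<Lambda>: "\<Lambda> > 0" using a_nonneg by (simp add: \<Lambda>_def)
  define c where "c = R + K * T + 2 * B"
  have c0: "c \<ge> 0" using assms K_nonneg T_pos B by (simp add: c_def)
  show ?thesis
  proof (intro exI[of _ "2 * c * exp (\<Lambda> * T)"] conjI allI impI)
    fix s t x g u
    assume s: "0 \<le> s" and t: "t \<le> T" and g: "sol s x {s..t} g" and x: "norm x \<le> R" and u: "u \<in> {s..t}"
    have gs: "g s = x" using driven_sol_start[OF g] u by auto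
    have inc: "(\<lambda>r. F r (g r)) integrable_on {s..v}" "g v = x + integral {s..v} (\<lambda>r. F r (g r)) + m v - m s"
      if "v \<in> {s..t}" for v
      using driven_sol_increment[OF g, of s v] that gs by auto
    \<comment> \<open>The bound \<open>D\<close> obtained here depends on \<open>g\<close>. It
      serves to make the supremum \<open>N\<close> finite, without which absorbing
      \<open>N / 2\<close> would prove nothing.\<close>
    have "continuous_on {s..t} (\<lambda>v. integral {s..v} (\<lambda>r. F r (g r)))"
      by (intro indefinite_integral_continuous_1 inc) (use u in auto)
    then have "bounded ((\<lambda>v. integral {s..v} (\<lambda>r. F r (g r))) ` {s..t})"
      by (intro compact_imp_bounded compact_continuous_image) auto
    then obtain D where D: "\<And>v. v \<in> {s..t} \<Longrightarrow> norm (integral {s..v} (\<lambda>r. F r (g r))) \<le> D"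
      unfolding bounded_iff by blast
    have gbd: "norm (g v) \<le> R + D + 2 * B" if v: "v \<in> {s..t}" for v
    proof -
      have "norm (g v) \<le> norm x + norm (integral {s..v} (\<lambda>r. F r (g r))) + norm (m v) + norm (m s)"
        unfolding inc(2)[OF v] by norm
      then show ?thesis
        using D[OF v] B(2)[of v] B(2)[of s] x v s t u by auto
    qed
    define N where "N = (SUP v\<in>{s..t}. exp (- \<Lambda> * (v - s)) * norm (g v))"
    have bdd: "bdd_above ((\<lambda>v. exp (- \<Lambda> * (v - s)) * norm (g v)) ` {s..t})"
    proof (rule bdd_aboveI2[of _ _ "1 * (R + D + 2 * B)"])
      fix v assume v: "v \<in> {s..t}"
      show "exp (- \<Lambda> * (v - s)) * norm (g v) \<le> 1 * (R + D + 2 * B)"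
        using v \<Lambda> gbd[OF v] by (intro mult_mono) (auto simp: mult_nonneg_nonneg)
    qed
    have N: "norm (g v) \<le> N * exp (\<Lambda> * (v - s))" if v: "v \<in> {s..t}" for v
    proof -
      have "exp (- \<Lambda> * (v - s)) * norm (g v) \<le> N"
        unfolding N_def by (rule cSUP_upper[OF v bdd])
      then have "exp (- \<Lambda> * (v - s)) * norm (g v) * exp (\<Lambda> * (v - s)) \<le> N * exp (\<Lambda> * (v - s))"
        by (intro mult_right_mono) auto
      moreover have "exp (- \<Lambda> * (v - s)) * norm (g v) * exp (\<Lambda> * (v - s)) = norm (g v)"
        by (simp add: exp_minus)
      ultimately show ?thesis by (simp only:)
    qed
    have "0 \<le> N * exp (\<Lambda> * (s - s))"
      by (rule order_trans[OF norm_ge_zero N]) (use u in auto)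
    then have N0: "N \<ge> 0" by simp
    have "N \<le> c + N / 2"
      unfolding N_def
    proof (rule cSUP_least)
      show "{s..t} \<noteq> {}" using u by auto
      fix v assume v: "v \<in> {s..t}"
      have he: "((\<lambda>r. K + a * (N * exp (\<Lambda> * (r - s)))) has_integral
          ((K * v + a * N * exp (\<Lambda> * (v - s)) / \<Lambda>) - (K * s + a * N * exp (\<Lambda> * (s - s)) / \<Lambda>))) {s..v}"
        using \<Lambda> v by (intro fundamental_theorem_of_calculus)
          (auto simp flip: has_real_derivative_iff_has_vector_derivative intro!: derivative_eq_intros)
      have "norm (integral {s..v} (\<lambda>r. F r (g r))) \<le> integral {s..v} (\<lambda>r. K + a * (N * exp (\<Lambda> * (r - s))))"
      proof (rule integral_norm_bound_integral)
        fix r assume r: "r \<in> {s..v}"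
        have "norm (F r (g r)) \<le> K + a * norm (g r)" using growth[of r] r s t v by auto
        also have "\<dots> \<le> K + a * (N * exp (\<Lambda> * (r - s)))"
          using N[of r] r v a_nonneg by (intro add_left_mono mult_left_mono) auto
        finally show "norm (F r (g r)) \<le> K + a * (N * exp (\<Lambda> * (r - s)))" .
      qed (use inc(1)[OF v] he in auto)
      also have "\<dots> = K * (v - s) + (a / \<Lambda>) * N * (exp (\<Lambda> * (v - s)) - 1)"
        using integral_unique[OF he] by (simp add: algebra_simps diff_divide_distrib)
      also have "\<dots> \<le> K * T + (1/2) * N * exp (\<Lambda> * (v - s))"
      proof (intro add_mono mult_mono mult_left_mono)
        show "a / \<Lambda> \<le> 1/2" using \<Lambda> by (simp add: \<Lambda>_def field_simps)
        show "0 \<le> exp (\<Lambda> * (v - s)) - 1" using \<Lambda> v by simp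
      qed (use K_nonneg v s t N0 in auto)
      finally have i: "norm (integral {s..v} (\<lambda>r. F r (g r))) \<le> K * T + N / 2 * exp (\<Lambda> * (v - s))" by simp
      have "norm (g v) \<le> norm x + norm (integral {s..v} (\<lambda>r. F r (g r))) + norm (m v) + norm (m s)"
        unfolding inc(2)[OF v] by norm
      then have g1: "norm (g v) \<le> c + N / 2 * exp (\<Lambda> * (v - s))"
        using i B(2)[of v] B(2)[of s] x v s t u by (auto simp: c_def)
      have e1: "exp (- \<Lambda> * (v - s)) \<le> 1" using \<Lambda> v by (simp add: mult_nonneg_nonneg)
      have "exp (- \<Lambda> * (v - s)) * norm (g v) \<le> exp (- \<Lambda> * (v - s)) * (c + N / 2 * exp (\<Lambda> * (v - s)))"
        using g1 by (intro mult_left_mono) auto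
      also have "\<dots> = exp (- \<Lambda> * (v - s)) * c + N / 2"
      proof -
        have "exp (- \<Lambda> * (v - s)) * exp (\<Lambda> * (v - s)) = 1" by (simp flip: exp_add)
        then show ?thesis by (simp only: distrib_left) (simp add: mult.left_commute)
      qed
      also have "\<dots> \<le> 1 * c + N / 2"
        using e1 c0 by (intro add_mono mult_right_mono) auto
      finally show "exp (- \<Lambda> * (v - s)) * norm (g v) \<le> c + (SUP v\<in>{s..t}. exp (- \<Lambda> * (v - s)) * norm (g v)) / 2"
        by (simp add: N_def)
    qed
    then have "N \<le> 2 * c" by simp
    then have "norm (g u) \<le> 2 * c * exp (\<Lambda> * (u - s))"
      using N[OF u] by (meson exp_ge_zero mult_right_mono order_trans)
    also have "\<dots> \<le> 2 * c * exp (\<Lambda> * T)"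
      using c0 \<Lambda> u s t by (intro mult_left_mono) auto
    finally show "norm (g u) \<le> 2 * c * exp (\<Lambda> * T)" .
  qed (use c0 in auto)
qed

lemma F_along_bound:
  assumes "t \<in> {0..T}" "norm z \<le> G"
  shows "norm (F t z) \<le> K + a * G"
  using growth[OF assms(1), of z] mult_left_mono[OF assms(2) a_nonneg] by simp

text \<open>The integral equation is used twice. Boundedness of the drift gives a difference of
  order \<open>s - r\<close>; fed into the Hoelder condition, this bounds the integrand by a
  multiple of \<open>(s - r) powr \<beta>\<close>, and integration yields the exponent
  \<open>1 + \<beta>\<close>.\<close>

lemma sol_difference:
  assumes "0 \<le> G"
  shows "\<exists>c\<ge>0. \<forall>r s y g h. 0 \<le> r \<longrightarrow> r \<le> s \<longrightarrow> s \<le> T \<longrightarrow> sol r y {r..s} g \<longrightarrow> sol r y {r..s} h \<longrightarrow>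
     (\<forall>u\<in>{r..s}. norm (g u) \<le> G \<and> norm (h u) \<le> G) \<longrightarrow> norm (g s - h s) \<le> c * (s - r) powr (1 + \<beta>)"
proof -
  define l where "l = 2 * (K + a * G)"
  have l0: "l \<ge> 0" using K_nonneg a_nonneg assms by (simp add: l_def)
  define c where "c = C * l powr \<beta> + a * (l * T powr (1 - \<beta>))"
  have c0: "c \<ge> 0" using l0 C_nonneg a_nonneg by (simp add: c_def)
  show ?thesis
  proof (intro exI[of _ c] conjI allI impI)
    fix r s y g h
    assume r: "0 \<le> r" "r \<le> s" "s \<le> T" and g: "sol r y {r..s} g" and h: "sol r y {r..s} h"
      and bd: "\<forall>u\<in>{r..s}. norm (g u) \<le> G \<and> norm (h u) \<le> G"
    have inc: "g u - h u = integral {r..u} (\<lambda>v. F v (g v) - F v (h v))"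
      "(\<lambda>v. F v (g v) - F v (h v)) integrable_on {r..u}" if u: "u \<in> {r..s}" for u
      using driven_sol_increment[OF g, of r u] driven_sol_increment[OF h, of r u] u
        driven_sol_start[OF g] driven_sol_start[OF h]
      by (auto simp: Henstock_Kurzweil_Integration.integral_diff intro: integrable_diff)
    have lip: "norm (g u - h u) \<le> l * (s - r)" if u: "u \<in> {r..s}" for u
    proof -
      have "norm (g u - h u) \<le> l * (u - r)"
        unfolding inc(1)[OF u]
      proof (rule norm_integral_le_const[OF inc(2)[OF u]])
        fix v assume v: "v \<in> {r..u}"
        then have "norm (F v (g v)) \<le> K + a * G" "norm (F v (h v)) \<le> K + a * G"
          using u r bd by (auto intro!: F_along_bound)
        then show "norm (F v (g v) - F v (h v)) \<le> l"
          using norm_triangle_ineq4[of "F v (g v)" "F v (h v)"] by (simp add: l_def)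
      qed (use u in auto)
      also have "\<dots> \<le> l * (s - r)" using l0 u by (intro mult_left_mono) auto
      finally show ?thesis .
    qed
    show "norm (g s - h s) \<le> c * (s - r) powr (1 + \<beta>)"
    proof (cases "r = s")
      case True
      then show ?thesis using lip[of s] r by simp
    next
      case False
      define \<delta> where "\<delta> = s - r"
      have \<delta>: "0 < \<delta>" "\<delta> \<le> T" using False r by (auto simp: \<delta>_def)
      \<comment> \<open>As the interval has length at most \<open>T\<close>, the Lipschitz
        contribution of order \<delta> is absorbed into the order
        \<open>\<delta> powr \<beta>\<close>.\<close>
      have pw: "\<delta> powr 1 \<le> T powr (1 - \<beta>) * \<delta> powr \<beta>"
      proof -
        have "\<delta> powr 1 = \<delta> powr (1 - \<beta>) * \<delta> powr \<beta>" by (simp flip: powr_add)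
        also have "\<dots> \<le> T powr (1 - \<beta>) * \<delta> powr \<beta>"
          using \<beta>_le_1 \<delta> by (intro mult_right_mono powr_mono2) auto
        finally show ?thesis .
      qed
      have "norm (g s - h s) \<le> (c * \<delta> powr \<beta>) * (s - r)"
        unfolding inc(1)[of s, simplified, OF r(2)]
      proof (rule norm_integral_le_const)
        show "(\<lambda>v. F v (g v) - F v (h v)) integrable_on {r..s}" using inc(2)[of s] r by auto
        fix v assume v: "v \<in> {r..s}"
        have "norm (F v (g v) - F v (h v)) \<le> C * norm (g v - h v) powr \<beta> + a * norm (g v - h v)"
          using holder[of v] v r by auto
        also have "\<dots> \<le> C * (l * \<delta>) powr \<beta> + a * (l * \<delta>)"
          using lip[OF v] C_nonneg a_nonneg \<beta>_pos
          by (intro add_mono mult_left_mono powr_mono2) (auto simp: \<delta>_def)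
        also have "\<dots> = C * (l powr \<beta> * \<delta> powr \<beta>) + a * (l * \<delta> powr 1)"
          using \<delta> l0 by (simp add: powr_mult)
        also have "\<dots> \<le> C * (l powr \<beta> * \<delta> powr \<beta>) + a * (l * (T powr (1 - \<beta>) * \<delta> powr \<beta>))"
          using C_nonneg a_nonneg l0 pw by (intro add_mono mult_left_mono) auto
        also have "\<dots> = c * \<delta> powr \<beta>" by (simp add: c_def algebra_simps)
        finally show "norm (F v (g v) - F v (h v)) \<le> c * \<delta> powr \<beta>" .
      qed (use r in auto)
      also have "\<dots> = c * \<delta> powr (1 + \<beta>)"
        using \<delta> by (simp add: powr_add \<delta>_def[symmetric])
      finally show ?thesis by (simp add: \<delta>_def )
    qed
  qed (use c0 in auto)
qed

end

section \<open>Compactness of the set of solutions\<close>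

text \<open>The times \<open>r k\<close> may equal \<open>s\<close>, a point that the right limit
  ignores; adding \<open>s\<close> to the set leaves the filter unchanged and turns the limit into
  continuity at \<open>s\<close>.\<close>

lemma cadlag_on_right_sequentially:
  assumes "cadlag_on {a..b} m" "s \<in> {a..b}" "\<And>k. r k \<in> {s..b}" "r \<longlonglongrightarrow> s"
  shows "(\<lambda>k. m (r k)) \<longlonglongrightarrow> m s"
proof -
  have "(m \<longlongrightarrow> m s) (at s within ({a..b} \<inter> {s<..}))"
    using assms(1,2) by (auto simp: cadlag_on_def)
  then have "(m \<longlongrightarrow> m s) (at s within insert s ({a..b} \<inter> {s<..}))"
    by (simp add: at_within_def)
  then have "continuous (at s within insert s ({a..b} \<inter> {s<..})) m"
    by (simp add: continuous_within)
  moreover have "r k \<in> insert s ({a..b} \<inter> {s<..})" for k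
    using assms(2) assms(3)[of k] by auto
  ultimately show ?thesis
    using assms(4) unfolding continuous_within_sequentially o_def by blast
qed

context driven_ode
begin

lemma holder_tendsto:
  assumes "t \<in> {0..T}" "z \<longlonglongrightarrow> z0"
  shows "(\<lambda>k. F t (z k)) \<longlonglongrightarrow> F t z0"
proof -
  have n: "(\<lambda>k. norm (z k - z0)) \<longlonglongrightarrow> 0"
    using assms(2) by (simp add: tendsto_norm_zero LIM_zero)
  have "(\<lambda>k. norm (z k - z0) powr \<beta>) \<longlonglongrightarrow> 0"
    by (rule tendsto_zero_powrI[OF n tendsto_const]) (use \<beta>_pos in auto)
  then have "(\<lambda>k. C * norm (z k - z0) powr \<beta> + a * norm (z k - z0)) \<longlonglongrightarrow> 0"
    using n by (intro tendsto_add_zero tendsto_mult_right_zero)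
  then have "(\<lambda>k. F t (z k) - F t z0) \<longlonglongrightarrow> 0"
    by (rule Lim_null_comparison[rotated]) (use holder[OF assms(1)] in auto)
  then show ?thesis by (rule LIM_zero_cancel)
qed

text \<open>Solutions jump with the noise, but a solution minus the noise does not: frozen before
  \<open>sk k\<close>, it is Lipschitz uniformly in \<open>k\<close>, so Arzela-Ascoli applies. The
  value \<open>c\<close> is \<open>m s\<close> for an approach from the right and the left limit of
  \<open>m\<close> for an approach from the left; the term \<open>m s - c\<close> in the initial
  value is the jump at \<open>s\<close> that the approximating solutions make after their
  start.\<close>

lemma sol_compactness:
  assumes sk: "\<And>k. sk k \<in> {0..T}" "sk \<longlonglongrightarrow> s" and xk: "xk \<longlonglongrightarrow> x"
    and mk: "(\<lambda>k. m (sk k)) \<longlonglongrightarrow> c"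
    and zk: "\<And>k. sol (sk k) (xk k) {sk k..T} (zk k)"
  obtains \<phi> y where "strict_mono (\<phi> :: nat \<Rightarrow> nat)"
    "uniform_limit {0..T} (\<lambda>j t. if t \<le> sk (\<phi> j) then xk (\<phi> j) else zk (\<phi> j) t - m t + m (sk (\<phi> j))) y sequentially"
    "\<And>t. t \<in> {0..s} \<Longrightarrow> y t = x"
    "sol s (x + m s - c) {s..T} (\<lambda>t. y t + m t - c)"
proof -
  have s: "s \<in> {0..T}"
    using closed_sequentially[OF closed_atLeastAtMost, OF _ sk(2)] sk(1) by blast
  obtain R where R: "\<And>k. norm (xk k) \<le> R"
    using convergent_imp_bounded[OF xk] by (auto simp: bounded_iff)
  have "0 \<le> R" using R[of 0] norm_ge_zero[of "xk 0"] by linarith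
  from sol_bound[OF this] obtain G where G0: "G \<ge> 0" and G: "\<And>s t x g u. 0 \<le> s \<Longrightarrow> t \<le> T \<Longrightarrow> sol s x {s..t} g \<Longrightarrow>
      norm x \<le> R \<Longrightarrow> u \<in> {s..t} \<Longrightarrow> norm (g u) \<le> G"
    by blast
  define \<Lambda> where "\<Lambda> = K + a * G"
  have \<Lambda>: "\<Lambda> \<ge> 0" using K_nonneg a_nonneg G0 by (simp add: \<Lambda>_def)
  have fb: "norm (F r (zk k r)) \<le> \<Lambda>" if "r \<in> {sk k..T}" for k r
    unfolding \<Lambda>_def by (rule F_along_bound) (use that sk(1)[of k] G[OF _ _ zk R] in auto)
  define Y where "Y k t = (if t \<le> sk k then xk k else zk k t - m t + m (sk k))" for k t
  have Yi: "Y k t = xk k + integral {sk k..t} (\<lambda>r. F r (zk k r))" if "t \<in> {sk k..T}" for k t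
  proof (cases "t = sk k")
    case False
    then show ?thesis
      using driven_solD(4)[OF zk that] that unfolding Y_def by (simp add: algebra_simps)
  qed (simp add: Y_def)
  have Yinc: "norm (Y k v - Y k u) \<le> \<Lambda> * (v - u)" if "sk k \<le> u" "u \<le> v" "v \<le> T" for k u v
  proof -
    have i: "(\<lambda>r. F r (zk k r)) integrable_on {sk k..v}"
      by (rule driven_solD(3)[OF zk]) (use that in auto)
    have "Y k v - Y k u = integral {u..v} (\<lambda>r. F r (zk k r))"
      using Yi[of v k] Yi[of u k] that Henstock_Kurzweil_Integration.integral_combine[OF that(1,2) i]
      by (auto simp: algebra_simps)
    also have "norm \<dots> \<le> \<Lambda> * (v - u)"
      by (rule norm_integral_le_const)
        (use that fb in \<open>auto intro: integrable_subinterval_real[OF i]\<close>)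
    finally show ?thesis .
  qed
  \<comment> \<open>Freezing before \<open>sk k\<close> amounts to replacing \<open>t\<close> by
    \<open>max t (sk k)\<close>, a 1-Lipschitz change of time, so the estimate \<open>Yinc\<close>
    extends to all of \<open>{0..T}\<close>.\<close>
  have Ymax: "Y k t = Y k (max t (sk k))" for k t
    by (auto simp: Y_def max_def)
  have Ylip': "norm (Y k v - Y k u) \<le> \<Lambda> * \<bar>max v (sk k) - max u (sk k)\<bar>" if "u \<le> v" "v \<le> T" for k u v
  proof -
    have "norm (Y k v - Y k u) = norm (Y k (max v (sk k)) - Y k (max u (sk k)))"
      by (simp only: Ymax[of k u, symmetric] Ymax[of k v, symmetric])
    also have "\<dots> \<le> \<Lambda> * (max v (sk k) - max u (sk k))"
      by (rule Yinc) (use that sk(1)[of k] in auto)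
    also have "\<dots> \<le> \<Lambda> * \<bar>max v (sk k) - max u (sk k)\<bar>"
      using \<Lambda> by (intro mult_left_mono) auto
    finally show ?thesis .
  qed
  have Ylip: "norm (Y k v - Y k u) \<le> \<Lambda> * \<bar>v - u\<bar>" if "u \<in> {0..T}" "v \<in> {0..T}" for k u v
  proof -
    have *: "norm (Y k v - Y k u) \<le> \<Lambda> * \<bar>v - u\<bar>" if "u \<in> {0..T}" "v \<in> {0..T}" "u \<le> v" for u v
    proof -
      have "norm (Y k v - Y k u) \<le> \<Lambda> * \<bar>max v (sk k) - max u (sk k)\<bar>"
        using that by (intro Ylip') auto
      also have "\<dots> \<le> \<Lambda> * \<bar>v - u\<bar>"
        using that \<Lambda> by (intro mult_left_mono) auto
      finally show ?thesis .
    qed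
    show ?thesis
      using *[of u v] *[of v u] that by (cases "u \<le> v") (auto simp: norm_minus_commute abs_minus_commute)
  qed
  have Ysk: "Y k (sk k) = xk k" for k by (simp add: Y_def)
  have Ybd: "norm (Y k t) \<le> R + \<Lambda> * T" if "t \<in> {0..T}" for k t
  proof -
    have "norm (Y k t - Y k (sk k)) \<le> \<Lambda> * \<bar>t - sk k\<bar>" using that sk(1) by (intro Ylip) auto
    also have "\<dots> \<le> \<Lambda> * T" using that sk(1)[of k] \<Lambda> by (intro mult_left_mono) auto
    finally show ?thesis
      using R[of k] norm_triangle_sub[of "Y k t" "xk k"] by (simp add: Ysk)
  qed
  obtain y and \<phi> :: "nat \<Rightarrow> nat" where y: "continuous_on {0..T} y" "strict_mono \<phi>"
    "\<And>e. 0 < e \<Longrightarrow> \<exists>N. \<forall>n t. n \<ge> N \<and> t \<in> {0..T} \<longrightarrow> norm (Y (\<phi> n) t - y t) < e"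
  proof (rule Arzela_Ascoli[of "{0..T}" Y "R + \<Lambda> * T"])
    fix t e :: real assume t: "t \<in> {0..T}" and e: "0 < e"
    show "\<exists>d>0. \<forall>n v. v \<in> {0..T} \<and> norm (t - v) < d \<longrightarrow> norm (Y n t - Y n v) < e"
    proof (intro exI[of _ "e / (\<Lambda> + 1)"] conjI allI impI)
      fix n v assume v: "v \<in> {0..T} \<and> norm (t - v) < e / (\<Lambda> + 1)"
      have "norm (Y n t - Y n v) \<le> \<Lambda> * \<bar>t - v\<bar>" using v t by (intro Ylip) auto
      also have "\<dots> \<le> (\<Lambda> + 1) * \<bar>t - v\<bar>" by (simp add: distrib_right)
      also have "\<dots> < e" using v \<Lambda> by (simp add: field_simps)
      finally show "norm (Y n t - Y n v) < e" .
    qed (use e \<Lambda> in auto)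
  qed (use Ybd in auto)
  have ul: "uniform_limit {0..T} (\<lambda>j. Y (\<phi> j)) y sequentially"
    unfolding uniform_limit_sequentially_iff dist_norm using y(3) by blast
  have lim: "(\<lambda>j. Y (\<phi> j) t) \<longlonglongrightarrow> y t" if "t \<in> {0..T}" for t
    by (rule tendsto_uniform_limitI[OF ul that])
  have s\<phi>: "(\<lambda>j. sk (\<phi> j)) \<longlonglongrightarrow> s" and x\<phi>: "(\<lambda>j. xk (\<phi> j)) \<longlonglongrightarrow> x" and m\<phi>: "(\<lambda>j. m (sk (\<phi> j))) \<longlonglongrightarrow> c"
    using LIMSEQ_subseq_LIMSEQ[OF sk(2) y(2)] LIMSEQ_subseq_LIMSEQ[OF xk y(2)] LIMSEQ_subseq_LIMSEQ[OF mk y(2)]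
    by (simp_all add: o_def)
  have yx: "y t = x" if t: "t \<in> {0..s}" for t
  proof -
    have "(\<lambda>j. Y (\<phi> j) t - xk (\<phi> j)) \<longlonglongrightarrow> 0"
    proof (rule Lim_null_comparison)
      show "eventually (\<lambda>j. norm (Y (\<phi> j) t - xk (\<phi> j)) \<le> \<Lambda> * \<bar>s - sk (\<phi> j)\<bar>) sequentially"
      proof (intro always_eventually allI)
        fix j
        show "norm (Y (\<phi> j) t - xk (\<phi> j)) \<le> \<Lambda> * \<bar>s - sk (\<phi> j)\<bar>"
        proof (cases "t \<le> sk (\<phi> j)")
          case True then show ?thesis using \<Lambda> by (simp add: Y_def)
        next
          case False
          then have "norm (Y (\<phi> j) t - Y (\<phi> j) (sk (\<phi> j))) \<le> \<Lambda> * (t - sk (\<phi> j))"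
            using t s by (intro Yinc) auto
          also have "\<dots> \<le> \<Lambda> * \<bar>s - sk (\<phi> j)\<bar>" using False t \<Lambda> by (intro mult_left_mono) auto
          finally show ?thesis by (simp add: Ysk)
        qed
      qed
      have "(\<lambda>j. \<Lambda> * \<bar>s - sk (\<phi> j)\<bar>) \<longlonglongrightarrow> \<Lambda> * \<bar>s - s\<bar>"
        by (intro tendsto_intros s\<phi>)
      then show "(\<lambda>j. \<Lambda> * \<bar>s - sk (\<phi> j)\<bar>) \<longlonglongrightarrow> 0" by simp
    qed
    moreover have "(\<lambda>j. Y (\<phi> j) t - xk (\<phi> j)) \<longlonglongrightarrow> y t - x"
      using t s by (intro tendsto_diff lim x\<phi>) auto
    ultimately show ?thesis
      using LIMSEQ_unique by fastforce
  qed
  have "sol s (x + m s - c) {s..T} (\<lambda>t. y t + m t - c)"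
    unfolding driven_sol_def
  proof (intro ballI)
    fix t assume t: "t \<in> {s..T}"
    define w where "w r = indicator {s..t} r *\<^sub>R F r (y r + m r - c)" for r
    define u0 where "u0 j r = indicator {sk (\<phi> j)..t} r *\<^sub>R F r (zk (\<phi> j) r)" for j r
    \<comment> \<open>The indicators may fail to converge at the single point \<open>r = s\<close>,
      on either side of which \<open>sk\<close> may lie. Prescribing the limit there leaves the
      integrals unchanged and gives convergence at every point.\<close>
    define u where "u j r = (if r = s then w s else u0 j r)" for j r
    have u0int: "integrable lborel (u0 j)" for j
    proof (cases "sk (\<phi> j) \<le> t")
      case True
      then show ?thesis
        using driven_solD(1)[OF zk[of "\<phi> j"], of t] t by (simp add: u0_def[abs_def] set_integrable_def)
    qed (simp add: u0_def[abs_def])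
    have um[measurable]: "u j \<in> borel_measurable lborel" for j
      using borel_measurable_integrable[OF u0int[of j]] unfolding u_def[abs_def] by measurable
    have ulim: "(\<lambda>j. u j r) \<longlonglongrightarrow> w r" for r
    proof (cases "r \<in> {s<..t}")
      case True
      then have r: "r \<in> {0..T}" using t s by auto
      have ev: "eventually (\<lambda>j. sk (\<phi> j) < r) sequentially"
        using order_tendstoD(2)[OF s\<phi>, of r] True by simp
      have "(\<lambda>j. F r (Y (\<phi> j) r + m r - m (sk (\<phi> j)))) \<longlonglongrightarrow> F r (y r + m r - c)"
        using r by (intro holder_tendsto tendsto_intros lim m\<phi>) auto
      moreover have "eventually (\<lambda>j. F r (Y (\<phi> j) r + m r - m (sk (\<phi> j))) = u j r) sequentially"
        using ev by eventually_elim (use True in \<open>auto simp: u_def u0_def Y_def\<close>)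
      moreover have "w r = F r (y r + m r - c)" using True by (simp add: w_def)
      ultimately show ?thesis using Lim_transform_eventually by fastforce
    next
      case False
      then consider "r = s" | "r < s" | "r > t" by force
      then show ?thesis
      proof cases
        case 1 then show ?thesis by (simp add: u_def)
      next
        case 2
        have "eventually (\<lambda>j. w r = u j r) sequentially"
          using order_tendstoD(1)[OF s\<phi> 2] by eventually_elim (use 2 in \<open>auto simp: u_def u0_def w_def\<close>)
        then show ?thesis using Lim_transform_eventually[OF tendsto_const] by fast
      next
        case 3
        then have "u j r = w r" for j using t by (auto simp: u_def u0_def w_def)
        then show ?thesis by simp
      qed
    qed
    have wm[measurable]: "w \<in> borel_measurable lborel"
      by (rule borel_measurable_LIMSEQ_metric[OF um ulim])
    have ub: "norm (u j r) \<le> indicator {0..T} r * (\<Lambda> + norm (w s))" for j r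
    proof -
      have "norm (u0 j r) \<le> indicator {0..T} r * (\<Lambda> + norm (w s))"
        using fb[of r "\<phi> j"] sk(1)[of "\<phi> j"] t \<Lambda> by (auto simp: u0_def indicator_def intro: add_increasing2)
      then show ?thesis using s \<Lambda> by (auto simp: u_def)
    qed
    have bint: "integrable lborel (\<lambda>r::real. indicator {0..T} r * (\<Lambda> + norm (w s)))"
      by (intro integrable_mult_left integrable_real_indicator) (auto simp: emeasure_lborel_Icc_eq)
    have wint: "integrable lborel w"
      by (rule integrable_dominated_convergence[where s=u, OF wm um bint]) (use ulim ub in auto)
    have "(\<lambda>j. integral\<^sup>L lborel (u j)) \<longlonglongrightarrow> integral\<^sup>L lborel w"
      by (rule integral_dominated_convergence[where s=u, OF wm um bint]) (use ulim ub in auto)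
    moreover have "integral\<^sup>L lborel (u j) = integral\<^sup>L lborel (u0 j)" for j
    proof (rule integral_cong_AE)
      show "AE r in lborel. u j r = u0 j r"
        using AE_lborel_singleton[of s] by eventually_elim (simp add: u_def)
    qed (use um borel_measurable_integrable[OF u0int] in auto)
    ultimately have ilim: "(\<lambda>j. integral\<^sup>L lborel (u0 j)) \<longlonglongrightarrow> integral\<^sup>L lborel w" by simp
    have wset: "set_integrable lborel {s..t} (\<lambda>r. F r (y r + m r - c))"
      using wint by (simp add: set_integrable_def w_def[abs_def])
    have wL: "integral\<^sup>L lborel w = (LINT r:{s..t}|lborel. F r (y r + m r - c))"
      by (simp add: set_lebesgue_integral_def w_def[abs_def])
    have "y t = x + integral\<^sup>L lborel w"
    proof (cases "t = s")
      case True
      have "integral\<^sup>L lborel w = 0"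
        unfolding wL set_borel_integral_eq_integral(2)[OF wset] by (simp add: True)
      then show ?thesis using yx[of t] True s by auto
    next
      case False
      then have "eventually (\<lambda>j. sk (\<phi> j) < t) sequentially"
        using order_tendstoD(2)[OF s\<phi>, of t] t by auto
      then have "eventually (\<lambda>j. xk (\<phi> j) + integral\<^sup>L lborel (u0 j) = Y (\<phi> j) t) sequentially"
      proof eventually_elim
        case (elim j)
        have tt: "t \<in> {sk (\<phi> j)..T}" using elim t by auto
        show ?case
          using Yi[OF tt] set_borel_integral_eq_integral(2)[OF driven_solD(1)[OF zk tt]]
          by (simp add: u0_def[abs_def] set_lebesgue_integral_def)
      qed
      then have "(\<lambda>j. Y (\<phi> j) t) \<longlonglongrightarrow> x + integral\<^sup>L lborel w"
        using Lim_transform_eventually[OF tendsto_add[OF x\<phi> ilim]] by fast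
      moreover have "(\<lambda>j. Y (\<phi> j) t) \<longlonglongrightarrow> y t" using t s by (intro lim) auto
      ultimately show ?thesis using LIMSEQ_unique by blast
    qed
    then show "set_integrable lborel {s..t} (\<lambda>r. F r (y r + m r - c)) \<and>
        y t + m t - c = x + m s - c + (LINT r:{s..t}|lborel. F r (y r + m r - c)) + m t - m s"
      using wset wL by (simp add: algebra_simps)
  qed
  with y(2) ul yx show ?thesis
    using that[of \<phi> y] unfolding Y_def[abs_def] by blast
qed

end

section \<open>Dyadic grids and path-by-path uniqueness\<close>

definition dgrid :: "real \<Rightarrow> nat \<Rightarrow> nat \<Rightarrow> real" where
  "dgrid T k i = real i * T / 2 ^ k"

definition dyadics :: "real \<Rightarrow> real set" where
  "dyadics T = (\<Union>k. dgrid T k ` {..2 ^ k})"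

lemma dgrid_in_dyadics: "i \<le> 2 ^ k \<Longrightarrow> dgrid T k i \<in> dyadics T"
  by (auto simp: dyadics_def)

lemma countable_dyadics: "countable (dyadics T)"
  by (auto simp: dyadics_def)

lemma dyadics_subset: "0 \<le> T \<Longrightarrow> dyadics T \<subseteq> {0..T}"
proof (clarsimp simp: dyadics_def dgrid_def)
  fix k i :: nat assume "0 \<le> T" "i \<le> 2 ^ k"
  then have "real i \<le> 2 ^ k" by (metis of_nat_le_iff of_nat_numeral of_nat_power)
  then show "real i * T / 2 ^ k \<le> T"
    using \<open>0 \<le> T\<close> mult_right_mono[of "real i" "2 ^ k" T] by (simp add: field_simps)
qed

lemma dyadicsD: "s \<in> dyadics T \<Longrightarrow> 0 \<le> T \<Longrightarrow> s \<in> {0..T}"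
  using dyadics_subset by blast

lemma dgrid_mono: "0 \<le> T \<Longrightarrow> i \<le> j \<Longrightarrow> dgrid T k i \<le> dgrid T k j"
  by (simp add: dgrid_def divide_right_mono mult_right_mono)

lemma dgrid_Suc: "dgrid T k (Suc i) = dgrid T k i + T / 2 ^ k"
  by (simp add: dgrid_def add_divide_distrib distrib_right)

lemma dgrid_refine: "k0 \<le> k \<Longrightarrow> dgrid T k0 i = dgrid T k (i * 2 ^ (k - k0))"
  by (auto simp: dgrid_def le_iff_add power_add)

text \<open>Rounding goes upwards because a cadlag path is recovered from its values to the
  right.\<close>

definition dceil :: "real \<Rightarrow> nat \<Rightarrow> real \<Rightarrow> nat" where
  "dceil T k s = nat \<lceil>s * 2 ^ k / T\<rceil>"

lemma dceil_bounds:
  assumes "0 < T" "s \<in> {0..T}"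
  shows "dceil T k s \<le> 2 ^ k" "s \<le> dgrid T k (dceil T k s)" "dgrid T k (dceil T k s) \<le> s + T / 2 ^ k"
proof -
  have 0: "0 \<le> s * 2 ^ k / T" using assms by simp
  then have r: "real (dceil T k s) = of_int \<lceil>s * 2 ^ k / T\<rceil>"
    by (simp add: dceil_def)
  have "s * 2 ^ k / T \<le> 2 ^ k" using assms by (simp add: field_simps)
  then have "\<lceil>s * 2 ^ k / T\<rceil> \<le> 2 ^ k" by (simp add: ceiling_le_iff)
  then have "of_int \<lceil>s * 2 ^ k / T\<rceil> \<le> (2 ^ k :: real)" by (metis of_int_le_iff of_int_numeral of_int_power)
  then show "dceil T k s \<le> 2 ^ k" unfolding r[symmetric] by (metis of_nat_le_iff of_nat_numeral of_nat_power)
  have "s * 2 ^ k / T \<le> real (dceil T k s)" unfolding r by (rule le_of_int_ceiling)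
  then show "s \<le> dgrid T k (dceil T k s)" using assms by (simp add: dgrid_def field_simps)
  have "real (dceil T k s) \<le> s * 2 ^ k / T + 1" unfolding r by linarith
  then have "real (dceil T k s) * T \<le> (s * 2 ^ k / T + 1) * T"
    using assms by (intro mult_right_mono) auto
  then have "real (dceil T k s) * T \<le> s * 2 ^ k + T" using assms by (simp add: distrib_right)
  then have "dgrid T k (dceil T k s) \<le> (s * 2 ^ k + T) / 2 ^ k"
    unfolding dgrid_def by (intro divide_right_mono) auto
  then show "dgrid T k (dceil T k s) \<le> s + T / 2 ^ k" by (simp add: add_divide_distrib)
qed

lemma dfloor:
  assumes "0 < T" "t \<in> {0..T}"
  obtains N where "N \<le> 2 ^ k" "dgrid T k N \<le> t" "t \<le> dgrid T k N + T / 2 ^ k"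
    "\<And>i. dgrid T k i \<le> t \<Longrightarrow> i \<le> N"
proof -
  define N where "N = nat \<lfloor>t * 2 ^ k / T\<rfloor>"
  have 0: "0 \<le> t * 2 ^ k / T" using assms by simp
  then have r: "real N = of_int \<lfloor>t * 2 ^ k / T\<rfloor>" by (simp add: N_def)
  have eq: "dgrid T k i \<le> t \<longleftrightarrow> i \<le> N" for i
  proof -
    have "dgrid T k i \<le> t \<longleftrightarrow> of_int (int i) \<le> t * 2 ^ k / T"
      using assms by (simp add: dgrid_def field_simps)
    also have "\<dots> \<longleftrightarrow> int i \<le> \<lfloor>t * 2 ^ k / T\<rfloor>" by (rule le_floor_iff[symmetric])
    also have "\<dots> \<longleftrightarrow> i \<le> N" using 0 by (simp add: N_def le_nat_iff)
    finally show ?thesis .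
  qed
  show ?thesis
  proof (rule that[of N])
    have "t * 2 ^ k / T \<le> 2 ^ k" using assms by (simp add: field_simps)
    then have "real N \<le> 2 ^ k" unfolding r by (meson of_int_floor_le order_trans)
    then show "N \<le> 2 ^ k" by (metis of_nat_le_iff of_nat_numeral of_nat_power)
    show "dgrid T k N \<le> t" by (simp add: eq)
    have "\<not> dgrid T k (Suc N) \<le> t" by (simp add: eq)
    then show "t \<le> dgrid T k N + T / 2 ^ k" by (simp add: dgrid_Suc)
  qed (simp add: eq)
qed

lemma dyadic_step_tendsto_0: "(\<lambda>k. (c::real) / 2 ^ k) \<longlonglongrightarrow> 0"
  by (rule LIMSEQ_divide_realpow_zero) simp

section \<open>Davie's uniqueness argument on the grid\<close>

context driven_ode
begin

text \<open>Telescoping along ever finer grids shows \<open>g t = \<psi> r (g r) t\<close> for each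
  dyadic \<open>r\<close> in \<open>{s..t}\<close>, and likewise for \<open>h\<close>. It remains to
  leave \<open>s\<close>, which need not be dyadic: at the first grid point \<open>r \<ge> s\<close>
  the two solutions are within \<open>c * (T / 2 ^ k) powr (1 + \<beta>)\<close> of each other, and
  the Hoelder bound of \<open>\<psi> r\<close> carries this to \<open>t\<close> at a cost again
  dominated by the grid sum.\<close>

theorem davie_uniqueness:
  fixes \<psi> :: "real \<Rightarrow> 'v \<Rightarrow> real \<Rightarrow> 'v" and H w :: "real \<Rightarrow> real"
  assumes \<psi>_sol: "\<And>s y. s \<in> dyadics T \<Longrightarrow> sol s y {s..T} (\<psi> s y)"
    and flow: "\<And>s r t y. s \<in> dyadics T \<Longrightarrow> r \<in> dyadics T \<Longrightarrow> s \<le> r \<Longrightarrow> r \<le> t \<Longrightarrow> t \<le> T \<Longrightarrow>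
      \<psi> s y t = \<psi> r (\<psi> s y r) t"
    and \<psi>_holder: "\<And>s t R y y'. s \<in> dyadics T \<Longrightarrow> t \<in> {s..T} \<Longrightarrow> norm y \<le> R \<Longrightarrow> norm y' \<le> R \<Longrightarrow>
      norm (\<psi> s y t - \<psi> s y' t) \<le> H s * w R * norm (y - y') powr \<alpha>"
    and H: "\<And>s. 0 \<le> H s" and w: "\<And>R. 0 \<le> w R" and \<alpha>: "0 < \<alpha>"
    and lim: "(\<lambda>k. (\<Sum>i\<le>2^k. H (dgrid T k i)) * (T / 2 ^ k) powr ((1 + \<beta>) * \<alpha>)) \<longlonglongrightarrow> 0"
    and st: "0 \<le> s" "s \<le> t" "t \<le> T"
    and g: "sol s x {s..t} g" and h: "sol s x {s..t} h"
  shows "g t = h t"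
proof (cases "s = t")
  case True
  then show ?thesis using driven_sol_start[OF g] driven_sol_start[OF h] by simp
next
  case False
  then have "s < t" using st by simp
  \<comment> \<open>Two radii occur: \<open>G0\<close> bounds the given solutions, \<open>G1\<close>
    the dyadic solutions restarted from points of norm at most \<open>G0\<close>. All later
    estimates use the larger one.\<close>
  obtain G0 where G0: "G0 \<ge> 0" "\<And>s t y g u. 0 \<le> s \<Longrightarrow> t \<le> T \<Longrightarrow> sol s y {s..t} g \<Longrightarrow>
      norm y \<le> norm x \<Longrightarrow> u \<in> {s..t} \<Longrightarrow> norm (g u) \<le> G0"
    using sol_bound[of "norm x"] by auto
  obtain G1 where G1: "G1 \<ge> 0" "\<And>s t y g u. 0 \<le> s \<Longrightarrow> t \<le> T \<Longrightarrow> sol s y {s..t} g \<Longrightarrow>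
      norm y \<le> G0 \<Longrightarrow> u \<in> {s..t} \<Longrightarrow> norm (g u) \<le> G1"
    using sol_bound[OF G0(1)] by auto
  define G where "G = max G0 G1"
  have "0 \<le> G" using G0 by (simp add: G_def)
  from sol_difference[OF this] obtain c where c0: "c \<ge> 0" and cd: "\<forall>r s y g h. 0 \<le> r \<longrightarrow> r \<le> s \<longrightarrow> s \<le> T \<longrightarrow> sol r y {r..s} g \<longrightarrow> sol r y {r..s} h \<longrightarrow>
     (\<forall>u\<in>{r..s}. norm (g u) \<le> G \<and> norm (h u) \<le> G) \<longrightarrow> norm (g s - h s) \<le> c * (s - r) powr (1 + \<beta>)"
    by (elim exE conjE)
  have c2: "norm (g s - h s) \<le> c * (s - r) powr (1 + \<beta>)"
    if "0 \<le> r" "r \<le> s" "s \<le> T" "sol r y {r..s} g" "sol r y {r..s} h"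
      "\<And>u. u \<in> {r..s} \<Longrightarrow> norm (g u) \<le> G \<and> norm (h u) \<le> G" for r s y g h
    using cd[rule_format, OF that(1-5)] that(6) by blast
  note c = c0 c2
  define E where "E k = (\<Sum>i\<le>2^k. H (dgrid T k i)) * (T / 2 ^ k) powr ((1 + \<beta>) * \<alpha>)" for k
  define W where "W = w G * c powr \<alpha>"
  have W: "W \<ge> 0" using w by (simp add: W_def)
  have cpow: "(c * d powr (1 + \<beta>)) powr \<alpha> = c powr \<alpha> * d powr ((1 + \<beta>) * \<alpha>)" for d :: real
    using c(1) by (simp add: powr_mult powr_powr)
  have dy: "r \<in> {0..T}" if "r \<in> dyadics T" for r using dyadics_subset[of T] T_pos that by auto
  have dev: "norm (g' r' - \<psi> r (g' r) r') \<le> c * (r' - r) powr (1 + \<beta>)"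
    if g': "sol s x {s..t} g'" and r: "r \<in> dyadics T" "s \<le> r" "r \<le> r'" "r' \<le> t" for g' r r'
  proof (rule c(2))
    have gr: "norm (g' u) \<le> G0" if "u \<in> {s..t}" for u
      using G0(2)[OF st(1,3) g' _ that] by simp
    show g1: "sol r (g' r) {r..r'} g'"
      by (rule driven_sol_subset[OF driven_sol_restart[OF g', of r]]) (use r in auto)
    show "sol r (g' r) {r..r'} (\<psi> r (g' r))"
      by (rule driven_sol_subset[OF \<psi>_sol[OF r(1)]]) (use r st in auto)
    show "norm (g' u) \<le> G \<and> norm (\<psi> r (g' r) u) \<le> G" if u: "u \<in> {r..r'}" for u
      using gr[of u] G1(2)[OF _ _ \<psi>_sol[OF r(1)] gr[of r], of u] dy[OF r(1)] r u st
      by (auto simp: G_def)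
  qed (use dy[OF r(1)] r st in auto)
  have stepr: "norm (\<psi> r' (g' r') t - \<psi> r (g' r) t) \<le> H r' * (W * (r' - r) powr ((1 + \<beta>) * \<alpha>))"
    if g': "sol s x {s..t} g'" and r: "r \<in> dyadics T" "r' \<in> dyadics T" "s \<le> r" "r \<le> r'" "r' \<le> t" for g' r r'
  proof -
    have gr: "norm (g' u) \<le> G0" if "u \<in> {s..t}" for u
      using G0(2)[OF st(1,3) g' _ that] by simp
    have b: "norm (\<psi> r (g' r) r') \<le> G1"
      using G1(2)[OF _ _ \<psi>_sol[OF r(1)] gr[of r], of r'] dy[OF r(1)] r st by auto
    have "\<psi> r (g' r) t = \<psi> r' (\<psi> r (g' r) r') t"
      using r st by (intro flow) auto
    then have "norm (\<psi> r' (g' r') t - \<psi> r (g' r) t) = norm (\<psi> r' (g' r') t - \<psi> r' (\<psi> r (g' r) r') t)"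
      by simp
    also have "\<dots> \<le> H r' * w G * norm (g' r' - \<psi> r (g' r) r') powr \<alpha>"
      using r st b gr[of r'] by (intro \<psi>_holder) (auto simp: G_def)
    also have "\<dots> \<le> H r' * w G * (c * (r' - r) powr (1 + \<beta>)) powr \<alpha>"
      using H w \<alpha> dev[OF g' r(1,3,4,5)] by (intro mult_left_mono powr_mono2) auto
    also have "\<dots> = H r' * (W * (r' - r) powr ((1 + \<beta>) * \<alpha>))"
      by (simp add: cpow W_def)
    finally show ?thesis .
  qed
  have restart: "g' t = \<psi> r (g' r) t"
    if g': "sol s x {s..t} g'" and r: "r \<in> dyadics T" "s \<le> r" "r \<le> t" for g' r
  proof -
    obtain k0 i0 where r0: "r = dgrid T k0 i0" "i0 \<le> 2 ^ k0"
      using r(1) by (auto simp: dyadics_def)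
    have bound: "norm (g' t - \<psi> r (g' r) t) \<le> W * E k + c * (T / 2 ^ k) powr (1 + \<beta>)" if k: "k0 \<le> k" for k
    proof -
      \<comment> \<open>For \<open>k \<ge> k0\<close> the point \<open>r\<close> lies on the grid of
        level \<open>k\<close>, so the telescoping sum starts exactly at \<open>r\<close>.\<close>
      define j0 where "j0 = i0 * 2 ^ (k - k0)"
      have rj: "r = dgrid T k j0" using dgrid_refine[OF k] r0 by (simp add: j0_def)
      obtain N where N: "N \<le> 2 ^ k" "dgrid T k N \<le> t" "t \<le> dgrid T k N + T / 2 ^ k"
        "\<And>i. dgrid T k i \<le> t \<Longrightarrow> i \<le> N"
        using dfloor[OF T_pos, of t k] st by auto
      have jN: "j0 \<le> N" using N(4) rj r by simp
      define e where "e = W * (T / 2 ^ k) powr ((1 + \<beta>) * \<alpha>)"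
      have e: "e \<ge> 0" using W by (simp add: e_def)
      have chain: "norm (\<psi> (dgrid T k n) (g' (dgrid T k n)) t - \<psi> r (g' r) t) \<le> (\<Sum>i=j0..n. H (dgrid T k i)) * e"
        if "j0 \<le> n" "n \<le> N" for n
        using that
      proof (induction n rule: dec_induct)
        case base
        then show ?case using H e by (simp add: rj)
      next
        case (step n)
        let ?r = "dgrid T k n" and ?r' = "dgrid T k (Suc n)"
        have le: "?r \<le> ?r'" "r \<le> ?r" "?r' \<le> t"
          using dgrid_mono[of T n "Suc n" k] dgrid_mono[of T j0 n k] dgrid_mono[of T "Suc n" N k] T_pos step.hyps step.prems N(2)
          by (auto simp: rj)
        have "norm (\<psi> ?r' (g' ?r') t - \<psi> ?r (g' ?r) t) \<le> H ?r' * (W * (?r' - ?r) powr ((1 + \<beta>) * \<alpha>))"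
          using step.hyps step.prems N(1) le r(2) by (intro stepr[OF g'] dgrid_in_dyadics) auto
        then have 1: "norm (\<psi> ?r' (g' ?r') t - \<psi> ?r (g' ?r) t) \<le> H ?r' * e"
          by (simp add: dgrid_Suc e_def)
        have 2: "norm (\<psi> ?r (g' ?r) t - \<psi> r (g' r) t) \<le> (\<Sum>i=j0..n. H (dgrid T k i)) * e"
          using step by simp
        have "norm (\<psi> ?r' (g' ?r') t - \<psi> r (g' r) t) \<le>
            norm (\<psi> ?r' (g' ?r') t - \<psi> ?r (g' ?r) t) + norm (\<psi> ?r (g' ?r) t - \<psi> r (g' r) t)"
          using norm_triangle_ineq[of "\<psi> ?r' (g' ?r') t - \<psi> ?r (g' ?r) t" "\<psi> ?r (g' ?r) t - \<psi> r (g' r) t"]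
          by simp
        then show ?case
          using 1 2 step.hyps by (simp add: distrib_right)
      qed
      have "(\<Sum>i=j0..N. H (dgrid T k i)) * e \<le> (\<Sum>i\<le>2^k. H (dgrid T k i)) * e"
        using H e N(1) by (intro mult_right_mono sum_mono2) auto
      also have "\<dots> = W * E k" by (simp add: e_def E_def)
      finally have 1: "norm (\<psi> (dgrid T k N) (g' (dgrid T k N)) t - \<psi> r (g' r) t) \<le> W * E k"
        using chain[OF jN] by simp
      have rN: "r \<le> dgrid T k N" using dgrid_mono[OF _ jN, of T k] T_pos rj by simp
      \<comment> \<open>In general \<open>t\<close> is no grid point. The last, incomplete step is
        compared at time \<open>t\<close> itself and so needs the one-step estimate but no Hoelder
        constant.\<close>
      have "norm (g' t - \<psi> (dgrid T k N) (g' (dgrid T k N)) t) \<le> c * (t - dgrid T k N) powr (1 + \<beta>)"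
        using N rN r by (intro dev[OF g'] dgrid_in_dyadics) auto
      also have "\<dots> \<le> c * (T / 2 ^ k) powr (1 + \<beta>)"
        using N c(1) \<beta>_pos by (intro mult_left_mono powr_mono2) auto
      finally have 2: "norm (g' t - \<psi> (dgrid T k N) (g' (dgrid T k N)) t) \<le> c * (T / 2 ^ k) powr (1 + \<beta>)" .
      have "norm (g' t - \<psi> r (g' r) t) \<le> norm (g' t - \<psi> (dgrid T k N) (g' (dgrid T k N)) t)
          + norm (\<psi> (dgrid T k N) (g' (dgrid T k N)) t - \<psi> r (g' r) t)"
        using norm_triangle_ineq[of "g' t - \<psi> (dgrid T k N) (g' (dgrid T k N)) t"
            "\<psi> (dgrid T k N) (g' (dgrid T k N)) t - \<psi> r (g' r) t"] by simp
      then show ?thesis using 1 2 by linarith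
    qed
    have "(\<lambda>k. (T / 2 ^ k) powr (1 + \<beta>)) \<longlonglongrightarrow> 0"
      by (rule tendsto_zero_powrI[OF dyadic_step_tendsto_0 tendsto_const]) (use \<beta>_pos T_pos in auto)
    then have "(\<lambda>k. W * E k + c * (T / 2 ^ k) powr (1 + \<beta>)) \<longlonglongrightarrow> 0"
      using lim unfolding E_def[symmetric] by (intro tendsto_add_zero tendsto_mult_right_zero)
    then have "norm (g' t - \<psi> r (g' r) t) \<le> 0"
      by (rule LIMSEQ_le_const) (use bound in blast)
    then show ?thesis by simp
  qed
  have "norm (g t - h t) \<le> 0"
  proof (rule LIMSEQ_le_const)
    show "(\<lambda>k. W * E k) \<longlonglongrightarrow> 0"
      using lim unfolding E_def[symmetric] by (rule tendsto_mult_right_zero)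
    have "eventually (\<lambda>k. T / 2 ^ k < t - s) sequentially"
      by (rule order_tendstoD(2)[OF dyadic_step_tendsto_0]) (use \<open>s < t\<close> in simp)
    then obtain k0 where k0: "\<And>k. k0 \<le> k \<Longrightarrow> T / 2 ^ k < t - s"
      by (auto simp: eventually_sequentially)
    show "\<exists>N. \<forall>k\<ge>N. norm (g t - h t) \<le> W * E k"
    proof (intro exI allI impI)
      fix k assume "k0 \<le> k"
      define r where "r = dgrid T k (dceil T k s)"
      have s0: "s \<in> {0..T}" using st by auto
      note cb = dceil_bounds[OF T_pos s0, of k]
      have r: "r \<in> dyadics T" "s \<le> r" "r \<le> t" "r - s \<le> T / 2 ^ k"
        using cb k0[OF \<open>k0 \<le> k\<close>] by (auto simp: r_def intro: dgrid_in_dyadics)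
      have gh: "norm (g u) \<le> G" "norm (h u) \<le> G" if "u \<in> {s..t}" for u
        using G0(2)[OF st(1,3) g _ that] G0(2)[OF st(1,3) h _ that] by (auto simp: G_def)
      have "norm (g r - h r) \<le> c * (r - s) powr (1 + \<beta>)"
        by (rule c(2)[OF st(1) r(2) _ driven_sol_subset[OF g] driven_sol_subset[OF h]])
          (use r st gh in auto)
      also have "\<dots> \<le> c * (T / 2 ^ k) powr (1 + \<beta>)"
        using r c(1) \<beta>_pos by (intro mult_left_mono powr_mono2) auto
      finally have d: "norm (g r - h r) \<le> c * (T / 2 ^ k) powr (1 + \<beta>)" .
      have "norm (g t - h t) = norm (\<psi> r (g r) t - \<psi> r (h r) t)"
        using restart[OF g r(1-3)] restart[OF h r(1-3)] by simp
      also have "\<dots> \<le> H r * w G * norm (g r - h r) powr \<alpha>"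
        using r st gh by (intro \<psi>_holder) auto
      also have "\<dots> \<le> H r * w G * (c * (T / 2 ^ k) powr (1 + \<beta>)) powr \<alpha>"
        using H w \<alpha> d by (intro mult_left_mono powr_mono2) auto
      also have "\<dots> = H r * (W * (T / 2 ^ k) powr ((1 + \<beta>) * \<alpha>))"
        by (simp add: cpow W_def)
      \<comment> \<open>The point \<open>r\<close> moves with \<open>k\<close> and no bound on the
        single constants \<open>H r\<close> is at hand, so \<open>H r\<close> is estimated by the
        whole grid sum.\<close>
      also have "\<dots> \<le> (\<Sum>i\<le>2^k. H (dgrid T k i)) * (W * (T / 2 ^ k) powr ((1 + \<beta>) * \<alpha>))"
        unfolding r_def using W H cb(1)
        by (intro mult_right_mono member_le_sum[of "dceil T k s" _ "\<lambda>i. H (dgrid T k i)"]) auto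
      also have "\<dots> = W * E k" by (simp add: E_def)
      finally show "norm (g t - h t) \<le> W * E k" .
    qed
  qed
  then show ?thesis by simp
qed

end

section \<open>The flow of a uniquely solvable equation\<close>

lemma dgrid_dceil_tendsto:
  assumes "0 < T" "s \<in> {0..T}"
  shows "(\<lambda>k. dgrid T k (dceil T k s)) \<longlonglongrightarrow> s"
proof (rule tendsto_sandwich[OF _ _ tendsto_const])
  have "(\<lambda>k. s + T / 2 ^ k) \<longlonglongrightarrow> s + 0"
    by (intro tendsto_add tendsto_const dyadic_step_tendsto_0)
  then show "(\<lambda>k. s + T / 2 ^ k) \<longlonglongrightarrow> s" by simp
qed (use dceil_bounds[OF assms] in auto)

lemma dyadic_approximation:
  assumes "0 < T" "t \<in> {0..T}"
  obtains tk where "\<And>k. tk k \<in> dyadics T" "\<And>k. tk k \<in> {t..T}" "tk \<longlonglongrightarrow> t"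
proof (rule that)
  fix k
  show "dgrid T k (dceil T k t) \<in> dyadics T"
    by (rule dgrid_in_dyadics[OF dceil_bounds(1)[OF assms]])
  from dyadicsD[OF this] show "dgrid T k (dceil T k t) \<in> {t..T}"
    using dceil_bounds(2)[OF assms, of k] assms(1) by auto
qed (rule dgrid_dceil_tendsto[OF assms])

text \<open>The first branch builds in the convention that a strong solution rests at
  \<open>x\<close> up to time \<open>s\<close>. The choice in the second is harmless once solutions
  are unique.\<close>

definition ode_flow ::
  "real \<Rightarrow> (real \<Rightarrow> 'v::euclidean_space \<Rightarrow> 'v) \<Rightarrow> (real \<Rightarrow> 'v) \<Rightarrow> real \<Rightarrow> 'v \<Rightarrow> real \<Rightarrow> 'v" where
  "ode_flow T F m s x t = (if t \<le> s then x else (SOME g. driven_sol F m s x {s..T} g) t)"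

text \<open>Along dyadic times tending to \<open>s\<close> from the right the noise tends to
  \<open>m s\<close>, so the shift in the compactness lemma vanishes and the limiting solution
  starts at \<open>x\<close>.\<close>

lemma (in driven_ode) exists_sol_of_dyadic:
  assumes "\<And>s x. s \<in> dyadics T \<Longrightarrow> \<exists>g. sol s x {s..T} g" "s \<in> {0..T}"
  shows "\<exists>g. sol s x {s..T} g"
proof -
  obtain sk where d: "\<And>k. sk k \<in> dyadics T" and sT: "\<And>k. sk k \<in> {s..T}" and lim: "sk \<longlonglongrightarrow> s"
    by (rule dyadic_approximation[OF T_pos assms(2)]) blast
  have T: "sk k \<in> {0..T}" for k using sT[of k] assms(2) by auto
  have "\<forall>k. \<exists>g. sol (sk k) x {sk k..T} g" using assms(1) d by blast
  then obtain z where z: "\<And>k. sol (sk k) x {sk k..T} (z k)" by metis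
  have ms: "(\<lambda>k. m (sk k)) \<longlonglongrightarrow> m s"
    by (rule cadlag_on_right_sequentially[OF m_cadlag assms(2) sT lim])
  show ?thesis
  proof (rule sol_compactness[OF T lim tendsto_const ms z])
    fix \<phi> y assume "sol s (x + m s - m s) {s..T} (\<lambda>t. y t + m t - m s)"
    then show ?thesis by auto
  qed
qed

locale driven_flow = driven_ode +
  assumes unique: "\<And>s t x g h. 0 \<le> s \<Longrightarrow> s \<le> t \<Longrightarrow> t \<le> T \<Longrightarrow> sol s x {s..t} g \<Longrightarrow> sol s x {s..t} h \<Longrightarrow> g t = h t"
    and existence: "\<And>s x. s \<in> {0..T} \<Longrightarrow> \<exists>g. sol s x {s..T} g"
begin

abbreviation "\<Phi> \<equiv> ode_flow T F m"

lemma flow_before: "t \<le> s \<Longrightarrow> \<Phi> s x t = x"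
  by (simp add: ode_flow_def)

lemma flow_sol:
  assumes "s \<in> {0..T}"
  shows "sol s x {s..T} (\<Phi> s x)"
proof -
  have g: "sol s x {s..T} (SOME g. sol s x {s..T} g)"
    using existence[OF assms] by (rule someI_ex)
  show ?thesis
    by (rule driven_sol_cong[OF g]) (use driven_sol_start[OF g] assms in \<open>auto simp: ode_flow_def\<close>)
qed

lemma flow_unique:
  assumes "0 \<le> s" "s \<le> t" "t \<le> T" "sol s x {s..t} g"
  shows "g t = \<Phi> s x t"
  by (rule unique[OF assms(1-4) driven_sol_subset[OF flow_sol]]) (use assms in auto)

lemma flow_cocycle:
  assumes "0 \<le> s" "s \<le> r" "r \<le> t" "t \<le> T"
  shows "\<Phi> s x t = \<Phi> r (\<Phi> s x r) t"
  by (rule flow_unique[OF _ assms(3,4) driven_sol_subset[OF driven_sol_restart[OF flow_sol]]])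
    (use assms in auto)

section \<open>Dependence of the flow on the initial time and point\<close>

text \<open>Compactness treats the solutions with the noise removed. To put it back, the removed
  terms must converge uniformly in \<open>t\<close> as well, and this is where the one-sided limits
  of \<open>m\<close> enter. From the left the limit rests at \<open>x\<close> until
  \<open>s\<close> and continues from \<open>x + m s - c\<close>, the position after the
  jump.\<close>

lemma flow_subsequence:
  assumes sk: "\<And>k. sk k \<in> {0..T}" "sk \<longlonglongrightarrow> s" and xk: "xk \<longlonglongrightarrow> x"
    and mk: "(\<lambda>k. m (sk k)) \<longlonglongrightarrow> c"
    and side: "(\<forall>k. s \<le> sk k) \<and> c = m s \<or> (\<forall>k. sk k < s)"
  shows "\<exists>\<phi>. strict_mono (\<phi> :: nat \<Rightarrow> nat) \<and>
    uniform_limit {0..T} (\<lambda>j. \<Phi> (sk (\<phi> j)) (xk (\<phi> j))) (\<lambda>t. if t < s then x else \<Phi> s (x + m s - c) t) sequentially"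
proof -
  have s: "s \<in> {0..T}"
    using closed_sequentially[OF closed_atLeastAtMost, OF _ sk(2)] sk(1) by blast
  obtain \<phi> y where \<phi>: "strict_mono (\<phi> :: nat \<Rightarrow> nat)"
    and ul: "uniform_limit {0..T} (\<lambda>j t. if t \<le> sk (\<phi> j) then xk (\<phi> j) else
        \<Phi> (sk (\<phi> j)) (xk (\<phi> j)) t - m t + m (sk (\<phi> j))) y sequentially"
    and yx: "\<And>t. t \<in> {0..s} \<Longrightarrow> y t = x"
    and ys: "sol s (x + m s - c) {s..T} (\<lambda>t. y t + m t - c)"
    using sol_compactness[OF sk xk mk flow_sol[OF sk(1)]] by blast
  define D where "D k t = (if t \<le> sk k then 0 else m t - m (sk k)) - (if t < s then 0 else m t - c)" for k t
  have D: "\<exists>N. \<forall>k\<ge>N. \<forall>t\<in>{0..T}. norm (D k t) < e" if e: "0 < e" for e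
  proof -
    obtain N1 where N1: "\<And>k. k \<ge> N1 \<Longrightarrow> dist (m (sk k)) c < e / 2"
      using mk[unfolded lim_sequentially, rule_format, of "e / 2"] e by auto
    from side show ?thesis
    proof
      assume r: "(\<forall>k. s \<le> sk k) \<and> c = m s"
      have "(m \<longlongrightarrow> m s) (at s within ({0..T} \<inter> {s<..}))"
        using m_cadlag s unfolding cadlag_on_def by blast
      from tendstoD[OF this e] obtain d where d: "d > 0"
        "\<And>u. u \<in> {0..T} \<Longrightarrow> s < u \<Longrightarrow> dist u s < d \<Longrightarrow> dist (m u) (m s) < e"
        by (auto simp: eventually_at)
      obtain N2 where N2: "\<And>k. k \<ge> N2 \<Longrightarrow> dist (sk k) s < d"
        using sk(2)[unfolded lim_sequentially, rule_format, OF d(1)] by auto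
      show ?thesis
      proof (intro exI[of _ "max N1 N2"] allI impI ballI)
        fix k t assume k: "max N1 N2 \<le> k" and t: "t \<in> {0..T}"
        consider "t < s" | "t = s" | "s < t" "t \<le> sk k" | "sk k < t" by force
        then show "norm (D k t) < e"
        proof cases
          case 1 then show ?thesis using e r by (auto simp: D_def intro: order_trans less_imp_le)
        next
          case 2 then show ?thesis using e r by (simp add: D_def)
        next
          case 3
          then have "dist t s < d" using N2[of k] k by (simp add: dist_real_def)
          then show ?thesis using d(2)[OF t 3(1)] 3 r by (simp add: D_def dist_norm norm_minus_commute)
        next
          case 4
          then have "\<not> t < s" using r by (meson le_less_trans less_asym less_le_not_le)
          then show ?thesis using 4 N1[of k] k e by (simp add: D_def dist_norm norm_minus_commute)
        qed
      qed
    next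
      assume l: "\<forall>k. sk k < s"
      obtain c' where c': "(m \<longlongrightarrow> c') (at s within ({0..T} \<inter> {..<s}))"
        using m_cadlag s unfolding cadlag_on_def by blast
      have "((m \<circ> sk) \<longlonglongrightarrow> c')"
        using c'[unfolded tendsto_at_iff_sequentially, rule_format, of sk] sk l by fastforce
      then have "c' = c" using mk LIMSEQ_unique by (fastforce simp: o_def)
      have "0 < e / 2" using e by simp
      from tendstoD[OF c' this] obtain d where d: "d > 0"
        "\<And>u. u \<in> {0..T} \<Longrightarrow> u < s \<Longrightarrow> dist u s < d \<Longrightarrow> dist (m u) c < e / 2"
        unfolding \<open>c' = c\<close> by (auto simp: eventually_at)
      obtain N2 where N2: "\<And>k. k \<ge> N2 \<Longrightarrow> dist (sk k) s < d"
        using sk(2)[unfolded lim_sequentially, rule_format, OF d(1)] by auto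
      show ?thesis
      proof (intro exI[of _ "max N1 N2"] allI impI ballI)
        fix k t assume k: "max N1 N2 \<le> k" and t: "t \<in> {0..T}"
        consider "t \<le> sk k" | "sk k < t" "t < s" | "s \<le> t" by force
        then show "norm (D k t) < e"
        proof cases
          case 1
          then have "t < s" using l by (meson le_less_trans)
          with 1 show ?thesis using e by (simp add: D_def)
        next
          case 2
          then have "dist t s < d" using N2[of k] k by (simp add: dist_real_def)
          then have "dist (m t) c < e / 2" using d(2)[OF t 2(2)] by simp
          then have "dist (m t) (m (sk k)) < e" using N1[of k] k by (auto intro: dist_triangle_half_l[of _ c])
          then show ?thesis using 2 by (simp add: D_def dist_norm)
        next
          case 3
          then have "\<not> t \<le> sk k" using l by (metis leD less_le_trans)
          then show ?thesis using 3 N1[of k] k e by (simp add: D_def dist_norm norm_minus_commute)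
        qed
      qed
    qed
  qed
  show ?thesis
  proof (intro exI[of _ \<phi>] conjI \<phi>)
    show "uniform_limit {0..T} (\<lambda>j. \<Phi> (sk (\<phi> j)) (xk (\<phi> j))) (\<lambda>t. if t < s then x else \<Phi> s (x + m s - c) t) sequentially"
      unfolding uniform_limit_sequentially_iff
    proof (intro allI impI)
      fix e :: real assume e: "0 < e"
      then have e2: "0 < e / 2" by simp
      obtain N1 where N1: "\<And>k t. k \<ge> N1 \<Longrightarrow> t \<in> {0..T} \<Longrightarrow> norm (D k t) < e / 2"
        using D[OF e2] by blast
      obtain N2 where N2: "\<And>j t. j \<ge> N2 \<Longrightarrow> t \<in> {0..T} \<Longrightarrow> dist (if t \<le> sk (\<phi> j) then xk (\<phi> j) else
        \<Phi> (sk (\<phi> j)) (xk (\<phi> j)) t - m t + m (sk (\<phi> j))) (y t) < e / 2"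
        using ul[unfolded uniform_limit_sequentially_iff] e2 by meson
      show "\<exists>N. \<forall>n\<ge>N. \<forall>t\<in>{0..T}. dist (\<Phi> (sk (\<phi> n)) (xk (\<phi> n)) t) (if t < s then x else \<Phi> s (x + m s - c) t) < e"
      proof (intro exI[of _ "max N1 N2"] allI impI ballI)
        fix j t assume j: "max N1 N2 \<le> j" and t: "t \<in> {0..T}"
        define k where "k = \<phi> j"
        have "k \<ge> N1" using seq_suble[OF \<phi>, of j] j by (simp add: k_def)
        note 1 = N1[OF this t]
        define Y where "Y = (if t \<le> sk k then xk k else \<Phi> (sk k) (xk k) t - m t + m (sk k))"
        have 2: "norm (Y - y t) < e / 2"
          using N2[of j t] j t unfolding dist_norm Y_def k_def by simp
        have "(if t < s then x else \<Phi> s (x + m s - c) t) = y t + (if t < s then 0 else m t - c)"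
          using yx[of t] flow_unique[OF _ _ _ driven_sol_subset[OF ys], of t] t s by (auto simp: algebra_simps)
        moreover have "\<Phi> (sk k) (xk k) t = Y + (if t \<le> sk k then 0 else m t - m (sk k))"
          by (simp add: Y_def flow_before)
        ultimately have "\<Phi> (sk k) (xk k) t - (if t < s then x else \<Phi> s (x + m s - c) t) = (Y - y t) + D k t"
          by (simp only: D_def) (simp add: algebra_simps)
        then show "dist (\<Phi> (sk (\<phi> j)) (xk (\<phi> j)) t) (if t < s then x else \<Phi> s (x + m s - c) t) < e"
          using 1 2 norm_triangle_ineq[of "Y - y t" "D k t"] by (simp only: dist_norm k_def[symmetric])
      qed
    qed
  qed
qed

text \<open>Every subsequence has a further one with the same limit, because uniqueness makes that
  limit an explicit expression in the flow; hence the full sequence converges.\<close>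

lemma flow_limit:
  assumes sk: "\<And>k. sk k \<in> {0..T}" "sk \<longlonglongrightarrow> s" and xk: "xk \<longlonglongrightarrow> x"
    and mk: "(\<lambda>k. m (sk k)) \<longlonglongrightarrow> c"
    and side: "(\<forall>k. s \<le> sk k) \<and> c = m s \<or> (\<forall>k. sk k < s)"
  shows "uniform_limit {0..T} (\<lambda>k. \<Phi> (sk k) (xk k)) (\<lambda>t. if t < s then x else \<Phi> s (x + m s - c) t) sequentially"
proof (rule uniform_limitI, rule ccontr)
  fix e :: real assume e: "0 < e"
  let ?L = "\<lambda>t. if t < s then x else \<Phi> s (x + m s - c) t"
  assume "\<not> (\<forall>\<^sub>F k in sequentially. \<forall>t\<in>{0..T}. dist (\<Phi> (sk k) (xk k) t) (?L t) < e)"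
  from not_eventually_sequentiallyD[OF this] obtain r :: "nat \<Rightarrow> nat" where r: "strict_mono r"
    "\<And>n. \<not> (\<forall>t\<in>{0..T}. dist (\<Phi> (sk (r n)) (xk (r n)) t) (?L t) < e)"
    by blast
  have "\<exists>\<phi>. strict_mono (\<phi> :: nat \<Rightarrow> nat) \<and>
      uniform_limit {0..T} (\<lambda>j. \<Phi> (sk (r (\<phi> j))) (xk (r (\<phi> j)))) ?L sequentially"
    using sk(1) side LIMSEQ_subseq_LIMSEQ[OF sk(2) r(1)] LIMSEQ_subseq_LIMSEQ[OF xk r(1)] LIMSEQ_subseq_LIMSEQ[OF mk r(1)]
    by (intro flow_subsequence[of "\<lambda>k. sk (r k)"]) (auto simp: o_def)
  then obtain \<phi> where "uniform_limit {0..T} (\<lambda>j. \<Phi> (sk (r (\<phi> j))) (xk (r (\<phi> j)))) ?L sequentially"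
    by blast
  from uniform_limitD[OF this e] r(2) show False
    by (auto simp: eventually_sequentially)
qed

lemma flow_limit_right:
  assumes "\<And>k. sk k \<in> {s..T}" "sk \<longlonglongrightarrow> s" "xk \<longlonglongrightarrow> x" "s \<in> {0..T}"
  shows "uniform_limit {0..T} (\<lambda>k. \<Phi> (sk k) (xk k)) (\<Phi> s x) sequentially"
proof -
  have sk: "sk k \<in> {0..T}" "s \<le> sk k" for k using assms(1)[of k] assms(4) by auto
  have "uniform_limit {0..T} (\<lambda>k. \<Phi> (sk k) (xk k)) (\<lambda>t. if t < s then x else \<Phi> s (x + m s - m s) t) sequentially"
    by (rule flow_limit[OF sk(1) assms(2,3) cadlag_on_right_sequentially[OF m_cadlag assms(4,1,2)]])
      (use sk(2) in blast)
  moreover have "(\<lambda>t. if t < s then x else \<Phi> s (x + m s - m s) t) = \<Phi> s x"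
    by (auto simp: flow_before fun_eq_iff)
  ultimately show ?thesis by simp
qed

lemma flow_limit_init:
  assumes "xk \<longlonglongrightarrow> x" "s \<in> {0..T}"
  shows "uniform_limit {0..T} (\<lambda>k. \<Phi> s (xk k)) (\<Phi> s x) sequentially"
  by (rule flow_limit_right[of "\<lambda>_. s"]) (use assms in auto)

lemma flow_continuous:
  assumes "s \<in> {0..T}" "0 < \<epsilon>"
  shows "\<exists>\<delta>>0. \<forall>y. dist y x < \<delta> \<longrightarrow> (\<forall>t\<in>{0..T}. dist (\<Phi> s y t) (\<Phi> s x t) < \<epsilon>)"
proof -
  have "eventually (\<lambda>y. \<forall>t\<in>{0..T}. dist (\<Phi> s y t) (\<Phi> s x t) < \<epsilon>) (at x)"
    using uniform_limitD[OF flow_limit_init[OF _ assms(1)] assms(2)]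
    by (intro sequentially_imp_eventually_at) blast
  then obtain \<delta> where "\<delta> > 0" "\<And>y. y \<noteq> x \<Longrightarrow> dist y x < \<delta> \<Longrightarrow> \<forall>t\<in>{0..T}. dist (\<Phi> s y t) (\<Phi> s x t) < \<epsilon>"
    by (auto simp: eventually_at)
  then show ?thesis using assms(2) by (metis dist_self)
qed

text \<open>Convergence along moving initial points upgrades to uniformity on balls: points
  violating it have a convergent subsequence in the compact ball, and a comparison at its limit,
  through continuity of \<open>L\<close> in the point, gives a contradiction.\<close>

lemma flow_locally_uniform_limit:
  assumes L: "\<And>sk xk x. (\<And>k. sk k \<in> S) \<Longrightarrow> (\<And>k. sk k \<noteq> s) \<Longrightarrow> sk \<longlonglongrightarrow> s \<Longrightarrow> xk \<longlonglongrightarrow> x \<Longrightarrow>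
      uniform_limit {0..T} (\<lambda>k. \<Phi> (sk k) (xk k)) (\<lambda>t. L t x) sequentially"
    and Lcont: "\<And>xk x. xk \<longlonglongrightarrow> x \<Longrightarrow> uniform_limit {0..T} (\<lambda>k t. L t (xk k)) (\<lambda>t. L t x) sequentially"
  shows "uniform_limit ({0..T} \<times> cball 0 R) (\<lambda>r (t, x). \<Phi> r x t) (\<lambda>(t, x). L t x) (at s within S)"
proof (rule uniform_limitI, rule sequentially_imp_eventually_within, intro allI impI, rule ccontr)
  fix e :: real and f assume e: "0 < e" and f: "(\<forall>n. f n \<in> S \<and> f n \<noteq> s) \<and> f \<longlonglongrightarrow> s"
  assume "\<not> (\<forall>\<^sub>F n in sequentially. \<forall>p\<in>{0..T} \<times> cball 0 R.
      dist (case p of (t, x) \<Rightarrow> \<Phi> (f n) x t) (case p of (t, x) \<Rightarrow> L t x) < e)"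
  from not_eventually_sequentiallyD[OF this] obtain r :: "nat \<Rightarrow> nat" where r: "strict_mono r"
    "\<And>n. \<exists>t\<in>{0..T}. \<exists>x\<in>cball 0 R. \<not> dist (\<Phi> (f (r n)) x t) (L t x) < e"
    by auto
  then obtain tk xk where tx: "\<And>n. tk n \<in> {0..T}" "\<And>n. xk n \<in> cball 0 R"
    "\<And>n. \<not> dist (\<Phi> (f (r n)) (xk n) (tk n)) (L (tk n) (xk n)) < e"
    by metis
  obtain x and q :: "nat \<Rightarrow> nat" where q: "strict_mono q" "(xk \<circ> q) \<longlonglongrightarrow> x"
    using compact_imp_seq_compact[OF compact_cball, THEN seq_compactE, of xk 0 R] tx(2) by metis
  have "strict_mono (r \<circ> q)" using r(1) q(1) by (rule strict_mono_o)
  then have fq: "(\<lambda>n. f (r (q n))) \<longlonglongrightarrow> s"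
    using LIMSEQ_subseq_LIMSEQ[of f s "r \<circ> q"] f by (simp add: o_def)
  have xq: "(\<lambda>n. xk (q n)) \<longlonglongrightarrow> x" using q(2) by (simp add: o_def)
  have e2: "0 < e / 2" using e by simp
  have "uniform_limit {0..T} (\<lambda>k. \<Phi> (f (r (q k))) (xk (q k))) (\<lambda>t. L t x) sequentially"
    by (rule L[OF _ _ fq xq]) (use f in auto)
  from uniform_limitD[OF this e2] uniform_limitD[OF Lcont[OF xq] e2]
  have "\<forall>\<^sub>F n in sequentially. False"
  proof eventually_elim
    case (elim n)
    then have "dist (\<Phi> (f (r (q n))) (xk (q n)) (tk (q n))) (L (tk (q n)) (xk (q n))) < e"
      using tx(1)[of "q n"] dist_triangle_half_l[of _ "L (tk (q n)) x"] by blast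
    then show False using tx(3)[of "q n"] by simp
  qed
  then show False by simp
qed

lemma flow_right_uniform:
  assumes "s \<in> {0..<T}"
  shows "uniform_limit ({0..T} \<times> cball 0 R) (\<lambda>r (t, x). \<Phi> r x t) (\<lambda>(t, x). \<Phi> s x t) (at_right s)"
proof -
  have "at_right s = at s within {s<..<T}"
    by (rule at_within_nhd[of _ "{..<T}"]) (use assms in auto)
  moreover have "uniform_limit ({0..T} \<times> cball 0 R) (\<lambda>r (t, x). \<Phi> r x t) (\<lambda>(t, x). \<Phi> s x t) (at s within {s<..<T})"
  proof (rule flow_locally_uniform_limit)
    fix sk and xk :: "nat \<Rightarrow> 'a" and x assume "\<And>k::nat. sk k \<in> {s<..<T}" "sk \<longlonglongrightarrow> s" "xk \<longlonglongrightarrow> x"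
    then show "uniform_limit {0..T} (\<lambda>k. \<Phi> (sk k) (xk k)) (\<lambda>t. \<Phi> s x t) sequentially"
      using assms by (intro flow_limit_right) (auto intro: less_imp_le)
  qed (use assms flow_limit_init in auto)
  ultimately show ?thesis by simp
qed

lemma flow_left_uniform:
  assumes "s \<in> {0<..T}"
  shows "\<exists>l. \<forall>R. uniform_limit ({0..T} \<times> cball 0 R) (\<lambda>r (t, x). \<Phi> r x t) l (at_left s)"
proof -
  obtain c where c: "(m \<longlongrightarrow> c) (at s within ({0..T} \<inter> {..<s}))"
    using m_cadlag assms unfolding cadlag_on_def by (meson atLeastAtMost_iff greaterThanAtMost_iff less_imp_le)
  \<comment> \<open>This is \<psi>(s-,t,x). A start slightly before \<open>s\<close> has the jump at
    \<open>s\<close> still ahead, so the point rests at \<open>x\<close> until \<open>s\<close> and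
    is then displaced by \<open>m s - c\<close>.\<close>
  define L where "L t x = (if t < s then x else \<Phi> s (x + m s - c) t)" for t x
  have al: "at_left s = at s within {0<..<s}"
    by (rule at_within_nhd[of _ "{0<..}"]) (use assms in auto)
  show ?thesis
  proof (intro exI allI)
    fix R
    show "uniform_limit ({0..T} \<times> cball 0 R) (\<lambda>r (t, x). \<Phi> r x t) (\<lambda>(t, x). L t x) (at_left s)"
      unfolding al
    proof (rule flow_locally_uniform_limit)
      fix sk and xk :: "nat \<Rightarrow> 'a" and x assume sk: "\<And>k::nat. sk k \<in> {0<..<s}" "sk \<longlonglongrightarrow> s" "xk \<longlonglongrightarrow> x"
      have sk': "sk k \<in> {0..T}" "sk k < s" for k using sk(1)[of k] assms by auto
      have "(m \<circ> sk) \<longlonglongrightarrow> c"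
        using c[unfolded tendsto_at_iff_sequentially, rule_format, of sk] sk' sk(2) by fastforce
      then have "(\<lambda>k. m (sk k)) \<longlonglongrightarrow> c" by (simp add: o_def)
      from flow_limit[OF sk'(1) sk(2,3) this] sk'(2)
      show "uniform_limit {0..T} (\<lambda>k. \<Phi> (sk k) (xk k)) (\<lambda>t. L t x) sequentially"
        unfolding L_def by blast
    next
      fix xk :: "nat \<Rightarrow> 'a" and x assume x: "xk \<longlonglongrightarrow> x"
      then have x': "(\<lambda>k. xk k + m s - c) \<longlonglongrightarrow> x + m s - c" by (intro tendsto_intros)
      have s: "s \<in> {0..T}" using assms by auto
      show "uniform_limit {0..T} (\<lambda>k t. L t (xk k)) (\<lambda>t. L t x) sequentially"
      proof (rule uniform_limitI)
        fix e :: real assume e: "0 < e"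
        from tendstoD[OF x e] uniform_limitD[OF flow_limit_init[OF x' s] e]
        show "\<forall>\<^sub>F k in sequentially. \<forall>t\<in>{0..T}. dist (L t (xk k)) (L t x) < e"
          by eventually_elim (auto simp: L_def)
      qed
    qed
  qed
qed

end

section \<open>Regularity of solutions in the running time\<close>

context driven_ode
begin

lemma sol_right_sequentially:
  assumes g: "sol s x {s..T} g" and "0 \<le> s" "t \<in> {s..T}" "\<And>k. tk k \<in> {t..T}" "tk \<longlonglongrightarrow> t"
  shows "(\<lambda>k. g (tk k)) \<longlonglongrightarrow> g t"
proof -
  have tk: "tk k \<in> {s..T}" for k using assms(3) assms(4)[of k] by auto
  have "continuous_on {s..T} (\<lambda>v. integral {s..v} (\<lambda>r. F r (g r)))"
    by (rule indefinite_integral_continuous_1[OF driven_solD(3)[OF g]]) (use assms in auto)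
  then have "(\<lambda>k. integral {s..tk k} (\<lambda>r. F r (g r))) \<longlonglongrightarrow> integral {s..t} (\<lambda>r. F r (g r))"
    using assms(3,5) tk unfolding continuous_on_sequentially by (auto simp: o_def)
  moreover have "(\<lambda>k. m (tk k)) \<longlonglongrightarrow> m t"
    by (rule cadlag_on_right_sequentially[OF m_cadlag _ assms(4,5)]) (use assms in auto)
  ultimately have "(\<lambda>k. x + integral {s..tk k} (\<lambda>r. F r (g r)) + m (tk k) - m s) \<longlonglongrightarrow>
      x + integral {s..t} (\<lambda>r. F r (g r)) + m t - m s"
    by (intro tendsto_intros)
  then show ?thesis
    unfolding driven_solD(4)[OF g tk, symmetric] driven_solD(4)[OF g assms(3), symmetric] .
qed

lemma sol_cadlag:
  assumes g: "sol s x {s..T} g" and "0 \<le> s"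
  shows "cadlag_on {s..T} g"
  unfolding cadlag_on_def
proof (intro ballI conjI)
  fix t assume t: "t \<in> {s..T}"
  then have t0: "t \<in> {0..T}" using assms(2) by auto
  define J where "J v = integral {s..v} (\<lambda>r. F r (g r))" for v
  have "continuous_on {s..T} J"
    unfolding J_def
    by (rule indefinite_integral_continuous_1[OF driven_solD(3)[OF g]]) (use t in auto)
  then have J: "(J \<longlongrightarrow> J t) (at t within {s..T})"
    using t by (simp add: continuous_on_def)
  have lim: "(g \<longlongrightarrow> x + J t + l - m s) (at t within S)"
    if S: "S \<subseteq> {s..T}" and l: "(m \<longlongrightarrow> l) (at t within S)" for S l
  proof (rule Lim_transform_eventually)
    show "((\<lambda>v. x + J v + m v - m s) \<longlongrightarrow> x + J t + l - m s) (at t within S)"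
      by (intro tendsto_intros tendsto_within_subset[OF J S] l)
    show "\<forall>\<^sub>F v in at t within S. x + J v + m v - m s = g v"
      unfolding eventually_at_filter J_def
      by (intro always_eventually allI impI driven_solD(4)[OF g, symmetric]) (use S in auto)
  qed
  obtain l where mr: "(m \<longlongrightarrow> m t) (at t within ({0..T} \<inter> {t<..}))"
    and ml: "(m \<longlongrightarrow> l) (at t within ({0..T} \<inter> {..<t}))"
    using m_cadlag t0 unfolding cadlag_on_def by blast
  have sub: "{s..T} \<inter> {t<..} \<subseteq> {0..T} \<inter> {t<..}" "{s..T} \<inter> {..<t} \<subseteq> {0..T} \<inter> {..<t}"
    using assms(2) by auto
  show "(g \<longlongrightarrow> g t) (at t within ({s..T} \<inter> {t<..}))"
    using lim[OF _ tendsto_within_subset[OF mr sub(1)]] driven_solD(4)[OF g t] by (simp add: J_def)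
  show "\<exists>l. (g \<longlongrightarrow> l) (at t within ({s..T} \<inter> {..<t}))"
    using lim[OF _ tendsto_within_subset[OF ml sub(2)]] by blast
qed

end

context driven_flow
begin

lemma flow_right_sequentially:
  assumes "s \<in> {0..T}" "t \<in> {0..T}" "\<And>k. tk k \<in> {t..T}" "tk \<longlonglongrightarrow> t"
  shows "(\<lambda>k. \<Phi> s x (tk k)) \<longlonglongrightarrow> \<Phi> s x t"
proof (cases "t < s")
  case True
  have "\<forall>\<^sub>F k in sequentially. x = \<Phi> s x (tk k)"
    using order_tendstoD(2)[OF assms(4) True] by eventually_elim (simp add: flow_before)
  then show ?thesis
    using True Lim_transform_eventually[OF tendsto_const] by (fastforce simp: flow_before)
next
  case False
  then show ?thesis
    using assms by (intro sol_right_sequentially[OF flow_sol]) auto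
qed

text \<open>Prepares joint measurability: with \<open>xk = gfloor k x\<close> the flow becomes a
  limit of its values at countably many arguments. Both times can be rounded together because
  convergence in the initial time is uniform in \<open>t\<close>.\<close>

lemma flow_dyadic_limit:
  assumes "s \<in> {0..T}" "t \<in> {0..T}" "xk \<longlonglongrightarrow> x"
  shows "(\<lambda>k. \<Phi> (dgrid T k (dceil T k s)) (xk k) (dgrid T k (dceil T k t))) \<longlonglongrightarrow> \<Phi> s x t"
proof -
  have in_ge: "dgrid T k (dceil T k u) \<in> {u..T}" if "u \<in> {0..T}" for u k
    using dceil_bounds[OF T_pos that, of k] dyadicsD[OF dgrid_in_dyadics[OF dceil_bounds(1)[OF T_pos that, of k], of T]]
      T_pos by auto
  define tk where "tk k = dgrid T k (dceil T k t)" for k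
  have ul: "uniform_limit {0..T} (\<lambda>k. \<Phi> (dgrid T k (dceil T k s)) (xk k)) (\<Phi> s x) sequentially"
    by (rule flow_limit_right[OF in_ge dgrid_dceil_tendsto[OF T_pos] assms(3)]) (use assms in auto)
  have tk: "tk k \<in> {t..T}" "tk k \<in> {0..T}" for k using in_ge[OF assms(2), of k] assms(2) by (auto simp: tk_def)
  have "(\<lambda>k. \<Phi> (dgrid T k (dceil T k s)) (xk k) (tk k) - \<Phi> s x (tk k)) \<longlonglongrightarrow> 0"
  proof (rule tendstoI)
    fix e :: real assume "0 < e"
    from uniform_limitD[OF ul this]
    show "\<forall>\<^sub>F k in sequentially. dist (\<Phi> (dgrid T k (dceil T k s)) (xk k) (tk k) - \<Phi> s x (tk k)) 0 < e"
      by eventually_elim (use tk(2) in \<open>simp add: dist_norm\<close>)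
  qed
  moreover have "(\<lambda>k. \<Phi> s x (tk k)) \<longlonglongrightarrow> \<Phi> s x t"
    by (rule flow_right_sequentially[OF assms(1,2) tk(1)]) (unfold tk_def, rule dgrid_dceil_tendsto[OF T_pos assms(2)])
  ultimately have "(\<lambda>k. (\<Phi> (dgrid T k (dceil T k s)) (xk k) (tk k) - \<Phi> s x (tk k)) + \<Phi> s x (tk k)) \<longlonglongrightarrow> 0 + \<Phi> s x t"
    by (rule tendsto_add)
  then show ?thesis by (simp add: tk_def)
qed

end

section \<open>Dyadic chaining\<close>

definition gfloor :: "nat \<Rightarrow> real^'n \<Rightarrow> real^'n" where
  "gfloor j x = (\<chi> i. of_int \<lfloor>2 ^ j * x $ i\<rfloor> / 2 ^ j)"

definition gbox :: "nat \<Rightarrow> nat \<Rightarrow> (real^'n) set" where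
  "gbox j l = {x. \<forall>i. x $ i \<in> (\<lambda>k. of_int k / 2 ^ j) ` {- (2 ^ (l + j))..2 ^ (l + j)}}"

text \<open>Neighbours in the maximum norm, diagonals included: rounding a point at two successive
  levels, or two nearby points at one level, may change all coordinates at once.\<close>

definition gpairs :: "nat \<Rightarrow> nat \<Rightarrow> ((real^'n) \<times> (real^'n)) set" where
  "gpairs j l = {(x, y). x \<in> gbox j l \<and> y \<in> gbox j l \<and> (\<forall>i. \<bar>x $ i - y $ i\<bar> \<le> 1 / 2 ^ j)}"

definition gpoints :: "(real^'n) set" where
  "gpoints = (\<Union>j. range (gfloor j))"

lemma gbox_finite: "finite (gbox j l :: (real^'n) set)"
  and gbox_card: "card (gbox j l :: (real^'n) set) \<le> (2 ^ (l + j + 2)) ^ CARD('n)"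
proof -
  define X :: "real set" where "X = (\<lambda>k. of_int k / 2 ^ j) ` {- (2 ^ (l + j))..2 ^ (l + j)}"
  have fX: "finite X" by (simp add: X_def)
  have "card X \<le> card {- (2 ^ (l + j))..2 ^ (l + j) :: int}"
    unfolding X_def by (rule card_image_le) simp
  also have "\<dots> = nat (2 * 2 ^ (l + j) + 1)" by simp
  also have "\<dots> = 2 * 2 ^ (l + j) + 1"
    by (simp add: nat_add_distrib nat_mult_distrib nat_power_eq)
  also have "\<dots> \<le> 2 ^ (l + j + 2)" by simp
  finally have cX: "card X \<le> 2 ^ (l + j + 2)" .
  have sub: "(gbox j l :: (real^'n) set) \<subseteq> vec_lambda ` (PiE UNIV (\<lambda>_. X))"
  proof
    fix x :: "real^'n" assume "x \<in> gbox j l"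
    then have "x = vec_lambda (\<lambda>i. x $ i)" "(\<lambda>i. x $ i) \<in> PiE UNIV (\<lambda>_. X)"
      by (auto simp: gbox_def X_def PiE_def)
    then show "x \<in> vec_lambda ` (PiE UNIV (\<lambda>_. X))" by (metis imageI)
  qed
  have fP: "finite (PiE (UNIV :: 'n set) (\<lambda>_. X))" by (intro finite_PiE fX) auto
  show "finite (gbox j l :: (real^'n) set)"
    using finite_subset[OF sub] fP by auto
  have "card (gbox j l :: (real^'n) set) \<le> card (PiE (UNIV :: 'n set) (\<lambda>_. X))"
    using card_mono[OF finite_imageI[OF fP] sub] card_image_le[OF fP] le_trans by blast
  also have "\<dots> = card X ^ CARD('n)" by (simp add: card_PiE)
  also have "\<dots> \<le> (2 ^ (l + j + 2)) ^ CARD('n)" using cX by (rule power_mono) simp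
  finally show "card (gbox j l :: (real^'n) set) \<le> (2 ^ (l + j + 2)) ^ CARD('n)" .
qed

lemma gpairs_finite: "finite (gpairs j l :: ((real^'n) \<times> (real^'n)) set)"
  and gpairs_card: "card (gpairs j l :: ((real^'n) \<times> (real^'n)) set) \<le> 2 ^ ((l + j + 2) * (2 * CARD('n)))"
proof -
  have sub: "(gpairs j l :: ((real^'n) \<times> (real^'n)) set) \<subseteq> gbox j l \<times> gbox j l"
    by (auto simp: gpairs_def)
  show "finite (gpairs j l :: ((real^'n) \<times> (real^'n)) set)"
    by (rule finite_subset[OF sub]) (simp add: gbox_finite)
  have "card (gpairs j l :: ((real^'n) \<times> (real^'n)) set) \<le> card (gbox j l :: (real^'n) set) * card (gbox j l :: (real^'n) set)"
    using card_mono[OF _ sub] by (simp add: gbox_finite card_cartesian_product)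
  also have "\<dots> \<le> (2 ^ (l + j + 2)) ^ CARD('n) * (2 ^ (l + j + 2)) ^ CARD('n)"
    by (intro mult_mono gbox_card) auto
  also have "\<dots> = (2 ^ (l + j + 2)) ^ (2 * CARD('n))"
    by (simp only: mult_2 power_add)
  also have "\<dots> = 2 ^ ((l + j + 2) * (2 * CARD('n)))"
    by (rule power_mult[symmetric])
  finally show "card (gpairs j l :: ((real^'n) \<times> (real^'n)) set) \<le> 2 ^ ((l + j + 2) * (2 * CARD('n)))" .
qed

lemma gfloor_abs_diff_le:
  fixes x :: "real^'n"
  shows "norm (gfloor j x - x) \<le> real CARD('n) / 2 ^ j"
proof -
  have "\<bar>(gfloor j x - x) $ i\<bar> \<le> 1 / 2 ^ j" for i
  proof -
    have "(gfloor j x - x) $ i = (of_int \<lfloor>2 ^ j * x $ i\<rfloor> - 2 ^ j * x $ i) / 2 ^ j"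
      by (simp add: gfloor_def field_simps)
    moreover have "\<bar>of_int \<lfloor>2 ^ j * x $ i\<rfloor> - 2 ^ j * x $ i\<bar> \<le> 1" by linarith
    ultimately show ?thesis by (simp add: abs_divide divide_right_mono)
  qed
  then have "(\<Sum>i\<in>UNIV. \<bar>(gfloor j x - x) $ i\<bar>) \<le> (\<Sum>i\<in>(UNIV :: 'n set). 1 / 2 ^ j)"
    by (intro sum_mono) auto
  then show ?thesis using norm_le_l1_cart[of "gfloor j x - x"] by simp
qed

lemma gfloor_tendsto: "(\<lambda>j. gfloor j x) \<longlonglongrightarrow> x"
proof -
  have "(\<lambda>j. gfloor j x - x) \<longlonglongrightarrow> 0"
  proof (rule Lim_null_comparison)
    show "(\<lambda>j. real CARD('a) / 2 ^ j) \<longlonglongrightarrow> 0"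
      by (rule LIMSEQ_divide_realpow_zero) simp
  qed (simp add: gfloor_abs_diff_le)
  then show ?thesis by (rule LIM_zero_cancel)
qed

lemma gfloor_gfloor:
  assumes "j \<le> k"
  shows "gfloor k (gfloor j x) = gfloor j x"
proof -
  obtain d where k: "k = j + d" using assms le_Suc_ex by blast
  have "2 ^ k * (of_int \<lfloor>2 ^ j * x $ i\<rfloor> / 2 ^ j) = (of_int (2 ^ d * \<lfloor>2 ^ j * x $ i\<rfloor>) :: real)" for i
    by (simp add: k power_add)
  then have "gfloor k (gfloor j x) $ i = gfloor j x $ i" for i
    unfolding gfloor_def vec_lambda_beta by (simp only: floor_of_int) (simp add: k power_add)
  then show ?thesis by (simp add: vec_eq_iff)
qed

lemma gpoints_eventually_fixed:
  assumes "x \<in> gpoints"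
  obtains J where "\<And>k. J \<le> k \<Longrightarrow> gfloor k x = x"
  using assms gfloor_gfloor unfolding gpoints_def by blast

lemma countable_gpoints: "countable (gpoints :: (real^'n) set)"
proof -
  have "gpoints \<subseteq> (\<Union>j. \<Union>l. gbox j l :: (real^'n) set)"
  proof
    fix y :: "real^'n" assume "y \<in> gpoints"
    then obtain j x where y: "y = gfloor j x" by (auto simp: gpoints_def)
    define N where "N = Max (range (\<lambda>i. nat \<bar>\<lfloor>2 ^ j * x $ i\<rfloor>\<bar>))"
    have "\<bar>\<lfloor>2 ^ j * x $ i\<rfloor>\<bar> \<le> 2 ^ (N + j)" for i
    proof -
      have "nat \<bar>\<lfloor>2 ^ j * x $ i\<rfloor>\<bar> \<le> N" unfolding N_def by (rule Max_ge) auto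
      also have "\<dots> \<le> 2 ^ N" by (simp add: less_exp less_imp_le)
      also have "\<dots> \<le> 2 ^ (N + j)" by simp
      finally show ?thesis by (simp add: nat_le_iff)
    qed
    then have "- (2 ^ (N + j)) \<le> \<lfloor>2 ^ j * x $ i\<rfloor> \<and> \<lfloor>2 ^ j * x $ i\<rfloor> \<le> 2 ^ (N + j)" for i
      by (metis abs_le_iff minus_le_iff)
    then have "y \<in> gbox j N" by (auto simp: y gbox_def gfloor_def)
    then show "y \<in> (\<Union>j. \<Union>l. gbox j l)" by blast
  qed
  moreover have "countable (\<Union>j. \<Union>l. gbox j l :: (real^'n) set)"
    by (simp add: countable_finite[OF gbox_finite])
  ultimately show ?thesis by (rule countable_subset)
qed

lemma gfloor_in_gpoints: "gfloor j x \<in> gpoints"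
  by (auto simp: gpoints_def)

lemma floor_in_range:
  fixes u :: real
  assumes "\<bar>u\<bar> \<le> of_int K"
  shows "- K \<le> \<lfloor>u\<rfloor> \<and> \<lfloor>u\<rfloor> \<le> K"
  using assms by (simp add: le_floor_iff floor_le_iff abs_le_iff)

lemma gfloor_in_gbox:
  fixes x :: "real^'n"
  assumes "norm x \<le> 2 ^ l"
  shows "gfloor j x \<in> gbox j l" "gfloor j x \<in> gbox (Suc j) l"
proof -
  have b: "- (2 ^ (l + j)) \<le> \<lfloor>2 ^ j * x $ i\<rfloor> \<and> \<lfloor>2 ^ j * x $ i\<rfloor> \<le> 2 ^ (l + j)" for i
  proof (rule floor_in_range)
    have "\<bar>x $ i\<bar> \<le> 2 ^ l" using component_le_norm_cart[of x i] assms by linarith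
    then have "2 ^ j * \<bar>x $ i\<bar> \<le> 2 ^ j * 2 ^ l" by (intro mult_left_mono) auto
    then show "\<bar>2 ^ j * x $ i\<bar> \<le> of_int (2 ^ (l + j))" by (simp add: abs_mult power_add mult.commute)
  qed
  show "gfloor j x \<in> gbox j l"
    using b by (auto simp: gbox_def gfloor_def)
  have "gfloor j x $ i \<in> (\<lambda>k. of_int k / 2 ^ Suc j) ` {- (2 ^ (l + Suc j))..2 ^ (l + Suc j)}" for i
    by (rule image_eqI[of _ _ "2 * \<lfloor>2 ^ j * x $ i\<rfloor>"]) (use b[of i] in \<open>auto simp: gfloor_def\<close>)
  then show "gfloor j x \<in> gbox (Suc j) l" unfolding gbox_def by blast
qed

text \<open>The integer part of \<open>2 * u\<close> is twice that of \<open>u\<close>, or this plus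
  one; refining thus moves each coordinate by 0 or one fine mesh width, and the coarse point lies on
  the fine grid too.\<close>

lemma gfloor_Suc_pair:
  fixes x :: "real^'n"
  assumes "norm x \<le> 2 ^ l"
  shows "(gfloor (Suc j) x, gfloor j x) \<in> gpairs (Suc j) l"
proof -
  have "\<bar>gfloor (Suc j) x $ i - gfloor j x $ i\<bar> \<le> 1 / 2 ^ Suc j" for i
  proof -
    define u where "u = 2 ^ j * x $ i"
    have "2 * \<lfloor>u\<rfloor> \<le> \<lfloor>2 * u\<rfloor>" "\<lfloor>2 * u\<rfloor> \<le> 2 * \<lfloor>u\<rfloor> + 1"
      by (simp add: le_floor_iff, simp add: floor_le_iff) linarith
    then have "\<bar>of_int \<lfloor>2 * u\<rfloor> - 2 * of_int \<lfloor>u\<rfloor> :: real\<bar> \<le> 1" by linarith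
    moreover have "gfloor (Suc j) x $ i - gfloor j x $ i = (of_int \<lfloor>2 * u\<rfloor> - 2 * of_int \<lfloor>u\<rfloor>) / 2 ^ Suc j"
      by (simp add: gfloor_def u_def diff_divide_distrib mult.assoc)
    ultimately show ?thesis by (simp add: abs_divide divide_right_mono)
  qed
  then show ?thesis
    using gfloor_in_gbox[OF assms] by (auto simp: gpairs_def)
qed

lemma gfloor_close_pair:
  fixes x y :: "real^'n"
  assumes "norm x \<le> 2 ^ l" "norm y \<le> 2 ^ l" "norm (x - y) \<le> 1 / 2 ^ j"
  shows "(gfloor j x, gfloor j y) \<in> gpairs j l"
proof -
  have "\<bar>gfloor j x $ i - gfloor j y $ i\<bar> \<le> 1 / 2 ^ j" for i
  proof -
    define u v where "u = 2 ^ j * x $ i" and "v = 2 ^ j * y $ i"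
    have "\<bar>x $ i - y $ i\<bar> \<le> 1 / 2 ^ j"
      using component_le_norm_cart[of "x - y" i] assms(3) by simp
    then have "2 ^ j * \<bar>x $ i - y $ i\<bar> \<le> 1" by (simp add: field_simps)
    then have "\<bar>u - v\<bar> \<le> 1" by (simp add: u_def v_def abs_mult flip: right_diff_distrib)
    then have "\<bar>\<lfloor>u\<rfloor> - \<lfloor>v\<rfloor>\<bar> \<le> 1" by linarith
    then have "\<bar>of_int \<lfloor>u\<rfloor> - of_int \<lfloor>v\<rfloor> :: real\<bar> \<le> 1" by linarith
    moreover have "gfloor j x $ i - gfloor j y $ i = (of_int \<lfloor>u\<rfloor> - of_int \<lfloor>v\<rfloor>) / 2 ^ j"
      by (simp add: gfloor_def u_def v_def diff_divide_distrib)
    ultimately show ?thesis by (simp add: abs_divide divide_right_mono)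
  qed
  then show ?thesis
    using gfloor_in_gbox(1)[OF assms(1)] gfloor_in_gbox(1)[OF assms(2)] by (auto simp: gpairs_def)
qed

text \<open>All coordinates move one unit towards \<open>y\<close> at the same time, so the number
  of steps is governed by the largest coordinate distance, and every intermediate point lies between
  \<open>x\<close> and \<open>y\<close>, hence in the box. It serves points at distance more than
  1.\<close>

lemma unit_grid_path:
  fixes f :: "real^'n \<Rightarrow> 'v::real_normed_vector"
  assumes step: "\<And>x y. (x, y) \<in> gpairs 0 l \<Longrightarrow> norm (f x - f y) \<le> S"
    and "x \<in> gbox 0 l" "y \<in> gbox 0 l" "\<And>i. \<bar>x $ i - y $ i\<bar> \<le> real N"
  shows "norm (f x - f y) \<le> real N * S"
  using assms(2-4)
proof (induction N arbitrary: x)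
  case 0
  then have "x = y" by (auto simp: vec_eq_iff)
  then show ?case by simp
next
  case (Suc N)
  define z where "z = (\<chi> i. x $ i + sgn (y $ i - x $ i))"
  have int: "\<exists>a b::int. x $ i = a \<and> y $ i = b \<and> - (2 ^ l :: int) \<le> a \<and> a \<le> (2 ^ l :: int) \<and> - (2 ^ l :: int) \<le> b \<and> b \<le> (2 ^ l :: int)" for i
  proof -
    have "x $ i \<in> (\<lambda>k. of_int k / 2 ^ 0) ` {- (2 ^ (l + 0))..2 ^ (l + 0)}"
      "y $ i \<in> (\<lambda>k. of_int k / 2 ^ 0) ` {- (2 ^ (l + 0))..2 ^ (l + 0)}"
      using Suc.prems(1,2) unfolding gbox_def by blast+
    then show ?thesis by auto
  qed
  have z: "\<exists>c::int. z $ i = c \<and> - (2 ^ l :: int) \<le> c \<and> c \<le> (2 ^ l :: int) \<and> \<bar>x $ i - z $ i\<bar> \<le> 1 \<and> \<bar>z $ i - y $ i\<bar> \<le> real N" for i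
  proof -
    from int[of i] obtain a b :: int where ab: "x $ i = a" "y $ i = b" "- (2 ^ l :: int) \<le> a" "a \<le> (2 ^ l :: int)" "- (2 ^ l :: int) \<le> b" "b \<le> (2 ^ l :: int)"
      by blast
    have "\<bar>real_of_int a - real_of_int b\<bar> \<le> real (Suc N)" using Suc.prems(3)[of i] ab by simp
    then have d: "\<bar>a - b\<bar> \<le> int (Suc N)" by linarith
    have "z $ i = of_int (a + sgn (b - a))" by (simp add: z_def ab sgn_if)
    moreover have "- (2 ^ l) \<le> a + sgn (b - a)" "a + sgn (b - a) \<le> 2 ^ l"
      using ab by (auto simp: sgn_if)
    moreover have "\<bar>a - (a + sgn (b - a))\<bar> \<le> 1" by (auto simp: sgn_if)
    then have "\<bar>x $ i - of_int (a + sgn (b - a))\<bar> \<le> 1" unfolding ab by linarith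
    moreover have "\<bar>a + sgn (b - a) - b\<bar> \<le> int N" using d by (auto simp: sgn_if)
    then have "\<bar>of_int (a + sgn (b - a)) - y $ i\<bar> \<le> real N" unfolding ab by linarith
    ultimately show ?thesis by (intro exI[of _ "a + sgn (b - a)"]) simp
  qed
  have zb: "z \<in> gbox 0 l"
    unfolding gbox_def
  proof (intro CollectI allI)
    fix i from z[of i] show "z $ i \<in> (\<lambda>k. of_int k / 2 ^ 0) ` {- (2 ^ (l + 0))..2 ^ (l + 0)}" by auto
  qed
  have "(x, z) \<in> gpairs 0 l"
    using z zb Suc.prems(1) by (auto simp: gpairs_def)
  then have 1: "norm (f x - f z) \<le> S" by (rule step)
  have 2: "norm (f z - f y) \<le> real N * S"
    using z by (intro Suc.IH zb Suc.prems(2)) blast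
  show ?case
    using 1 2 norm_triangle_ineq[of "f x - f z" "f z - f y"] by (simp add: distrib_right)
qed

text \<open>A point is reached from its rounding at level \<open>j\<close> through a geometric
  series, and points within \<open>2^-j\<close> have neighbouring roundings at level
  \<open>j\<close>. The level is matched to the distance, the box index to
  \<open>max 1 (max (norm x) (norm y))\<close>. Beyond distance 1 a path of unit steps yields linear
  growth, which the factor with exponent \<open>1 - \<gamma>\<close> records.\<close>

theorem dyadic_chaining:
  fixes \<gamma> \<kappa> :: real
  assumes "0 < \<gamma>" "\<gamma> \<le> 1" "0 \<le> \<kappa>"
  shows "\<exists>C\<ge>0. \<forall>(f :: real^'n \<Rightarrow> 'v::real_normed_vector) B x y. 0 \<le> B \<longrightarrow> x \<in> gpoints \<longrightarrow> y \<in> gpoints \<longrightarrow>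
    (\<forall>j l x y. (x, y) \<in> gpairs j l \<longrightarrow> norm (f x - f y) \<le> B * 2 powr (\<kappa> * l - \<gamma> * j)) \<longrightarrow>
    norm (f x - f y) \<le> C * B * (norm (x - y) powr \<gamma> * max 1 (norm (x - y)) powr (1 - \<gamma>))
       * (max 1 (max (norm x) (norm y))) powr \<kappa>"
proof -
  define q where "q = 2 powr (- \<gamma>)"
  have q: "0 < q" "q < 1" using assms by (simp_all add: q_def powr_less_one)
  have qpow: "2 powr (- (\<gamma> * real j)) = q ^ j" for j
    by (simp add: q_def powr_powr flip: powr_realpow)
  \<comment> \<open>The sum of \<open>q ^ i\<close> over \<open>i \<ge> 1\<close>, that is, the
    length of a chain relative to its starting level. The exact partial sums
    \<open>D * (1 - q ^ d)\<close> let the induction in \<open>tail\<close> close.\<close>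
  define D where "D = q / (1 - q)"
  have D: "D \<ge> 0" using q by (simp add: D_def)
  define C where "C = 2 powr \<kappa> * ((2 * D + 3) * 2)"
  show ?thesis
  proof (intro exI[of _ C] conjI allI impI)
    show "C \<ge> 0" using D by (simp add: C_def)
    fix f :: "real^'n \<Rightarrow> 'v" and B :: real and x y :: "real^'n"
    assume B: "0 \<le> B" and xy: "x \<in> gpoints" "y \<in> gpoints"
      and st: "\<forall>j l x y. (x, y) \<in> gpairs j l \<longrightarrow> norm (f x - f y) \<le> B * 2 powr (\<kappa> * l - \<gamma> * j)"
    define W where "W = max 1 (max (norm x) (norm y))"
    have W: "W \<ge> 1" "norm x \<le> W" "norm y \<le> W" by (auto simp: W_def)
    define l where "l = nat \<lceil>log 2 W\<rceil>"
    have l0: "real l = of_int \<lceil>log 2 W\<rceil>" using W by (simp add: l_def)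
    have "W = 2 powr (log 2 W)" using W by simp
    also have "\<dots> \<le> 2 powr real l" unfolding l0 by (intro powr_mono) auto
    finally have Wl: "W \<le> 2 ^ l" by (simp add: powr_realpow)
    have "2 powr real l \<le> 2 powr (log 2 W + 1)" unfolding l0 by (intro powr_mono) linarith+
    also have "\<dots> = 2 * W" using W by (simp add: powr_add)
    finally have lW: "2 powr real l \<le> 2 * W" .
    define S where "S = B * 2 powr (\<kappa> * l)"
    have S: "S \<ge> 0" using B by (simp add: S_def)
    have "2 powr (\<kappa> * l) = (2 powr real l) powr \<kappa>" by (simp add: powr_powr mult.commute)
    also have "\<dots> \<le> (2 * W) powr \<kappa>" using assms lW by (intro powr_mono2) auto
    also have "\<dots> = 2 powr \<kappa> * W powr \<kappa>" using W by (simp add: powr_mult)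
    finally have SW: "S \<le> B * (2 powr \<kappa> * W powr \<kappa>)" using B by (simp add: S_def mult_left_mono)
    have st': "norm (f u - f v) \<le> S * q ^ j" if "(u, v) \<in> gpairs j l" for u v j
      using st that unfolding S_def qpow[symmetric] by (fastforce simp: powr_add[symmetric] mult.assoc)
    have tail: "norm (f (gfloor (j + d) u) - f (gfloor j u)) \<le> S * q ^ j * (D * (1 - q ^ d))"
      if u: "norm u \<le> W" for u j d
    proof (induction d)
      case (Suc d)
      have "norm (f (gfloor (Suc (j + d)) u) - f (gfloor (j + d) u)) \<le> S * q ^ Suc (j + d)"
        using u Wl by (intro st' gfloor_Suc_pair) auto
      then have "norm (f (gfloor (j + Suc d) u) - f (gfloor j u)) \<le> S * q ^ Suc (j + d) + S * q ^ j * (D * (1 - q ^ d))"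
        using Suc norm_triangle_ineq[of "f (gfloor (Suc (j + d)) u) - f (gfloor (j + d) u)" "f (gfloor (j + d) u) - f (gfloor j u)"]
        by simp
      also have "\<dots> = S * q ^ j * (q ^ Suc d + D * (1 - q ^ d))"
        by (simp add: power_add algebra_simps)
      also have "q ^ Suc d + D * (1 - q ^ d) = D * (1 - q ^ Suc d)"
        using q by (simp add: D_def field_simps)
      finally show ?case .
    qed simp
    \<comment> \<open>A point of \<open>gpoints\<close> is fixed by all sufficiently fine roundings,
      so its chain is finite and \<open>f\<close> need not be continuous.\<close>
    have tail': "norm (f u - f (gfloor j u)) \<le> S * q ^ j * D" if u: "norm u \<le> W" "u \<in> gpoints" for u j
    proof -
      obtain J where J: "\<And>k. J \<le> k \<Longrightarrow> gfloor k u = u" using gpoints_eventually_fixed[OF u(2)] by metis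
      have "norm (f (gfloor (j + J) u) - f (gfloor j u)) \<le> S * q ^ j * (D * (1 - q ^ J))"
        by (rule tail[OF u(1)])
      also have "\<dots> \<le> S * q ^ j * (D * 1)"
        using S q D by (intro mult_left_mono) auto
      finally show ?thesis using J[of "j + J"] by simp
    qed
    have tri: "norm (f x - f y) \<le> 2 * (S * q ^ j * D) + norm (f (gfloor j x) - f (gfloor j y))" for j
    proof -
      have "norm (f x - f y) \<le> norm (f x - f (gfloor j x)) + norm (f (gfloor j x) - f (gfloor j y)) + norm (f y - f (gfloor j y))"
        by norm
      then show ?thesis using tail'[OF W(2) xy(1), of j] tail'[OF W(3) xy(2), of j] by linarith
    qed
    have main: "norm (f x - f y) \<le> S * ((2 * D + 3) * 2 * (norm (x - y) powr \<gamma> * max 1 (norm (x - y)) powr (1 - \<gamma>)))"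
    proof (cases "x = y")
      case False
      define r where "r = norm (x - y)"
      have r: "r > 0" using False by (simp add: r_def)
      show ?thesis
      proof (cases "r \<le> 1")
        case True
        \<comment> \<open>Chosen so that \<open>2^-(j+1) < r \<le> 2^-j\<close>: the upper bound
          makes the roundings neighbours, the lower one bounds \<open>q ^ j\<close> by
          \<open>2 * r powr \<gamma>\<close>.\<close>
        define j where "j = nat \<lfloor>- log 2 r\<rfloor>"
        have "0 \<le> - log 2 r" using r True by simp
        then have j: "real j = of_int \<lfloor>- log 2 r\<rfloor>" by (simp add: j_def)
        have "r = 2 powr (- (- log 2 r))" using r by simp
        also have "\<dots> \<le> 2 powr (- real j)" unfolding j by (intro powr_mono) linarith+
        finally have rj: "r \<le> 1 / 2 ^ j" by (simp add: powr_minus powr_realpow divide_inverse)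
        have "2 powr (- real j) \<le> 2 powr (log 2 r + 1)" unfolding j by (intro powr_mono) linarith+
        also have "\<dots> = 2 * r" using r by (simp add: powr_add)
        finally have jr: "2 powr (- real j) \<le> 2 * r" .
        have "norm (f (gfloor j x) - f (gfloor j y)) \<le> S * q ^ j"
          using W Wl rj by (intro st' gfloor_close_pair) (auto simp: r_def)
        then have "norm (f x - f y) \<le> S * ((2 * D + 1) * q ^ j)"
          using tri[of j] by (simp add: algebra_simps)
        also have "\<dots> \<le> S * ((2 * D + 3) * (2 * r powr \<gamma>))"
        proof (intro mult_left_mono[OF _ S] mult_mono)
          have "q ^ j = (2 powr (- real j)) powr \<gamma>" by (simp add: qpow[symmetric] powr_powr mult.commute)
          also have "\<dots> \<le> (2 * r) powr \<gamma>" using jr assms by (intro powr_mono2) auto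
          also have "\<dots> = 2 powr \<gamma> * r powr \<gamma>" using r by (simp add: powr_mult)
          also have "\<dots> \<le> 2 powr 1 * r powr \<gamma>" using assms by (intro mult_right_mono powr_mono) auto
          finally show "q ^ j \<le> 2 * r powr \<gamma>" by simp
        qed (use D q in auto)
        finally have "norm (f x - f y) \<le> S * ((2 * D + 3) * (2 * r powr \<gamma>))" .
        moreover have "max 1 r = 1" using True by simp
        ultimately show ?thesis
          by (simp only: r_def[symmetric] powr_one_eq_one mult_1_right mult.assoc)
      next
        case False
        \<comment> \<open>Integer parts of numbers at distance at most \<open>r\<close> differ by at
          most \<open>r + 1\<close>; rounded up, this does not exceed \<open>3 * r\<close> because
          \<open>r > 1\<close>.\<close>
        define N where "N = nat \<lceil>r + 1\<rceil>"
        have N: "r + 1 \<le> real N" "real N \<le> 3 * r" using False by (auto simp: N_def) linarith+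
        have "norm (f (gfloor 0 x) - f (gfloor 0 y)) \<le> real N * S"
        proof (rule unit_grid_path)
          show "norm (f u - f v) \<le> S" if "(u, v) \<in> gpairs 0 l" for u v
            using st'[OF that] by simp
          show "gfloor 0 x \<in> gbox 0 l" "gfloor 0 y \<in> gbox 0 l" using W Wl by (auto intro: gfloor_in_gbox)
          fix i
          have "\<bar>x $ i - y $ i\<bar> \<le> r" using component_le_norm_cart[of "x - y" i] by (simp add: r_def)
          then show "\<bar>gfloor 0 x $ i - gfloor 0 y $ i\<bar> \<le> real N"
            using N(1) unfolding gfloor_def by simp linarith
        qed
        also have "\<dots> \<le> 3 * r * S" using N S by (intro mult_right_mono) auto
        finally have "norm (f x - f y) \<le> S * (2 * D + 3 * r)"
          using tri[of 0] by (simp add: algebra_simps)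
        also have "\<dots> \<le> S * ((2 * D + 3) * 2 * r)"
        proof (rule mult_left_mono[OF _ S])
          have "2 * D * 1 \<le> 2 * D * r" using False D by (intro mult_left_mono) auto
          moreover have "0 \<le> 2 * D * r" using r D by simp
          ultimately show "2 * D + 3 * r \<le> (2 * D + 3) * 2 * r" using r by (simp add: algebra_simps)
        qed
        also have "r = r powr \<gamma> * r powr (1 - \<gamma>)" using r by (simp flip: powr_add)
        finally show ?thesis using False by (simp add: r_def[symmetric] max_def mult.assoc)
      qed
    qed simp
    also have "\<dots> \<le> B * (2 powr \<kappa> * W powr \<kappa>) * ((2 * D + 3) * 2 * (norm (x - y) powr \<gamma> * max 1 (norm (x - y)) powr (1 - \<gamma>)))"
      using D by (intro mult_right_mono[OF SW]) auto
    also have "\<dots> = C * B * (norm (x - y) powr \<gamma> * max 1 (norm (x - y)) powr (1 - \<gamma>)) * W powr \<kappa>"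
      by (simp add: C_def)
    finally show "norm (f x - f y) \<le> C * B * (norm (x - y) powr \<gamma> * max 1 (norm (x - y)) powr (1 - \<gamma>))
       * (max 1 (max (norm x) (norm y))) powr \<kappa>" by (simp add: W_def)
  qed
qed

section \<open>The moment sum behind the random Hoelder constant\<close>

text \<open>
  (H1) provides moments of every order, so the exponent \<open>ks_exp\<close> may be taken so large that the crude
  count of all pairs of a grid box is affordable and the constant grows only like \<open>R^(1/m)\<close> on a ball of
  radius \<open>R\<close>. The index \<open>l\<close> below refers to the box of half-width \<open>2^l\<close>, which handles all of space at once.
\<close>

definition ks_exp :: "nat \<Rightarrow> real \<Rightarrow> real" where
  "ks_exp m N = (2 * N + 1) * m"

definition ks_hol :: "nat \<Rightarrow> real \<Rightarrow> real" where
  "ks_hol m N = (m - 2 * N) / m"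

text \<open>Each term is the \<open>p\<close>-th power of an increment divided by its permitted size
  \<open>2 powr (l / m - ks_hol m N * j)\<close>. A finite value therefore controls all scales and
  all boxes at once, uniformly over the times in \<open>D\<close>.\<close>

definition ks_sum :: "nat \<Rightarrow> real set \<Rightarrow> (real^'n \<Rightarrow> real \<Rightarrow> 'v::real_normed_vector) \<Rightarrow> ennreal" where
  "ks_sum m D f = (let N = real CARD('n); p = ks_exp m N in
     \<Sum>j. \<Sum>l. \<Sum>(x, y)\<in>gpairs j l. (SUP t\<in>D. ennreal (norm (f x t - f y t) powr p)) *
       ennreal (2 powr ((ks_hol m N * j - l / m) * p)))"

lemma card_ge_1: "1 \<le> real CARD('n::finite)"
  by (simp add: Suc_leI)

text \<open>Trades the \<open>p\<close>-th root for \<open>1 + K\<close>. The Hoelder constant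
  becomes affine in the moment sum, so a bound on the mean of the sum bounds its mean
  directly.\<close>

lemma le_one_plus_of_powr_le:
  assumes "u powr p \<le> K" "1 \<le> p" "0 \<le> u"
  shows "u \<le> 1 + (K::real)"
proof (cases "u \<le> 1")
  case True
  have "0 \<le> K" using assms(1) powr_ge_zero order_trans by blast
  then show ?thesis using True by simp
next
  case False
  then have "u powr 1 \<le> u powr p" using assms by (intro powr_mono) auto
  then show ?thesis using assms False by simp
qed

lemma ks_sum_step:
  fixes f :: "real^'n \<Rightarrow> real \<Rightarrow> 'v::real_normed_vector"
  assumes m: "2 * CARD('n) < m" and fin: "ks_sum m D f < \<infinity>" and t: "t \<in> D" and xy: "(x, y) \<in> gpairs j l"
  shows "norm (f x t - f y t) \<le> (1 + enn2real (ks_sum m D f)) * 2 powr (1 / m * l - ks_hol m CARD('n) * j)"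
proof -
  define N p where "N = real CARD('n)" and "p = ks_exp m N"
  define c where "c = ks_hol m N * j - l / m"
  have N: "1 \<le> N" using card_ge_1 by (simp add: N_def)
  have "1 * 1 \<le> (2 * N + 1) * real m" using N m by (intro mult_mono) auto
  then have p: "1 \<le> p" by (simp add: p_def ks_exp_def)
  define a where "a j l x y = (SUP t\<in>D. ennreal (norm (f x t - f y t) powr p)) *
       ennreal (2 powr ((ks_hol m N * real j - real l / m) * p))" for j l x y
  have K: "ks_sum m D f = (\<Sum>j. \<Sum>l. \<Sum>(x, y)\<in>gpairs j l. a j l x y)"
    by (simp add: ks_sum_def Let_def a_def N_def p_def)
  have "ennreal (norm (f x t - f y t) powr p) * ennreal (2 powr (c * p)) \<le> a j l x y"
    unfolding a_def c_def by (intro mult_right_mono SUP_upper t) auto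
  also have "\<dots> \<le> (\<Sum>(x, y)\<in>gpairs j l. a j l x y)"
    using member_le_sum[of "(x, y)" "gpairs j l" "\<lambda>(x, y). a j l x y"] xy gpairs_finite by auto
  also have "\<dots> \<le> (\<Sum>l. \<Sum>(x, y)\<in>gpairs j l. a j l x y)"
    using sum_le_suminf[of "\<lambda>l. \<Sum>(x, y)\<in>gpairs j l. a j l x y" "{l}"] by simp
  also have "\<dots> \<le> ks_sum m D f"
    unfolding K using sum_le_suminf[of "\<lambda>j. \<Sum>l. \<Sum>(x, y)\<in>gpairs j l. a j l x y" "{j}"] by simp
  finally have "ennreal (norm (f x t - f y t) powr p * 2 powr (c * p)) \<le> ks_sum m D f"
    by (simp add: ennreal_mult)
  then have "norm (f x t - f y t) powr p * 2 powr (c * p) \<le> enn2real (ks_sum m D f)"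
    using fin by (metis enn2real_ennreal enn2real_mono mult_nonneg_nonneg powr_ge_zero infinity_ennreal_def)
  moreover have "norm (f x t - f y t) powr p * 2 powr (c * p) = (norm (f x t - f y t) * 2 powr c) powr p"
    by (simp add: powr_mult powr_powr)
  ultimately have "norm (f x t - f y t) * 2 powr c \<le> 1 + enn2real (ks_sum m D f)"
    using p by (intro le_one_plus_of_powr_le) auto
  then have "norm (f x t - f y t) * 2 powr c * 2 powr (- c) \<le> (1 + enn2real (ks_sum m D f)) * 2 powr (- c)"
    by (intro mult_right_mono) auto
  moreover have "norm (f x t - f y t) * 2 powr c * 2 powr (- c) = norm (f x t - f y t)"
    by (simp add: mult.assoc flip: powr_add)
  ultimately have "norm (f x t - f y t) \<le> (1 + enn2real (ks_sum m D f)) * 2 powr (- c)"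
    by (simp only:)
  then show ?thesis by (simp add: c_def N_def)
qed

text \<open>The modulus of continuity required in (iii).\<close>

definition ks_weight :: "nat \<Rightarrow> real^'n \<Rightarrow> real^'n \<Rightarrow> real" where
  "ks_weight m x y = norm (x - y) powr ((real m - 2 * real CARD('n)) / real m)
     * max ((max (norm x) (norm y)) powr ((2 * real CARD('n) + 1) / real m)) 1"

text \<open>Chaining with \<gamma> = (m-2n)/m and \<kappa> = 1/m leaves a power 2n/m of
  \<open>max 1 (norm (x - y))\<close>, which the triangle inequality turns into the same power of
  \<open>max 1 (max (norm x) (norm y))\<close>, up to a factor 2. Together with the power 1/m this
  is the origin of the exponent (2n+1)/m.\<close>

lemma ks_sum_bound:
  assumes m: "2 * CARD('n) < m"
  shows "\<exists>C\<ge>0. \<forall>D (f :: real^'n \<Rightarrow> real \<Rightarrow> 'v::real_normed_vector) x y t. ks_sum m D f < \<infinity> \<longrightarrow> t \<in> D \<longrightarrow>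
    x \<in> gpoints \<longrightarrow> y \<in> gpoints \<longrightarrow> norm (f x t - f y t) \<le> C * (1 + enn2real (ks_sum m D f)) * ks_weight m x y"
proof -
  define N where "N = real CARD('n)"
  have N: "1 \<le> N" using card_ge_1 by (simp add: N_def)
  have mN: "2 * N < real m" using m by (simp add: N_def)
  define \<gamma> where "\<gamma> = ks_hol m N"
  have \<gamma>: "0 < \<gamma>" "\<gamma> \<le> 1" "1 - \<gamma> = 2 * N / m" using mN N by (simp_all add: \<gamma>_def ks_hol_def field_simps)
  obtain C where C: "C \<ge> 0" "\<And>(g :: real^'n \<Rightarrow> 'v) B x y. 0 \<le> B \<Longrightarrow> x \<in> gpoints \<Longrightarrow> y \<in> gpoints \<Longrightarrow>
    (\<And>j l x y. (x, y) \<in> gpairs j l \<Longrightarrow> norm (g x - g y) \<le> B * 2 powr (1 / m * l - \<gamma> * j)) \<Longrightarrow>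
    norm (g x - g y) \<le> C * B * (norm (x - y) powr \<gamma> * max 1 (norm (x - y)) powr (1 - \<gamma>))
       * (max 1 (max (norm x) (norm y))) powr (1 / m)"
    using dyadic_chaining[where 'v='v and 'n='n, OF \<gamma>(1,2), of "1 / m"] by auto
  show ?thesis
  proof (intro exI[of _ "2 * C"] conjI allI impI)
    fix D and f :: "real^'n \<Rightarrow> real \<Rightarrow> 'v" and x y :: "real^'n" and t
    assume fin: "ks_sum m D f < \<infinity>" and t: "t \<in> D" and xy: "x \<in> gpoints" "y \<in> gpoints"
    define B where "B = 1 + enn2real (ks_sum m D f)"
    have B: "0 \<le> B" by (simp add: B_def)
    define v where "v = max (norm x) (norm y)"
    define W where "W = max 1 v"
    have W: "1 \<le> W" by (simp add: W_def)
    have v: "0 \<le> v" by (simp add: v_def le_max_iff_disj)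
    have "norm (x - y) \<le> 2 * W"
      using norm_triangle_ineq4[of x y] by (auto simp: W_def v_def max_def)
    then have "max 1 (norm (x - y)) powr (1 - \<gamma>) \<le> (2 * W) powr (1 - \<gamma>)"
      using W \<gamma> by (intro powr_mono2) auto
    also have "\<dots> = 2 powr (1 - \<gamma>) * W powr (1 - \<gamma>)" using W by (simp add: powr_mult)
    also have "\<dots> \<le> 2 powr 1 * W powr (1 - \<gamma>)" using \<gamma> by (intro mult_right_mono powr_mono) auto
    finally have m1: "max 1 (norm (x - y)) powr (1 - \<gamma>) \<le> 2 * W powr (1 - \<gamma>)" by simp
    have "norm (f x t - f y t) \<le> C * B * (norm (x - y) powr \<gamma> * max 1 (norm (x - y)) powr (1 - \<gamma>)) * W powr (1 / m)"
      unfolding W_def v_def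
      by (rule C(2)[of B x y "\<lambda>x. f x t", OF B xy]) (use ks_sum_step[OF m fin t] in \<open>auto simp: B_def \<gamma>_def N_def\<close>)
    also have "\<dots> \<le> C * B * (norm (x - y) powr \<gamma> * (2 * W powr (1 - \<gamma>))) * W powr (1 / m)"
      using C(1) B m1 by (intro mult_right_mono mult_left_mono) auto
    also have "\<dots> = 2 * C * B * (norm (x - y) powr \<gamma> * W powr ((1 - \<gamma>) + 1 / m))"
      by (simp add: powr_add)
    also have "(1 - \<gamma>) + 1 / m = (2 * N + 1) / m" unfolding \<gamma>(3) by (simp add: add_divide_distrib)
    also have "W powr ((2 * N + 1) / m) = max (v powr ((2 * N + 1) / m)) 1"
    proof (cases "v \<le> 1")
      case True
      then have "v powr ((2 * N + 1) / m) \<le> 1 powr ((2 * N + 1) / m)" using v N by (intro powr_mono2) auto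
      then show ?thesis using True by (simp add: W_def max_def)
    next
      case False
      then have "1 powr ((2 * N + 1) / m) \<le> v powr ((2 * N + 1) / m)" using N by (intro powr_mono2) auto
      then show ?thesis using False by (simp add: W_def max_def)
    qed
    finally show "norm (f x t - f y t) \<le> 2 * C * (1 + enn2real (ks_sum m D f)) * ks_weight m x y"
      by (simp add: B_def ks_weight_def v_def \<gamma>_def ks_hol_def N_def mult.assoc)
  qed (use C in auto)
qed

lemma gpairs_norm_le:
  assumes "(x, y) \<in> (gpairs j l :: ((real^'n) \<times> (real^'n)) set)"
  shows "norm (x - y) \<le> real CARD('n) / 2 ^ j"
proof -
  have "(\<Sum>i\<in>UNIV. \<bar>(x - y) $ i\<bar>) \<le> (\<Sum>i\<in>(UNIV :: 'n set). 1 / 2 ^ j)"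
    using assms by (intro sum_mono) (auto simp: gpairs_def)
  then show ?thesis using norm_le_l1_cart[of "x - y"] by simp
qed

lemma suminf_ennreal_half: "0 \<le> c \<Longrightarrow> (\<Sum>l. ennreal (c * (1/2) ^ l)) = ennreal (2 * c)"
  using sums_mult[OF geometric_sums[of "1/2 :: real"], of c]
  by (intro suminf_ennreal_eq) (auto simp: mult.commute)

lemma borel_measurable_ks_sum:
  fixes f :: "'a \<Rightarrow> real^'n \<Rightarrow> real \<Rightarrow> 'v::{real_normed_vector, second_countable_topology}"
  assumes "countable D" "\<And>x t. t \<in> D \<Longrightarrow> (\<lambda>\<omega>. f \<omega> x t) \<in> borel_measurable M"
  shows "(\<lambda>\<omega>. ks_sum m D (f \<omega>)) \<in> borel_measurable M"
proof -
  have "(\<lambda>\<omega>. SUP t\<in>D. ennreal (norm (f \<omega> x t - f \<omega> y t) powr p)) \<in> borel_measurable M" for x y p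
    using assms by (intro borel_measurable_SUP) auto
  then show ?thesis
    unfolding ks_sum_def Let_def case_prod_beta
    by (intro borel_measurable_suminf_order borel_measurable_sum borel_measurable_times_ennreal borel_measurable_const)
qed

text \<open>The exponents of 2 balance. There are at most 2^(2N(l+j+2)) pairs, the moments are of
  order 2^(-jp), and the weights are 2^(jp(m-2N)/m - lp/m). With p/m = 2N+1 the total exponent is 4N
  - l - 4 N^2 j, so the double series is dominated by a geometric one; \<open>ks_exp\<close> is
  chosen to leave the factor 2^(-l).\<close>

lemma nn_integral_ks_sum:
  fixes f :: "'a \<Rightarrow> real^'n \<Rightarrow> real \<Rightarrow> 'v::{real_normed_vector, second_countable_topology}"
  assumes m: "2 * CARD('n) < m" and D: "countable D"
    and meas: "\<And>x t. t \<in> D \<Longrightarrow> (\<lambda>\<omega>. f \<omega> x t) \<in> borel_measurable M"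
    and C: "0 \<le> C" and moment: "\<And>x y. (\<integral>\<^sup>+\<omega>. (SUP t\<in>D. ennreal (norm (f \<omega> x t - f \<omega> y t) powr ks_exp m CARD('n))) \<partial>M)
       \<le> ennreal (C * norm (x - y) powr ks_exp m CARD('n))"
  shows "(\<integral>\<^sup>+\<omega>. ks_sum m D (f \<omega>) \<partial>M)
    \<le> ennreal (4 * (C * real CARD('n) powr ks_exp m CARD('n) * 2 ^ (4 * CARD('n))))"
proof -
  define n where "n = CARD('n)"
  define N p where "N = real CARD('n)" and "p = ks_exp m N"
  have N: "1 \<le> N" using card_ge_1 by (simp add: N_def)
  have mN: "2 * N < real m" using m by (simp add: N_def)
  define S where "S \<omega> x y = (SUP t\<in>D. ennreal (norm (f \<omega> x t - f \<omega> y t) powr p))" for \<omega> x y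
  have Sm[measurable]: "(\<lambda>\<omega>. S \<omega> x y) \<in> borel_measurable M" for x y
    unfolding S_def using D meas by (intro borel_measurable_SUP) auto
  define w where "w j l = 2 powr ((ks_hol m N * real j - real l / m) * p)" for j l :: nat
  define c where "c = C * N powr p * 2 ^ (4 * n)"
  have c: "0 \<le> c" using C by (simp add: c_def)
  have inner: "(\<integral>\<^sup>+\<omega>. (\<Sum>(x, y)\<in>gpairs j l. S \<omega> x y * ennreal (w j l)) \<partial>M) \<le> ennreal (c * (1/2) ^ j * (1/2) ^ l)" for j l
  proof -
    have "(\<integral>\<^sup>+\<omega>. (\<Sum>(x, y)\<in>gpairs j l. S \<omega> x y * ennreal (w j l)) \<partial>M) =
        (\<Sum>(x, y)\<in>gpairs j l. (\<integral>\<^sup>+\<omega>. S \<omega> x y * ennreal (w j l) \<partial>M))"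
      unfolding case_prod_beta by (rule nn_integral_sum) auto
    also have "\<dots> = (\<Sum>(x, y)\<in>gpairs j l. (\<integral>\<^sup>+\<omega>. S \<omega> x y \<partial>M) * ennreal (w j l))"
      by (intro sum.cong refl) (auto simp: nn_integral_multc)
    also have "\<dots> \<le> (\<Sum>(x, y)\<in>(gpairs j l :: ((real^'n) \<times> (real^'n)) set). ennreal (C * (N / 2 ^ j) powr p) * ennreal (w j l))"
    proof (intro sum_mono)
      fix z :: "(real^'n) \<times> (real^'n)" assume z: "z \<in> gpairs j l"
      obtain x y where z': "z = (x, y)" by (cases z)
      with z have xy: "(x, y) \<in> gpairs j l" by simp
      have "0 \<le> p" using N by (simp add: p_def ks_exp_def)
      then have "C * norm (x - y) powr p \<le> C * (N / 2 ^ j) powr p"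
        using gpairs_norm_le[OF xy] C by (intro mult_left_mono powr_mono2) (auto simp: N_def)
      then have "(\<integral>\<^sup>+\<omega>. S \<omega> x y \<partial>M) \<le> ennreal (C * (N / 2 ^ j) powr p)"
        using moment[of x y] unfolding S_def p_def N_def by (meson ennreal_leI order_trans)
      then show "(case z of (x, y) \<Rightarrow> (\<integral>\<^sup>+\<omega>. S \<omega> x y \<partial>M) * ennreal (w j l))
          \<le> (case z of (x, y) \<Rightarrow> ennreal (C * (N / 2 ^ j) powr p) * ennreal (w j l))"
        by (simp add: z' mult_right_mono)
    qed
    also have "\<dots> = ennreal (real (card (gpairs j l :: ((real^'n) \<times> (real^'n)) set)) * (C * (N / 2 ^ j) powr p * w j l))"
      using C N by (simp add: w_def ennreal_of_nat_eq_real_of_nat flip: ennreal_mult)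
    also have "\<dots> \<le> ennreal (2 ^ ((l + j + 2) * (2 * n)) * (C * (N / 2 ^ j) powr p * w j l))"
    proof (intro ennreal_leI mult_right_mono)
      have "real (card (gpairs j l :: ((real^'n) \<times> (real^'n)) set)) \<le> real (2 ^ ((l + j + 2) * (2 * CARD('n))))"
        using gpairs_card[of j l, where 'n='n] by (simp only: of_nat_le_iff)
      then show "real (card (gpairs j l :: ((real^'n) \<times> (real^'n)) set)) \<le> 2 ^ ((l + j + 2) * (2 * n))"
        by (simp add: n_def)
    qed (use C in \<open>simp add: w_def\<close>)
    also have "2 ^ ((l + j + 2) * (2 * n)) * (C * (N / 2 ^ j) powr p * w j l) \<le> c * (1/2) ^ j * (1/2) ^ l"
    proof -
      have a1: "(2 :: real) ^ ((l + j + 2) * (2 * n)) = 2 powr ((real l + real j + 2) * (2 * N))"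
      proof -
        have "real ((l + j + 2) * (2 * n)) = (real l + real j + 2) * (2 * N)" by (simp add: n_def N_def algebra_simps)
        then show ?thesis by (metis powr_realpow zero_less_numeral)
      qed
      have "(N / 2 ^ j) powr p = (N * 2 powr (- real j)) powr p"
        by (simp add: powr_minus powr_realpow divide_inverse)
      also have "\<dots> = N powr p * 2 powr (- (real j * p))"
        using N by (simp add: powr_mult powr_powr)
      finally have npow: "(N / 2 ^ j) powr p = N powr p * 2 powr (- (real j * p))" .
      have "2 ^ ((l + j + 2) * (2 * n)) * (C * (N / 2 ^ j) powr p * w j l) =
          C * N powr p * (2 powr ((real l + real j + 2) * (2 * N)) * 2 powr (- (real j * p)) * 2 powr ((ks_hol m N * real j - real l / m) * p))"
        unfolding a1 w_def npow by (simp only: mult_ac)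
      also have "\<dots> = C * N powr p * 2 powr ((real l + real j + 2) * (2 * N) + - (real j * p) + (ks_hol m N * real j - real l / m) * p)"
        by (simp only: powr_add)
      also have "\<dots> \<le> C * N powr p * 2 powr (4 * N + - real j + - real l)"
      proof (intro mult_left_mono powr_mono)
        have pm: "p / m = 2 * N + 1" using mN N by (simp add: p_def ks_exp_def)
        have ph: "ks_hol m N * p = p - 2 * N * (2 * N + 1)"
          using mN N by (simp add: p_def ks_exp_def ks_hol_def field_simps)
        have "(ks_hol m N * real j - real l / m) * p = (ks_hol m N * p) * real j - (p / m) * real l"
          by (simp add: algebra_simps)
        also have "\<dots> = real j * p - 2 * N * (2 * N + 1) * real j - (2 * N + 1) * real l"
          unfolding pm ph by (simp add: algebra_simps)
        finally have e: "(real l + real j + 2) * (2 * N) + - (real j * p) + (ks_hol m N * real j - real l / m) * p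
            = 4 * N - real l - 4 * (N * N) * real j"
          by (simp add: algebra_simps)
        have "1 * 1 \<le> N * N" using N by (intro mult_mono) auto
        then have "1 * real j \<le> 4 * (N * N) * real j" by (intro mult_right_mono) auto
        then show "(real l + real j + 2) * (2 * N) + - (real j * p) + (ks_hol m N * real j - real l / m) * p \<le> 4 * N + - real j + - real l"
          unfolding e by simp
      qed (use C in auto)
      also have "2 powr (4 * N + - real j + - real l) = 2 ^ (4 * n) * (1/2) ^ j * (1/2) ^ l"
      proof -
        have "2 powr real (4 * n) = (2::real) ^ (4 * n)" by (rule powr_realpow) simp
        moreover have "real (4 * n) = 4 * N" by (simp add: n_def N_def)
        moreover have "2 powr (- real i) = (1/2 :: real) ^ i" for i
          by (simp add: powr_minus_divide powr_realpow power_one_over)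
        ultimately show ?thesis
          by (simp only: powr_add)
      qed
      finally show ?thesis by (simp add: c_def)
    qed
    finally show ?thesis by (simp add: ennreal_leI)
  qed
  have "(\<integral>\<^sup>+\<omega>. ks_sum m D (f \<omega>) \<partial>M) = (\<integral>\<^sup>+\<omega>. (\<Sum>j. \<Sum>l. \<Sum>(x, y)\<in>gpairs j l. S \<omega> x y * ennreal (w j l)) \<partial>M)"
    by (simp add: ks_sum_def Let_def S_def w_def N_def p_def)
  also have "\<dots> = (\<Sum>j. \<Sum>l. (\<integral>\<^sup>+\<omega>. (\<Sum>(x, y)\<in>gpairs j l. S \<omega> x y * ennreal (w j l)) \<partial>M))"
    by (subst nn_integral_suminf, (auto simp: case_prod_beta intro!: borel_measurable_suminf_order)[1],
        subst nn_integral_suminf) (auto simp: case_prod_beta)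
  also have "\<dots> \<le> (\<Sum>j. \<Sum>l. ennreal (c * (1/2) ^ j * (1/2) ^ l))"
    by (intro suminf_le inner summableI)
  also have "\<dots> = (\<Sum>j. ennreal (2 * c * (1/2) ^ j))"
  proof -
    have "(\<Sum>l. ennreal (c * (1/2) ^ j * (1/2) ^ l)) = ennreal (2 * (c * (1/2) ^ j))" for j
      using c by (intro suminf_ennreal_half) simp
    then show ?thesis by (simp only: mult.assoc)
  qed
  also have "\<dots> = ennreal (4 * c)" using c by (subst suminf_ennreal_half) auto
  finally show ?thesis by (simp add: c_def N_def p_def n_def)
qed

section \<open>Strong solutions\<close>

lemma space_FL [simp]: "space (FL P L s t) = space P"
  by (simp add: FL_def space_measure_of_conv)

lemma space_FL_gen [simp]: "space (FL_gen P L s t) = space P"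
  by (simp add: FL_gen_def space_measure_of_conv)

lemma sets_FL:
  "sets (FL P L s t) = sigma_sets (space P)
     {A. A \<subseteq> space P \<and> (\<exists>B\<in>sets (FL_gen P L s t). \<exists>N\<in>null_sets P. (A - B) \<union> (B - A) \<subseteq> N)}"
  unfolding FL_def by (rule sets_measure_of) blast

lemma sets_FL_gen:
  "sets (FL_gen P L s t) = sigma_sets (space P)
     (\<Union>r\<in>{s..t}. {(\<lambda>\<omega>. L r \<omega> - L s \<omega>) -` B \<inter> space P | B. B \<in> sets borel})"
  unfolding FL_gen_def by (rule sets_measure_of) blast

lemma FL_basic:
  assumes "A \<subseteq> space P" "B \<in> sets (FL_gen P L s t)" "N \<in> null_sets P" "(A - B) \<union> (B - A) \<subseteq> N"
  shows "A \<in> sets (FL P L s t)"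
  unfolding sets_FL using assms by (intro sigma_sets.Basic) blast

lemma FL_null_subset:
  assumes "N \<in> null_sets P" "A \<subseteq> N"
  shows "A \<in> sets (FL P L s t)"
proof (rule FL_basic[OF _ sets.empty_sets assms(1)])
  show "A \<subseteq> space P" using assms null_setsD2 sets.sets_into_space by blast
qed (use assms in auto)

lemma FL_gen_increment_measurable:
  fixes L :: "real \<Rightarrow> 'a \<Rightarrow> real^'d"
  assumes "u \<in> {s..t}"
  shows "(\<lambda>\<omega>. L u \<omega> - L s \<omega>) \<in> borel_measurable (FL_gen P L s t)"
proof (rule measurableI)
  fix B :: "(real^'d) set" assume "B \<in> sets borel"
  then show "(\<lambda>\<omega>. L u \<omega> - L s \<omega>) -` B \<inter> space (FL_gen P L s t) \<in> sets (FL_gen P L s t)"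
    unfolding sets_FL_gen space_FL_gen using assms by (intro sigma_sets.Basic) blast
qed simp

text \<open>Increments from \<open>r\<close> are differences of increments from \<open>s\<close>.
  Hence a process restarted at \<open>r\<close> remains adapted when seen from the earlier
  start.\<close>

lemma FL_gen_mono:
  fixes L :: "real \<Rightarrow> 'a \<Rightarrow> real^'d"
  assumes "s \<le> r" "t \<le> t'"
  shows "sets (FL_gen P L r t) \<subseteq> sets (FL_gen P L s t')"
  unfolding sets_FL_gen[of P L r t]
proof (rule sets.sigma_sets_subset'[of _ "FL_gen P L s t'", simplified])
  show "(\<Union>u\<in>{r..t}. {(\<lambda>\<omega>. L u \<omega> - L r \<omega>) -` B \<inter> space P | B. B \<in> sets borel}) \<subseteq> sets (FL_gen P L s t')"
  proof clarify
    fix u and B :: "(real^'d) set" assume u: "u \<in> {r..t}" and B: "B \<in> sets borel"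
    have "(\<lambda>\<omega>. (L u \<omega> - L s \<omega>) - (L r \<omega> - L s \<omega>)) \<in> borel_measurable (FL_gen P L s t')"
      using u assms by (intro borel_measurable_diff FL_gen_increment_measurable) auto
    from measurable_sets[OF this B]
    show "(\<lambda>\<omega>. L u \<omega> - L r \<omega>) -` B \<inter> space P \<in> sets (FL_gen P L s t')" by simp
  qed
  show "space P \<in> sets (FL_gen P L s t')" using sets.top[of "FL_gen P L s t'"] by simp
qed

lemma FL_mono:
  assumes "s \<le> r" "t \<le> t'"
  shows "sets (FL P L r t) \<subseteq> sets (FL P L s t')"
  unfolding sets_FL using FL_gen_mono[OF assms, of P L] by (intro sigma_sets_mono') blast

lemma measurable_FL_mono:
  assumes "f \<in> borel_measurable (FL P L r t)" "s \<le> r" "t \<le> t'"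
  shows "f \<in> borel_measurable (FL P L s t')"
  using assms(1) FL_mono[OF assms(2,3), of P L] unfolding measurable_def by auto

text \<open>A set of the completion differs from a generated one by subsets of a null set, and these
  are measurable because \<open>P\<close> is complete.\<close>

lemma FL_subset:
  fixes L :: "real \<Rightarrow> 'a \<Rightarrow> real^'d"
  assumes "complete_measure P" "\<And>t. 0 \<le> t \<Longrightarrow> L t \<in> borel_measurable P" "0 \<le> s"
  shows "sets (FL P L s t) \<subseteq> sets P"
proof -
  interpret complete_measure P by fact
  have gen: "sets (FL_gen P L s t) \<subseteq> sets P"
    unfolding sets_FL_gen
  proof (rule sets.sigma_sets_subset)
    show "(\<Union>r\<in>{s..t}. {(\<lambda>\<omega>. L r \<omega> - L s \<omega>) -` B \<inter> space P | B. B \<in> sets borel}) \<subseteq> sets P"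
    proof clarify
      fix u and B :: "(real^'d) set" assume u: "u \<in> {s..t}" and B: "B \<in> sets borel"
      have "(\<lambda>\<omega>. L u \<omega> - L s \<omega>) \<in> borel_measurable P"
        using u assms by (intro borel_measurable_diff) auto
      from measurable_sets[OF this B]
      show "(\<lambda>\<omega>. L u \<omega> - L s \<omega>) -` B \<inter> space P \<in> sets P" .
    qed
  qed
  show ?thesis
    unfolding sets_FL
  proof (rule sets.sigma_sets_subset, clarify)
    fix A B N assume A: "A \<subseteq> space P" "B \<in> sets (FL_gen P L s t)" "N \<in> null_sets P" "(A - B) \<union> (B - A) \<subseteq> N"
    have "A - B \<in> sets P" "B - A \<in> sets P" by (rule complete[OF _ A(3)]; use A(4) in blast)+
    moreover have "A = (B - (B - A)) \<union> (A - B)" by blast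
    ultimately show "A \<in> sets P" using gen A(2) by (metis sets.Diff sets.Un subsetD)
  qed
qed

text \<open>All subsets of null sets belong to \<open>FL\<close>, so an arbitrary change on a null
  set preserves adaptedness. This passes adaptedness from a chosen strong solution to the flow,
  which agrees with it almost surely.\<close>

lemma measurable_FL_modify:
  fixes V W :: "'a \<Rightarrow> 'b::topological_space"
  assumes V: "V \<in> borel_measurable (FL P L s t)" and N: "N \<in> null_sets P"
    and eq: "\<And>\<omega>. \<omega> \<in> space P - N \<Longrightarrow> V \<omega> = W \<omega>"
  shows "W \<in> borel_measurable (FL P L s t)"
proof (rule measurableI)
  fix B :: "'b set" assume B: "B \<in> sets borel"
  have 1: "V -` B \<inter> space P \<in> sets (FL P L s t)" using measurable_sets[OF V B] by simp
  have 2: "N \<in> sets (FL P L s t)" "W -` B \<inter> space P \<inter> N \<in> sets (FL P L s t)"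
    by (rule FL_null_subset[OF N]; blast)+
  have eq': "W -` B \<inter> space (FL P L s t) = (V -` B \<inter> space P - N) \<union> (W -` B \<inter> space P \<inter> N)"
    using eq by auto
  show "W -` B \<inter> space (FL P L s t) \<in> sets (FL P L s t)"
    unfolding eq' by (intro sets.Un sets.Diff 1 2)
qed simp

lemma (in prob_space) AE_iff_prob_1:
  "(AE \<omega> in M. Q \<omega>) \<longleftrightarrow> (\<exists>\<Omega>\<in>sets M. measure M \<Omega> = 1 \<and> (\<forall>\<omega>\<in>\<Omega>. Q \<omega>))"
proof
  assume "AE \<omega> in M. Q \<omega>"
  then obtain N where N: "\<And>\<omega>. \<omega> \<in> space M - N \<Longrightarrow> Q \<omega>" "N \<in> null_sets M"
    by (rule AE_E3) blast
  then have "measure M (space M - N) = 1"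
    by (subst prob_compl) (auto simp: measure_eq_0_null_sets)
  then show "\<exists>\<Omega>\<in>sets M. measure M \<Omega> = 1 \<and> (\<forall>\<omega>\<in>\<Omega>. Q \<omega>)"
    using N by (intro bexI[of _ "space M - N"]) auto
next
  assume "\<exists>\<Omega>\<in>sets M. measure M \<Omega> = 1 \<and> (\<forall>\<omega>\<in>\<Omega>. Q \<omega>)"
  then obtain \<Omega> where \<Omega>: "\<Omega> \<in> sets M" "measure M \<Omega> = 1" "\<forall>\<omega>\<in>\<Omega>. Q \<omega>" by blast
  from AE_prob_1[OF \<Omega>(2)] show "AE \<omega> in M. Q \<omega>"
    by eventually_elim (use \<Omega>(3) in blast)
qed

section \<open>Consequences of (H1) for strong solutions\<close>

locale hoelder_sde =
  fixes P :: "'a measure" and L :: "real \<Rightarrow> 'a \<Rightarrow> real^'d"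
    and b :: "real \<Rightarrow> real^'n \<Rightarrow> real^'n" and A :: "real^'n^'n"
    and M :: "real \<Rightarrow> 'a \<Rightarrow> real^'n" and T \<beta> Kb Cb :: real
  assumes prob: "prob_space P" and complete: "complete_measure P"
    and T_pos: "0 < T" and \<beta>_pos: "0 < \<beta>" and \<beta>_le_1: "\<beta> \<le> 1"
    and L_meas: "\<And>t. 0 \<le> t \<Longrightarrow> L t \<in> borel_measurable P"
    and b_bound: "\<And>t x. t \<in> {0..T} \<Longrightarrow> norm (b t x) \<le> Kb"
    and b_hoelder: "\<And>t x x'. t \<in> {0..T} \<Longrightarrow> norm (b t x - b t x') \<le> Cb * norm (x - x') powr \<beta>"
    and M_cadlag: "AE \<omega> in P. cadlag_on {0..T} (\<lambda>t. M t \<omega>)"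
    and H1: "H1 P L b A M T"
begin

abbreviation "drift \<equiv> \<lambda>r z. b r z + A *v z"
abbreviation "path_ode \<omega> \<equiv> driven_ode T drift (\<lambda>t. M t \<omega>) \<bar>Kb\<bar> (onorm ((*v) A)) \<bar>Cb\<bar> \<beta>"
abbreviation "path_flow \<omega> \<equiv> driven_flow T drift (\<lambda>t. M t \<omega>) \<bar>Kb\<bar> (onorm ((*v) A)) \<bar>Cb\<bar> \<beta>"
abbreviation "path_sol \<omega> \<equiv> driven_sol drift (\<lambda>t. M t \<omega>)"
abbreviation "strong s x V \<equiv> strong_solution P L b A M T s x V"

lemma driven:
  assumes "cadlag_on {0..T} (\<lambda>t. M t \<omega>)"
  shows "path_ode \<omega>"
proof
  have bl: "bounded_linear ((*v) A)" by (rule matrix_vector_mul_bounded_linear)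
  show "0 \<le> onorm ((*v) A)" by (rule onorm_pos_le[OF bl])
  show "norm (b t z + A *v z) \<le> \<bar>Kb\<bar> + onorm ((*v) A) * norm z" if "t \<in> {0..T}" for t z
    using norm_triangle_ineq[of "b t z" "A *v z"] b_bound[OF that, of z] onorm[OF bl, of z] by linarith
  show "norm (b t z + A *v z - (b t z' + A *v z')) \<le> \<bar>Cb\<bar> * norm (z - z') powr \<beta> + onorm ((*v) A) * norm (z - z')"
    if "t \<in> {0..T}" for t z z'
  proof -
    have eq: "b t z + A *v z - (b t z' + A *v z') = (b t z - b t z') + A *v (z - z')"
      by (simp add: matrix_vector_mult_diff_distrib)
    have "Cb * norm (z - z') powr \<beta> \<le> \<bar>Cb\<bar> * norm (z - z') powr \<beta>"
      by (intro mult_right_mono) auto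
    then show ?thesis
      using norm_triangle_ineq[of "b t z - b t z'" "A *v (z - z')"] b_hoelder[OF that, of z z'] onorm[OF bl, of "z - z'"]
      unfolding eq by linarith
  qed
qed (use assms T_pos \<beta>_pos \<beta>_le_1 in auto)

lemma strong_before: "strong s x V \<Longrightarrow> t \<in> {0..s} \<Longrightarrow> \<omega> \<in> space P \<Longrightarrow> V t \<omega> = x"
  unfolding strong_solution_def by blast

lemma strong_FL: "strong s x V \<Longrightarrow> t \<in> {s..T} \<Longrightarrow> V t \<in> borel_measurable (FL P L s t)"
  unfolding strong_solution_def by blast

lemma strong_iff:
  "strong s x V \<longleftrightarrow>
     (\<forall>t\<in>{0..s}. \<forall>\<omega>\<in>space P. V t \<omega> = x) \<and>
     (\<forall>t\<in>{s..T}. V t \<in> borel_measurable (FL P L s t)) \<and>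
     (AE \<omega> in P. cadlag_on {s..T} (\<lambda>t. V t \<omega>) \<and> cadlag_on {0..T} (\<lambda>t. L t \<omega>) \<and>
                  L 0 \<omega> = 0 \<and> path_sol \<omega> s x {s..T} (\<lambda>t. V t \<omega>))"
  unfolding strong_solution_def solves_E_iff_driven_sol prob_space.AE_iff_prob_1[OF prob] by blast

lemma strong_AE:
  assumes "strong s x V"
  shows "AE \<omega> in P. cadlag_on {s..T} (\<lambda>t. V t \<omega>) \<and> cadlag_on {0..T} (\<lambda>t. L t \<omega>) \<and>
                  L 0 \<omega> = 0 \<and> path_sol \<omega> s x {s..T} (\<lambda>t. V t \<omega>)"
  using assms unfolding strong_iff by blast

lemma measurable_FL_P:
  assumes "f \<in> borel_measurable (FL P L s t)" "0 \<le> s"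
  shows "f \<in> borel_measurable P"
  using assms(1) FL_subset[where L=L and t=t, OF complete L_meas assms(2)] unfolding measurable_def by auto

lemma strong_measurable:
  assumes "strong s x V" "s \<in> {0..T}" "t \<in> {0..T}"
  shows "V t \<in> borel_measurable P"
proof (cases "t \<le> s")
  case True
  then have "V t \<omega> = x" if "\<omega> \<in> space P" for \<omega>
    using strong_before[OF assms(1) _ that, of t] assms(3) by auto
  then show ?thesis by (simp cong: measurable_cong)
next
  case False
  then show ?thesis
    using assms by (intro measurable_FL_P[OF strong_FL[OF assms(1)]]) auto
qed

lemma H1_moment:
  assumes "2 \<le> p"
  obtains C where "C > 0" "\<forall>s\<in>{0..T}. \<forall>x y Z1 Z2. strong s x Z1 \<longrightarrow> strong s y Z2 \<longrightarrow>
        (\<integral>\<^sup>+\<omega>. (\<Squnion>t\<in>{s..T}. ennreal (norm (Z1 t \<omega> - Z2 t \<omega>) powr p)) \<partial>P) \<le> ennreal (C * norm (x - y) powr p)"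
proof -
  have "\<forall>p\<ge>2. \<exists>C>0. \<forall>s\<in>{0..T}. \<forall>x y Z1 Z2. strong s x Z1 \<longrightarrow> strong s y Z2 \<longrightarrow>
        (\<integral>\<^sup>+\<omega>. (\<Squnion>t\<in>{s..T}. ennreal (norm (Z1 t \<omega> - Z2 t \<omega>) powr p)) \<partial>P) \<le> ennreal (C * norm (x - y) powr p)"
    using H1 unfolding H1_def by (rule conjunct2)
  from this[rule_format, OF assms] show ?thesis using that by (elim exE conjE)
qed

text \<open>The supremum in (H1) runs over \<open>{s..T}\<close>. At earlier times both solutions
  rest at their starting points, values already attained at time \<open>s\<close>. Restricting to
  dyadic times makes the supremum countable, hence measurable.\<close>

lemma strong_moment:
  assumes "2 \<le> p"
  shows "\<exists>C\<ge>0. \<forall>s\<in>{0..T}. \<forall>f. (\<forall>x. strong s x (f x)) \<longrightarrow> (\<forall>x y.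
     (\<integral>\<^sup>+\<omega>. (SUP t\<in>dyadics T. ennreal (norm (f x t \<omega> - f y t \<omega>) powr p)) \<partial>P) \<le> ennreal (C * norm (x - y) powr p))"
proof -
  obtain C where C: "C > 0" "\<forall>s\<in>{0..T}. \<forall>x y Z1 Z2. strong s x Z1 \<longrightarrow> strong s y Z2 \<longrightarrow>
        (\<integral>\<^sup>+\<omega>. (\<Squnion>t\<in>{s..T}. ennreal (norm (Z1 t \<omega> - Z2 t \<omega>) powr p)) \<partial>P) \<le> ennreal (C * norm (x - y) powr p)"
    by (rule H1_moment[OF assms])
  show ?thesis
  proof (intro exI[of _ C] conjI ballI allI impI)
    fix s f x y assume s: "s \<in> {0..T}" and f: "\<forall>x. strong s x (f x)"
    have "(\<integral>\<^sup>+\<omega>. (SUP t\<in>dyadics T. ennreal (norm (f x t \<omega> - f y t \<omega>) powr p)) \<partial>P)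
        \<le> (\<integral>\<^sup>+\<omega>. (\<Squnion>t\<in>{s..T}. ennreal (norm (f x t \<omega> - f y t \<omega>) powr p)) \<partial>P)"
    proof (intro nn_integral_mono SUP_least)
      fix \<omega> t assume \<omega>: "\<omega> \<in> space P" and t: "t \<in> dyadics T"
      have t0: "t \<in> {0..T}" using dyadicsD[OF t] T_pos by auto
      define t' where "t' = max s t"
      have "f x t \<omega> = f x t' \<omega>" "f y t \<omega> = f y t' \<omega>"
        using strong_before[OF spec[OF f] _ \<omega>, of t] strong_before[OF spec[OF f] _ \<omega>, of s] t0 s
        by (auto simp: t'_def max_def)
      moreover have "t' \<in> {s..T}" using t0 s by (auto simp: t'_def)
      ultimately show "ennreal (norm (f x t \<omega> - f y t \<omega>) powr p) \<le> (\<Squnion>t\<in>{s..T}. ennreal (norm (f x t \<omega> - f y t \<omega>) powr p))"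
        using SUP_upper[of t' "{s..T}" "\<lambda>t. ennreal (norm (f x t \<omega> - f y t \<omega>) powr p)"] by simp
    qed
    also have "\<dots> \<le> ennreal (C * norm (x - y) powr p)"
      using f by (intro C(2)[rule_format, OF s]) auto
    finally show "(\<integral>\<^sup>+\<omega>. (SUP t\<in>dyadics T. ennreal (norm (f x t \<omega> - f y t \<omega>) powr p)) \<partial>P) \<le> ennreal (C * norm (x - y) powr p)" .
  qed (use C in auto)
qed

text \<open>The constant does not depend on \<open>s\<close>; this is what allows the Hoelder
  constants to be summed over a grid and, later, integrated over the initial time.\<close>

lemma strong_ks_sum:
  assumes m: "2 * CARD('n) < m"
  shows "\<exists>C\<ge>0. \<forall>s\<in>{0..T}. \<forall>f. (\<forall>x. strong s x (f x)) \<longrightarrow>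
     (\<lambda>\<omega>. ks_sum m (dyadics T) (\<lambda>x t. f x t \<omega>)) \<in> borel_measurable P \<and>
     (\<integral>\<^sup>+\<omega>. ks_sum m (dyadics T) (\<lambda>x t. f x t \<omega>) \<partial>P) \<le> ennreal C"
proof -
  define p where "p = ks_exp m CARD('n)"
  have N: "1 \<le> real CARD('n)" by (rule card_ge_1)
  then have "3 \<le> real m" using m by linarith
  then have "1 * 2 \<le> (2 * real CARD('n) + 1) * real m" using N by (intro mult_mono) auto
  then have "2 \<le> p" by (simp add: p_def ks_exp_def)
  from strong_moment[OF this] obtain C where C: "C \<ge> 0" "\<forall>s\<in>{0..T}. \<forall>f. (\<forall>x. strong s x (f x)) \<longrightarrow> (\<forall>x y.
     (\<integral>\<^sup>+\<omega>. (SUP t\<in>dyadics T. ennreal (norm (f x t \<omega> - f y t \<omega>) powr p)) \<partial>P) \<le> ennreal (C * norm (x - y) powr p))"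
    by (elim exE conjE)
  show ?thesis
  proof (intro exI conjI ballI allI impI)
    fix s f assume s: "s \<in> {0..T}" and f: "\<forall>x. strong s x (f x)"
    have fm: "(\<lambda>\<omega>. f x t \<omega>) \<in> borel_measurable P" if "t \<in> dyadics T" for x t
      using strong_measurable[OF spec[OF f] s dyadicsD[OF that]] T_pos by simp
    show "(\<lambda>\<omega>. ks_sum m (dyadics T) (\<lambda>x t. f x t \<omega>)) \<in> borel_measurable P"
      using fm by (intro borel_measurable_ks_sum countable_dyadics)
    show "(\<integral>\<^sup>+\<omega>. ks_sum m (dyadics T) (\<lambda>x t. f x t \<omega>) \<partial>P) \<le> ennreal (4 * (C * real CARD('n) powr p * 2 ^ (4 * CARD('n))))"
      unfolding p_def
      by (intro nn_integral_ks_sum[OF m countable_dyadics fm C(1)] C(2)[unfolded p_def, rule_format, OF s] spec[OF f])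
  qed (use C(1) in simp)
qed

text \<open>For equal starting points the right-hand side of (H1) is zero, so the solutions agree
  almost surely at each single time. The dyadic times share one null set, and right continuity gives
  the remaining times.\<close>

lemma strong_unique:
  assumes s: "s \<in> {0..T}" and V: "strong s x V" and W: "strong s x W"
  shows "AE \<omega> in P. \<forall>t\<in>{s..T}. V t \<omega> = W t \<omega>"
proof -
  obtain C where C: "C > 0" "\<forall>s\<in>{0..T}. \<forall>x y Z1 Z2. strong s x Z1 \<longrightarrow> strong s y Z2 \<longrightarrow>
        (\<integral>\<^sup>+\<omega>. (\<Squnion>t\<in>{s..T}. ennreal (norm (Z1 t \<omega> - Z2 t \<omega>) powr 2)) \<partial>P) \<le> ennreal (C * norm (x - y) powr 2)"
    by (rule H1_moment[OF order_refl])
  have "AE \<omega> in P. V t \<omega> = W t \<omega>" if t: "t \<in> {s..T}" for t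
  proof -
    have [measurable]: "V t \<in> borel_measurable P" "W t \<in> borel_measurable P"
      using strong_measurable[OF V s] strong_measurable[OF W s] t s by auto
    have "(\<integral>\<^sup>+\<omega>. ennreal (norm (V t \<omega> - W t \<omega>) powr 2) \<partial>P) \<le>
        (\<integral>\<^sup>+\<omega>. (\<Squnion>t\<in>{s..T}. ennreal (norm (V t \<omega> - W t \<omega>) powr 2)) \<partial>P)"
      by (intro nn_integral_mono SUP_upper t)
    also have "\<dots> \<le> 0" using C(2)[rule_format, OF s V W] by simp
    finally have "AE \<omega> in P. ennreal (norm (V t \<omega> - W t \<omega>) powr 2) = 0"
      by (subst nn_integral_0_iff_AE[symmetric]) auto
    then show ?thesis by eventually_elim simp
  qed
  then have "AE \<omega> in P. \<forall>t\<in>dyadics T \<inter> {s..T}. V t \<omega> = W t \<omega>"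
    by (intro AE_ball_countable[THEN iffD2] countable_Int1 countable_dyadics) auto
  with strong_AE[OF V] strong_AE[OF W] show ?thesis
  proof eventually_elim
    case (elim \<omega>)
    show ?case
    proof
      fix t assume t: "t \<in> {s..T}"
      then have t0: "t \<in> {0..T}" using s by auto
      obtain tk where tk: "\<And>k. tk k \<in> dyadics T" "\<And>k. tk k \<in> {t..T}" and lim: "tk \<longlonglongrightarrow> t"
        by (rule dyadic_approximation[OF T_pos t0]) blast
      have "(\<lambda>k. V (tk k) \<omega>) \<longlonglongrightarrow> V t \<omega>" "(\<lambda>k. W (tk k) \<omega>) \<longlonglongrightarrow> W t \<omega>"
        using elim by (auto intro!: cadlag_on_right_sequentially[OF _ t tk(2) lim])
      moreover have "V (tk k) \<omega> = W (tk k) \<omega>" for k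
        using elim tk[of k] t by auto
      ultimately show "V t \<omega> = W t \<omega>" using LIMSEQ_unique by auto
    qed
  qed
qed

text \<open>An arbitrary selection: no regularity in \<open>s\<close> or \<open>x\<close> is built
  in, and the exceptional null set varies with both.\<close>

definition Z :: "real \<Rightarrow> real^'n \<Rightarrow> real \<Rightarrow> 'a \<Rightarrow> real^'n" where
  "Z s x = (SOME V. strong s x V)"

lemma strong_Z: "s \<in> {0..T} \<Longrightarrow> strong s x (Z s x)"
proof -
  assume s: "s \<in> {0..T}"
  have "\<forall>s\<in>{0..T}. \<forall>x. \<exists>V. strong s x V" using H1 unfolding H1_def by (rule conjunct1)
  from this[rule_format, OF s] show "strong s x (Z s x)" unfolding Z_def by (rule someI_ex)
qed

end

section \<open>Solutions started on the dyadic grid\<close>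

lemma borel_measurable_gfloor [measurable]: "gfloor j \<in> borel_measurable (borel :: (real^'n) measure)"
proof -
  have "gfloor j = (\<lambda>x :: real^'n. \<Sum>i\<in>UNIV. (of_int \<lfloor>2 ^ j * x $ i\<rfloor> / 2 ^ j) *\<^sub>R axis i 1)"
  proof
    fix x :: "real^'n"
    have "gfloor j x = (\<Sum>i\<in>UNIV. gfloor j x $ i *\<^sub>R axis i 1)"
      using basis_expansion[of "gfloor j x"] by (simp add: scalar_mult_eq_scaleR)
    then show "gfloor j x = (\<Sum>i\<in>UNIV. (of_int \<lfloor>2 ^ j * x $ i\<rfloor> / 2 ^ j) *\<^sub>R axis i 1)"
      by (simp add: gfloor_def)
  qed
  moreover have [measurable]: "(\<lambda>x :: real^'n. x $ i) \<in> borel_measurable borel" for i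
    by (intro borel_measurable_continuous_onI continuous_on_component continuous_on_id)
  ultimately show ?thesis by simp
qed

lemma measurable_gfloor_count_space:
  fixes g :: "'a \<Rightarrow> real^'n"
  assumes [measurable]: "g \<in> borel_measurable N"
  shows "(\<lambda>\<omega>. gfloor j (g \<omega>)) \<in> measurable N (count_space gpoints)"
proof (subst measurable_count_space_eq_countable[OF countable_gpoints], intro conjI ballI)
  fix q :: "real^'n"
  have "(\<lambda>\<omega>. gfloor j (g \<omega>)) \<in> borel_measurable N" by measurable
  from measurable_sets[OF this, of "{q}"]
  show "(\<lambda>\<omega>. gfloor j (g \<omega>)) -` {q} \<inter> space N \<in> sets N" by simp
qed (auto intro: gfloor_in_gpoints)

text \<open>A random point may be inserted into a family with no regularity in its index once it is
  rounded, since then only countably many members occur. It yields adaptedness of solutions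
  restarted at a random point.\<close>

lemma measurable_compose_gfloor:
  fixes g :: "'a \<Rightarrow> real^'n"
  assumes "\<And>q. f q \<in> borel_measurable N" "g \<in> borel_measurable N"
  shows "(\<lambda>\<omega>. f (gfloor j (g \<omega>)) \<omega>) \<in> borel_measurable N"
  by (rule measurable_compose_countable'[OF assms(1) measurable_gfloor_count_space[OF assms(2)] countable_gpoints])

lemma ks_weight_le:
  fixes x y :: "real^'n"
  assumes "norm x \<le> R" "norm y \<le> R"
  shows "ks_weight m x y \<le> max (R powr ((2 * real CARD('n) + 1) / real m)) 1 * norm (x - y) powr ks_hol m CARD('n)"
proof -
  have "max (norm x) (norm y) powr ((2 * real CARD('n) + 1) / real m) \<le> R powr ((2 * real CARD('n) + 1) / real m)"
    using assms by (intro powr_mono2) (auto simp: le_max_iff_disj)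
  then have "max (max (norm x) (norm y) powr ((2 * real CARD('n) + 1) / real m)) 1
      \<le> max (R powr ((2 * real CARD('n) + 1) / real m)) 1" by linarith
  then show ?thesis
    unfolding ks_weight_def ks_hol_def by (subst mult.commute) (intro mult_right_mono, auto)
qed

lemma norm_gfloor_le: "norm (gfloor j x) \<le> norm x + real CARD('n)" for x :: "real^'n"
proof -
  have "norm (gfloor j x - x) \<le> real CARD('n) / 2 ^ j" by (rule gfloor_abs_diff_le)
  also have "\<dots> \<le> real CARD('n) / 1" by (intro divide_left_mono) auto
  finally show ?thesis using norm_triangle_sub[of "gfloor j x" x] by simp
qed

lemma convergent_along_gfloor:
  fixes f :: "real^'n \<Rightarrow> 'v::banach"
  assumes f: "\<And>x z. x \<in> gpoints \<Longrightarrow> z \<in> gpoints \<Longrightarrow> norm x \<le> norm y + CARD('n) \<Longrightarrow> norm z \<le> norm y + CARD('n) \<Longrightarrow>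
      norm (f x - f z) \<le> B * norm (x - z) powr \<gamma>" and \<gamma>: "0 < \<gamma>"
  shows "convergent (\<lambda>j. f (gfloor j y))"
proof -
  have "Cauchy (\<lambda>j. f (gfloor j y))"
  proof (rule metric_CauchyI)
    fix e :: real assume e: "0 < e"
    \<comment> \<open>\<open>d\<close> solves
      \<open>(\<bar>B\<bar> + 1) * d powr \<gamma> = e\<close>; the added 1 avoids division by zero
      and makes the final inequality strict.\<close>
    define d where "d = (e / (\<bar>B\<bar> + 1)) powr (1 / \<gamma>)"
    have d: "0 < d" using e by (simp add: d_def)
    obtain N where N: "\<And>i j. i \<ge> N \<Longrightarrow> j \<ge> N \<Longrightarrow> dist (gfloor i y) (gfloor j y) < d"
      using metric_CauchyD[OF LIMSEQ_imp_Cauchy[OF gfloor_tendsto[of y]] d] by blast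
    show "\<exists>N. \<forall>i\<ge>N. \<forall>j\<ge>N. dist (f (gfloor i y)) (f (gfloor j y)) < e"
    proof (intro exI allI impI)
      fix i j assume "N \<le> i" "N \<le> j"
      have "dist (f (gfloor i y)) (f (gfloor j y)) \<le> B * norm (gfloor i y - gfloor j y) powr \<gamma>"
        unfolding dist_norm by (intro f gfloor_in_gpoints norm_gfloor_le)
      also have "\<dots> \<le> \<bar>B\<bar> * norm (gfloor i y - gfloor j y) powr \<gamma>" by (intro mult_right_mono) auto
      also have "\<dots> \<le> \<bar>B\<bar> * d powr \<gamma>"
        using N[OF \<open>N \<le> i\<close> \<open>N \<le> j\<close>] \<gamma> by (intro mult_left_mono powr_mono2) (auto simp: dist_norm)
      also have "d powr \<gamma> = e / (\<bar>B\<bar> + 1)" using e \<gamma> by (simp add: d_def powr_powr)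
      also have "\<bar>B\<bar> * (e / (\<bar>B\<bar> + 1)) < e" using e by (simp add: field_simps)
      finally show "dist (f (gfloor i y)) (f (gfloor j y)) < e" .
    qed
  qed
  then show ?thesis by (simp add: Cauchy_convergent_iff)
qed

lemma AE_finite_of_nn_integral_le:
  assumes "f \<in> borel_measurable M" "(\<integral>\<^sup>+x. f x \<partial>M) \<le> ennreal C"
  shows "AE x in M. f x < (\<infinity>::ennreal)"
proof -
  have "(\<integral>\<^sup>+x. f x \<partial>M) \<noteq> \<infinity>" using assms(2) by (auto simp: top_unique)
  from nn_integral_noteq_infinite[OF assms(1) this] show ?thesis
    by eventually_elim (simp add: less_top)
qed

context hoelder_sde
begin

definition Zsum :: "nat \<Rightarrow> real \<Rightarrow> 'a \<Rightarrow> ennreal" where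
  "Zsum m s \<omega> = ks_sum m (dyadics T) (\<lambda>x t. Z s x t \<omega>)"

text \<open>\<open>enn2real\<close> sends infinity to 0, so the value is a genuine bound only where
  \<open>Zsum\<close> is finite, a condition kept separately in \<open>good\<close>.\<close>

definition Hol :: "nat \<Rightarrow> real \<Rightarrow> 'a \<Rightarrow> real" where
  "Hol m s \<omega> = 1 + enn2real (Zsum m s \<omega>)"

text \<open>The conditions on solutions involve countably many times and points, so that one null
  set suffices. The last clause is the limit hypothesis of the uniqueness theorem.\<close>

definition good :: "nat \<Rightarrow> 'a \<Rightarrow> bool" where
  "good m \<omega> \<longleftrightarrow> \<omega> \<in> space P \<and> cadlag_on {0..T} (\<lambda>t. M t \<omega>) \<and>
     (\<forall>s\<in>dyadics T. \<forall>q\<in>gpoints. path_sol \<omega> s q {s..T} (\<lambda>t. Z s q t \<omega>)) \<and>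
     (\<forall>s\<in>dyadics T. Zsum m s \<omega> < \<infinity>) \<and>
     (\<lambda>k. (\<Sum>i\<le>2^k. Hol m (dgrid T k i) \<omega>) * (T / 2 ^ k) powr ((1 + \<beta>) * ks_hol m CARD('n))) \<longlonglongrightarrow> 0"

lemma dyadic_in: "s \<in> dyadics T \<Longrightarrow> s \<in> {0..T}"
  using dyadicsD[of s T] T_pos by simp

text \<open>The mean of the \<open>k\<close>th weighted sum is at most (2^k + 1)(1 + C)(T/2^k)^e,
  which decays geometrically as e > 1. The series of these sums thus has finite mean, converges
  almost surely, and its terms tend to 0.\<close>

lemma AE_Hol_sum_tendsto_0:
  assumes m: "2 * CARD('n) < m" and e1: "1 < e"
  shows "AE \<omega> in P. (\<forall>s\<in>dyadics T. Zsum m s \<omega> < \<infinity>) \<and>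
     (\<lambda>k. (\<Sum>i\<le>2^k. Hol m (dgrid T k i) \<omega>) * (T / 2 ^ k) powr e) \<longlonglongrightarrow> 0"
proof -
  obtain C where C: "C \<ge> 0" and K: "\<And>s. s \<in> {0..T} \<Longrightarrow> Zsum m s \<in> borel_measurable P"
    "\<And>s. s \<in> {0..T} \<Longrightarrow> (\<integral>\<^sup>+\<omega>. Zsum m s \<omega> \<partial>P) \<le> ennreal C"
  proof -
    obtain C where "C \<ge> 0" and C: "\<forall>s\<in>{0..T}. \<forall>f. (\<forall>x. strong s x (f x)) \<longrightarrow>
     (\<lambda>\<omega>. ks_sum m (dyadics T) (\<lambda>x t. f x t \<omega>)) \<in> borel_measurable P \<and>
     (\<integral>\<^sup>+\<omega>. ks_sum m (dyadics T) (\<lambda>x t. f x t \<omega>) \<partial>P) \<le> ennreal C"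
      using strong_ks_sum[OF m] by (elim exE conjE)
    have "Zsum m s \<in> borel_measurable P \<and> (\<integral>\<^sup>+\<omega>. Zsum m s \<omega> \<partial>P) \<le> ennreal C" if s: "s \<in> {0..T}" for s
      unfolding Zsum_def[abs_def] by (rule C[rule_format, OF s strong_Z[OF s]])
    then show ?thesis using that[OF \<open>C \<ge> 0\<close>] by blast
  qed
  have fin: "AE \<omega> in P. \<forall>s\<in>dyadics T. Zsum m s \<omega> < \<infinity>"
    by (intro AE_ball_countable[THEN iffD2] countable_dyadics ballI AE_finite_of_nn_integral_le[OF K] dyadic_in)
  define a where "a k \<omega> = (\<Sum>i\<le>2^k. 1 + Zsum m (dgrid T k i) \<omega>) * ennreal ((T / 2 ^ k) powr e)" for k \<omega>
  have Km: "(\<lambda>\<omega>. Zsum m (dgrid T k i) \<omega>) \<in> borel_measurable P" if "i \<le> 2 ^ k" for k i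
    using K(1)[OF dyadic_in[OF dgrid_in_dyadics[OF that]]] by simp
  have sm: "(\<lambda>\<omega>. \<Sum>i\<le>2^k. 1 + Zsum m (dgrid T k i) \<omega>) \<in> borel_measurable P" for k
    by (intro borel_measurable_sum borel_measurable_add borel_measurable_const Km) auto
  have am: "a k \<in> borel_measurable P" for k
    unfolding a_def[abs_def] by (intro borel_measurable_times_ennreal sm borel_measurable_const)
  define q where "q = 2 powr (1 - e)"
  have q: "0 < q" "q < 1" using e1 by (simp_all add: q_def powr_less_one)
  define c where "c = 2 * (1 + C) * T powr e"
  have c: "0 \<le> c" using C by (simp add: c_def)
  have aint: "(\<integral>\<^sup>+\<omega>. a k \<omega> \<partial>P) \<le> ennreal (c * q ^ k)" for k
  proof -
    have "(\<integral>\<^sup>+\<omega>. a k \<omega> \<partial>P) = (\<integral>\<^sup>+\<omega>. (\<Sum>i\<le>2^k. 1 + Zsum m (dgrid T k i) \<omega>) \<partial>P) * ennreal ((T / 2 ^ k) powr e)"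
      unfolding a_def by (rule nn_integral_multc[OF sm])
    also have "(\<integral>\<^sup>+\<omega>. (\<Sum>i\<le>2^k. 1 + Zsum m (dgrid T k i) \<omega>) \<partial>P) = (\<Sum>i\<le>2^k. \<integral>\<^sup>+\<omega>. 1 + Zsum m (dgrid T k i) \<omega> \<partial>P)"
      by (intro nn_integral_sum borel_measurable_add borel_measurable_const Km) auto
    also have "\<dots> \<le> (\<Sum>i\<le>(2::nat)^k. ennreal (1 + C))"
    proof (rule sum_mono)
      fix i assume i: "i \<in> {..(2::nat) ^ k}"
      then have g: "dgrid T k i \<in> {0..T}" by (intro dyadic_in dgrid_in_dyadics) auto
      have "(\<integral>\<^sup>+\<omega>. 1 + Zsum m (dgrid T k i) \<omega> \<partial>P) = (\<integral>\<^sup>+\<omega>. 1 \<partial>P) + (\<integral>\<^sup>+\<omega>. Zsum m (dgrid T k i) \<omega> \<partial>P)"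
        using i by (intro nn_integral_add borel_measurable_const Km) auto
      also have "\<dots> \<le> 1 + ennreal C"
        using K(2)[OF g] prob_space.emeasure_space_1[OF prob] by (intro add_mono) auto
      also have "\<dots> = ennreal (1 + C)" using C by (simp add: ennreal_plus)
      finally show "(\<integral>\<^sup>+\<omega>. 1 + Zsum m (dgrid T k i) \<omega> \<partial>P) \<le> ennreal (1 + C)" .
    qed
    also have "(\<Sum>i\<le>(2::nat)^k. ennreal (1 + C)) = ennreal ((2 ^ k + 1) * (1 + C))"
    proof -
      have "(\<Sum>i\<le>(2::nat)^k. ennreal (1 + C)) = ennreal (\<Sum>i\<le>(2::nat)^k. 1 + C)"
        using C by (intro sum_ennreal) simp
      then show ?thesis by (simp add: add.commute)
    qed
    also have "ennreal ((2 ^ k + 1) * (1 + C)) * ennreal ((T / 2 ^ k) powr e) = ennreal ((2 ^ k + 1) * (1 + C) * (T / 2 ^ k) powr e)"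
      using C by (simp add: ennreal_mult)
    also have "\<dots> \<le> ennreal (c * q ^ k)"
    proof (rule ennreal_leI)
      have "(T / 2 ^ k) powr e = (T * 2 powr (- real k)) powr e"
        by (simp add: powr_minus_divide powr_realpow)
      also have "\<dots> = T powr e * 2 powr (- real k * e)" using T_pos by (simp add: powr_mult powr_powr)
      finally have pe: "(T / 2 ^ k) powr e = T powr e * 2 powr (- real k * e)" .
      have "(2 ^ k + 1) * (1 + C) * (T / 2 ^ k) powr e \<le> (2 * 2 ^ k) * (1 + C) * (T / 2 ^ k) powr e"
        using C by (intro mult_right_mono) auto
      also have "\<dots> = c * (2 ^ k * 2 powr (- real k * e))"
        unfolding pe by (simp add: c_def)
      also have "2 ^ k * 2 powr (- real k * e) = 2 powr (real k + - real k * e)"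
        by (simp only: powr_add) (simp add: powr_realpow)
      also have "\<dots> = q powr real k" by (simp add: q_def powr_powr algebra_simps)
      also have "\<dots> = q ^ k" using q by (simp add: powr_realpow)
      finally show "(2 ^ k + 1) * (1 + C) * (T / 2 ^ k) powr e \<le> c * q ^ k" .
    qed
    finally show ?thesis by (simp add: mult_right_mono)
  qed
  have "(\<integral>\<^sup>+\<omega>. (\<Sum>k. a k \<omega>) \<partial>P) = (\<Sum>k. \<integral>\<^sup>+\<omega>. a k \<omega> \<partial>P)"
    by (rule nn_integral_suminf[OF am])
  also have "\<dots> \<le> (\<Sum>k. ennreal (c * q ^ k))" by (intro suminf_le aint summableI)
  also have "\<dots> = ennreal (c * (1 / (1 - q)))"
    using sums_mult[OF geometric_sums[of q], of c] q c by (intro suminf_ennreal_eq) auto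
  finally have "AE \<omega> in P. (\<Sum>k. a k \<omega>) < \<infinity>"
    by (intro AE_finite_of_nn_integral_le borel_measurable_suminf_order am)
  with fin show ?thesis
  proof eventually_elim
    case (elim \<omega>)
    define f where "f k = (\<Sum>i\<le>2^k. Hol m (dgrid T k i) \<omega>) * (T / 2 ^ k) powr e" for k
    have H0: "0 \<le> Hol m s \<omega>" for s by (simp add: Hol_def)
    have f0: "0 \<le> f k" for k by (simp add: f_def H0 sum_nonneg)
    have "a k \<omega> = ennreal (f k)" for k
    proof -
      have "1 + Zsum m (dgrid T k i) \<omega> = ennreal (Hol m (dgrid T k i) \<omega>)" if "i \<in> {..(2::nat) ^ k}" for i
      proof -
        have "Zsum m (dgrid T k i) \<omega> < \<infinity>" using elim(1) dgrid_in_dyadics that by blast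
        then have "ennreal (enn2real (Zsum m (dgrid T k i) \<omega>)) = Zsum m (dgrid T k i) \<omega>" by simp
        then show ?thesis unfolding Hol_def by (subst ennreal_plus) auto
      qed
      then have "(\<Sum>i\<le>2^k. 1 + Zsum m (dgrid T k i) \<omega>) = (\<Sum>i\<le>2^k. ennreal (Hol m (dgrid T k i) \<omega>))"
        by (intro sum.cong) auto
      also have "\<dots> = ennreal (\<Sum>i\<le>2^k. Hol m (dgrid T k i) \<omega>)"
        using H0 by (intro sum_ennreal)
      finally show ?thesis by (simp add: a_def f_def ennreal_mult sum_nonneg H0)
    qed
    then have "(\<Sum>k. ennreal (f k)) \<noteq> top" using elim(2) by auto
    then have "summable f" using f0 by (intro summable_suminf_not_top) auto
    then have "f \<longlonglongrightarrow> 0" by (rule summable_LIMSEQ_zero)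
    then show ?case using elim(1) by (simp add: f_def[abs_def])
  qed
qed

lemma AE_good:
  assumes "2 * CARD('n) < m" "1 < (1 + \<beta>) * ks_hol m CARD('n)"
  shows "AE \<omega> in P. good m \<omega>"
proof -
  have "AE \<omega> in P. \<forall>s\<in>dyadics T. \<forall>q\<in>gpoints. path_sol \<omega> s q {s..T} (\<lambda>t. Z s q t \<omega>)"
  proof (intro AE_ball_countable[THEN iffD2] countable_dyadics countable_gpoints ballI)
    fix s and q :: "real^'n" assume "s \<in> dyadics T"
    from strong_AE[OF strong_Z[OF dyadic_in[OF this]], of q]
    show "AE \<omega> in P. path_sol \<omega> s q {s..T} (\<lambda>t. Z s q t \<omega>)"
      by eventually_elim blast
  qed
  with M_cadlag AE_space AE_Hol_sum_tendsto_0[OF assms] show ?thesis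
    by eventually_elim (simp add: good_def)
qed

text \<open>\<open>lim\<close> is total, so measurability in the outcome holds without knowing
  convergence. On good outcomes the limit exists and is the Hoelder extension from the dyadic
  points.\<close>

definition dyadic_flow :: "real \<Rightarrow> real^'n \<Rightarrow> real \<Rightarrow> 'a \<Rightarrow> real^'n" where
  "dyadic_flow s y t \<omega> = (if t \<le> s then y else lim (\<lambda>j. Z s (gfloor j y) t \<omega>))"

lemma Z_before: "s \<in> {0..T} \<Longrightarrow> t \<in> {0..s} \<Longrightarrow> \<omega> \<in> space P \<Longrightarrow> Z s x t \<omega> = x"
  by (rule strong_before[OF strong_Z])

text \<open>The moment sum sees dyadic \<open>t\<close> only; right continuity of the solutions
  carries the inequality to the other times.\<close>

lemma good_hoelder_gpoints:
  assumes m: "2 * CARD('n) < m"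
  shows "\<exists>C\<ge>0. \<forall>\<omega> s t x y. good m \<omega> \<longrightarrow> s \<in> dyadics T \<longrightarrow> t \<in> {s..T} \<longrightarrow> x \<in> gpoints \<longrightarrow> y \<in> gpoints \<longrightarrow>
     norm (Z s x t \<omega> - Z s y t \<omega>) \<le> C * Hol m s \<omega> * ks_weight m x y"
proof -
  obtain C where C: "C \<ge> 0" "\<And>D (f :: real^'n \<Rightarrow> real \<Rightarrow> real^'n) x y t. ks_sum m D f < \<infinity> \<Longrightarrow> t \<in> D \<Longrightarrow>
    x \<in> gpoints \<Longrightarrow> y \<in> gpoints \<Longrightarrow> norm (f x t - f y t) \<le> C * (1 + enn2real (ks_sum m D f)) * ks_weight m x y"
    using ks_sum_bound[OF m, where 'v="real^'n"] by blast
  show ?thesis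
  proof (intro exI[of _ C] conjI allI impI C(1))
    fix \<omega> s t and x y :: "real^'n"
    assume g: "good m \<omega>" and s: "s \<in> dyadics T" and t: "t \<in> {s..T}" and x: "x \<in> gpoints" and y: "y \<in> gpoints"
    have s0: "s \<in> {0..T}" by (rule dyadic_in[OF s])
    then have t0: "t \<in> {0..T}" using t by auto
    interpret driven_ode T drift "\<lambda>t. M t \<omega>" "\<bar>Kb\<bar>" "onorm ((*v) A)" "\<bar>Cb\<bar>" \<beta>
      using g by (intro driven) (simp add: good_def)
    have dy: "norm (Z s x t \<omega> - Z s y t \<omega>) \<le> C * Hol m s \<omega> * ks_weight m x y" if "t \<in> dyadics T" for t
      using C(2)[of "dyadics T" "\<lambda>x t. Z s x t \<omega>", OF _ that x y] g s by (simp add: good_def Hol_def Zsum_def)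
    obtain tk where tk: "\<And>k. tk k \<in> dyadics T" and tk': "\<And>k. tk k \<in> {t..T}" and lim: "tk \<longlonglongrightarrow> t"
      by (rule dyadic_approximation[OF T_pos t0]) blast
    have "(\<lambda>k. Z s x (tk k) \<omega>) \<longlonglongrightarrow> Z s x t \<omega>" "(\<lambda>k. Z s y (tk k) \<omega>) \<longlonglongrightarrow> Z s y t \<omega>"
      using g s x y s0 unfolding good_def
      by (auto intro!: sol_right_sequentially[OF _ _ t tk' lim])
    then have "(\<lambda>k. norm (Z s x (tk k) \<omega> - Z s y (tk k) \<omega>)) \<longlonglongrightarrow> norm (Z s x t \<omega> - Z s y t \<omega>)"
      by (intro tendsto_intros)
    then show "norm (Z s x t \<omega> - Z s y t \<omega>) \<le> C * Hol m s \<omega> * ks_weight m x y"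
      by (rule LIMSEQ_le_const2) (use dy[OF tk] in blast)
  qed
qed

text \<open>The Hoelder bound makes the solutions converge along the roundings of \<open>y\<close>.
  The limit is a solution by compactness at the constant initial time \<open>s\<close>: some
  subsequence tends to a solution, which the convergence of the full sequence identifies. In
  \<open>w\<close> the radius is enlarged by \<open>CARD('n)\<close> because rounding may leave the
  ball.\<close>

lemma
  assumes m: "2 * CARD('n) < m"
  shows dyadic_flow_limit: "\<lbrakk>good m \<omega>; s \<in> dyadics T; t \<in> {s..T}\<rbrakk> \<Longrightarrow>
       (\<lambda>j. Z s (gfloor j y) t \<omega>) \<longlonglongrightarrow> dyadic_flow s y t \<omega>"
    and dyadic_flow_sol: "\<lbrakk>good m \<omega>; s \<in> dyadics T\<rbrakk> \<Longrightarrow>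
       path_sol \<omega> s y {s..T} (\<lambda>t. dyadic_flow s y t \<omega>)"
    and dyadic_flow_hoelder: "\<exists>C w. 0 \<le> C \<and> (\<forall>R. 0 \<le> w R) \<and> (\<forall>\<omega> s t R x y. good m \<omega> \<longrightarrow> s \<in> dyadics T \<longrightarrow>
       t \<in> {s..T} \<longrightarrow> norm x \<le> R \<longrightarrow> norm y \<le> R \<longrightarrow>
       norm (dyadic_flow s x t \<omega> - dyadic_flow s y t \<omega>) \<le> C * Hol m s \<omega> * w R * norm (x - y) powr ks_hol m CARD('n))"
proof -
  define \<gamma> where "\<gamma> = ks_hol m CARD('n)"
  have \<gamma>: "0 < \<gamma>" using m by (simp add: \<gamma>_def ks_hol_def)
  obtain C where C: "C \<ge> 0" "\<And>\<omega> s t x y. good m \<omega> \<Longrightarrow> s \<in> dyadics T \<Longrightarrow> t \<in> {s..T} \<Longrightarrow> x \<in> gpoints \<Longrightarrow> y \<in> gpoints \<Longrightarrow>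
     norm (Z s x t \<omega> - Z s y t \<omega>) \<le> C * Hol m s \<omega> * ks_weight m x y"
    using good_hoelder_gpoints[OF m] by blast
  define w where "w R = max ((R + CARD('n)) powr ((2 * real CARD('n) + 1) / real m)) 1" for R :: real
  have w: "0 \<le> w R" for R by (simp add: w_def le_max_iff_disj)
  have H: "0 \<le> Hol m s \<omega>" for s \<omega> by (simp add: Hol_def)
  have hoel: "norm (Z s x t \<omega> - Z s z t \<omega>) \<le> C * Hol m s \<omega> * w R * norm (x - z) powr \<gamma>"
    if "good m \<omega>" "s \<in> dyadics T" "t \<in> {s..T}" "x \<in> gpoints" "z \<in> gpoints"
      "norm x \<le> R + CARD('n)" "norm z \<le> R + CARD('n)" for \<omega> s t x z and R :: real
  proof -
    have "norm (Z s x t \<omega> - Z s z t \<omega>) \<le> C * Hol m s \<omega> * ks_weight m x z"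
      by (rule C(2)[OF that(1-5)])
    also have "\<dots> \<le> C * Hol m s \<omega> * (w R * norm (x - z) powr \<gamma>)"
      unfolding w_def \<gamma>_def by (intro mult_left_mono ks_weight_le that mult_nonneg_nonneg C(1) H)
    finally show ?thesis by (simp add: mult.assoc)
  qed
  have lim: "(\<lambda>j. Z s (gfloor j y) t \<omega>) \<longlonglongrightarrow> dyadic_flow s y t \<omega>"
    if g: "good m \<omega>" and s: "s \<in> dyadics T" and t: "t \<in> {s..T}" for \<omega> s t y
  proof (cases "t = s")
    case True
    then show ?thesis
      using Z_before[OF dyadic_in[OF s], of s \<omega>] g dyadic_in[OF s] gfloor_tendsto[of y]
      by (simp add: dyadic_flow_def good_def)
  next
    case False
    have "convergent (\<lambda>j. Z s (gfloor j y) t \<omega>)"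
      by (rule convergent_along_gfloor[where f="\<lambda>x. Z s x t \<omega>", OF hoel[OF g s t] \<gamma>]) auto
    then show ?thesis using False t by (simp add: dyadic_flow_def convergent_LIMSEQ_iff)
  qed
  have sol: "path_sol \<omega> s y {s..T} (\<lambda>t. dyadic_flow s y t \<omega>)"
    if g: "good m \<omega>" and s: "s \<in> dyadics T" for \<omega> s y
  proof -
    interpret driven_ode T drift "\<lambda>t. M t \<omega>" "\<bar>Kb\<bar>" "onorm ((*v) A)" "\<bar>Cb\<bar>" \<beta>
      using g by (intro driven) (simp add: good_def)
    have Zs: "sol s (gfloor k y) {s..T} (\<lambda>t. Z s (gfloor k y) t \<omega>)" for k
      using g s gfloor_in_gpoints unfolding good_def by blast
    obtain \<phi> y' where \<phi>: "strict_mono (\<phi> :: nat \<Rightarrow> nat)"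
      and ul: "uniform_limit {0..T} (\<lambda>j t. if t \<le> s then gfloor (\<phi> j) y else Z s (gfloor (\<phi> j) y) t \<omega> - M t \<omega> + M s \<omega>) y' sequentially"
      and y': "\<And>t. t \<in> {0..s} \<Longrightarrow> y' t = y"
      and sol': "sol s (y + M s \<omega> - M s \<omega>) {s..T} (\<lambda>t. y' t + M t \<omega> - M s \<omega>)"
      using sol_compactness[of "\<lambda>_. s", OF dyadic_in[OF s] tendsto_const gfloor_tendsto[of y] tendsto_const Zs] by blast
    have "dyadic_flow s y t \<omega> = y' t + M t \<omega> - M s \<omega>" if t: "t \<in> {s..T}" for t
    proof (cases "t = s")
      case True
      then show ?thesis using y'[of s] dyadic_in[OF s] by (simp add: dyadic_flow_def)
    next
      case False
      have t0: "t \<in> {0..T}" using t dyadic_in[OF s] by auto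
      have "(\<lambda>j. Z s (gfloor (\<phi> j) y) t \<omega> - M t \<omega> + M s \<omega>) \<longlonglongrightarrow> y' t"
        using tendsto_uniform_limitI[OF ul t0] False t by simp
      moreover have "(\<lambda>j. Z s (gfloor (\<phi> j) y) t \<omega> - M t \<omega> + M s \<omega>) \<longlonglongrightarrow> dyadic_flow s y t \<omega> - M t \<omega> + M s \<omega>"
        using LIMSEQ_subseq_LIMSEQ[OF lim[OF g s t, of y] \<phi>] by (intro tendsto_intros) (simp add: o_def)
      ultimately have "y' t = dyadic_flow s y t \<omega> - M t \<omega> + M s \<omega>" by (rule LIMSEQ_unique)
      then show ?thesis by simp
    qed
    then show ?thesis
      using driven_sol_cong[OF sol', of "\<lambda>t. dyadic_flow s y t \<omega>"] by simp
  qed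
  have hoel': "norm (dyadic_flow s x t \<omega> - dyadic_flow s y t \<omega>) \<le> C * Hol m s \<omega> * w R * norm (x - y) powr \<gamma>"
    if g: "good m \<omega>" and s: "s \<in> dyadics T" and t: "t \<in> {s..T}" and x: "norm x \<le> R" and y: "norm y \<le> R" for \<omega> s t R x y
  proof (rule LIMSEQ_le)
    show "(\<lambda>j. norm (Z s (gfloor j x) t \<omega> - Z s (gfloor j y) t \<omega>)) \<longlonglongrightarrow> norm (dyadic_flow s x t \<omega> - dyadic_flow s y t \<omega>)"
      by (intro tendsto_intros lim[OF g s t])
    have "(\<lambda>j. norm (gfloor j x - gfloor j y)) \<longlonglongrightarrow> norm (x - y)"
      by (intro tendsto_intros gfloor_tendsto)
    then have "(\<lambda>j. norm (gfloor j x - gfloor j y) powr \<gamma>) \<longlonglongrightarrow> norm (x - y) powr \<gamma>"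
      using \<gamma> by (intro tendsto_powr' tendsto_const) auto
    then show "(\<lambda>j. C * Hol m s \<omega> * w R * norm (gfloor j x - gfloor j y) powr \<gamma>) \<longlonglongrightarrow> C * Hol m s \<omega> * w R * norm (x - y) powr \<gamma>"
      by (rule tendsto_mult_left)
    show "\<exists>N. \<forall>j\<ge>N. norm (Z s (gfloor j x) t \<omega> - Z s (gfloor j y) t \<omega>) \<le> C * Hol m s \<omega> * w R * norm (gfloor j x - gfloor j y) powr \<gamma>"
    proof (intro exI[of _ 0] allI impI hoel[OF g s t] gfloor_in_gpoints)
      fix j :: nat
      show "norm (gfloor j x) \<le> R + CARD('n)" "norm (gfloor j y) \<le> R + CARD('n)"
        using norm_gfloor_le[of j x] norm_gfloor_le[of j y] x y by linarith+
    qed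
  qed
  show "\<lbrakk>good m \<omega>; s \<in> dyadics T; t \<in> {s..T}\<rbrakk> \<Longrightarrow>
       (\<lambda>j. Z s (gfloor j y) t \<omega>) \<longlonglongrightarrow> dyadic_flow s y t \<omega>"
    by (rule lim)
  show "\<lbrakk>good m \<omega>; s \<in> dyadics T\<rbrakk> \<Longrightarrow>
       path_sol \<omega> s y {s..T} (\<lambda>t. dyadic_flow s y t \<omega>)"
    by (rule sol)
  show "\<exists>C w. 0 \<le> C \<and> (\<forall>R. 0 \<le> w R) \<and> (\<forall>\<omega> s t R x y. good m \<omega> \<longrightarrow> s \<in> dyadics T \<longrightarrow>
       t \<in> {s..T} \<longrightarrow> norm x \<le> R \<longrightarrow> norm y \<le> R \<longrightarrow>
       norm (dyadic_flow s x t \<omega> - dyadic_flow s y t \<omega>) \<le> C * Hol m s \<omega> * w R * norm (x - y) powr ks_hol m CARD('n))"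
    unfolding \<gamma>_def[symmetric]
    by (intro exI[of _ C] exI[of _ w] conjI allI impI C(1) w hoel')
qed

lemma dyadic_flow_FL:
  assumes "s \<in> dyadics T" "t \<in> {s..T}"
  shows "dyadic_flow s y t \<in> borel_measurable (FL P L s t)"
proof (cases "t = s")
  case False
  have "(\<lambda>\<omega>. lim (\<lambda>j. Z s (gfloor j y) t \<omega>)) \<in> borel_measurable (FL P L s t)"
    using strong_FL[OF strong_Z[OF dyadic_in[OF assms(1)]] assms(2)]
    by (intro borel_measurable_lim_metric) simp
  then show ?thesis using False assms(2) by (simp add: dyadic_flow_def[abs_def])
qed (simp add: dyadic_flow_def[abs_def])

lemma strong_dyadic_flow:
  assumes m: "2 * CARD('n) < m" and good: "AE \<omega> in P. good m \<omega>" and s: "s \<in> dyadics T"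
  shows "strong s y (dyadic_flow s y)"
proof -
  note fl = dyadic_flow_sol[OF m]
  show ?thesis
    unfolding strong_iff
  proof (intro conjI ballI)
    show "AE \<omega> in P. cadlag_on {s..T} (\<lambda>t. dyadic_flow s y t \<omega>) \<and> cadlag_on {0..T} (\<lambda>t. L t \<omega>) \<and>
                  L 0 \<omega> = 0 \<and> path_sol \<omega> s y {s..T} (\<lambda>t. dyadic_flow s y t \<omega>)"
      using good strong_AE[OF strong_Z[OF dyadic_in[OF s]], of y]
    proof eventually_elim
      case (elim \<omega>)
      interpret driven_ode T drift "\<lambda>t. M t \<omega>" "\<bar>Kb\<bar>" "onorm ((*v) A)" "\<bar>Cb\<bar>" \<beta>
        using elim(1) by (intro driven) (simp add: good_def)
      show ?case
        using elim sol_cadlag[OF fl[OF elim(1) s]] fl[OF elim(1) s] dyadic_in[OF s] by auto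
    qed
  qed (use dyadic_flow_FL[OF s] in \<open>auto simp: dyadic_flow_def\<close>)
qed

section \<open>The cocycle identity at dyadic times\<close>

text \<open>The path restarted at the random point \<open>dyadic_flow s y r \<omega>\<close> is
  viewed as part of a process with the deterministic start \<open>y\<close>, to which (H1) applies.
  It is adapted as a limit of solutions restarted at roundings of that point.\<close>

lemma strong_dyadic_concat:
  assumes m: "2 * CARD('n) < m" and good: "AE \<omega> in P. good m \<omega>"
    and s: "s \<in> dyadics T" and r: "r \<in> dyadics T" and "s \<le> r"
  shows "strong s y (\<lambda>t \<omega>. if t \<le> r then dyadic_flow s y t \<omega> else dyadic_flow r (dyadic_flow s y r \<omega>) t \<omega>)"
    (is "strong s y ?W")
proof -
  note fl = dyadic_flow_sol[OF m]
  have rT: "r \<le> T" "0 \<le> s" using dyadic_in[OF r] dyadic_in[OF s] by auto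
  show ?thesis
    unfolding strong_iff
  proof (intro conjI ballI)
    fix t \<omega> assume "t \<in> {0..s}"
    then show "?W t \<omega> = y" using \<open>s \<le> r\<close> by (simp add: dyadic_flow_def)
  next
    fix t assume t: "t \<in> {s..T}"
    show "?W t \<in> borel_measurable (FL P L s t)"
    proof (cases "t \<le> r")
      case True
      then show ?thesis using dyadic_flow_FL[OF s t] by simp
    next
      case False
      then have rt: "r \<in> {s..T}" "t \<in> {r..T}" "r \<le> t" using t \<open>s \<le> r\<close> rT by auto
      have y: "dyadic_flow s y r \<in> borel_measurable (FL P L s t)"
        by (rule measurable_FL_mono[OF dyadic_flow_FL[OF s rt(1)] order_refl rt(3)])
      have "Z r q t \<in> borel_measurable (FL P L s t)" for q
        by (rule measurable_FL_mono[OF strong_FL[OF strong_Z[OF dyadic_in[OF r]] rt(2)] \<open>s \<le> r\<close> order_refl])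
      then have "(\<lambda>\<omega>. Z r (gfloor j (dyadic_flow s y r \<omega>)) t \<omega>) \<in> borel_measurable (FL P L s t)" for j
        using y by (rule measurable_compose_gfloor)
      then have "(\<lambda>\<omega>. lim (\<lambda>j. Z r (gfloor j (dyadic_flow s y r \<omega>)) t \<omega>)) \<in> borel_measurable (FL P L s t)"
        by (rule borel_measurable_lim_metric)
      moreover have "?W t = (\<lambda>\<omega>. lim (\<lambda>j. Z r (gfloor j (dyadic_flow s y r \<omega>)) t \<omega>))"
        using False by (simp add: dyadic_flow_def)
      ultimately show ?thesis by simp
    qed
  next
    show "AE \<omega> in P. cadlag_on {s..T} (\<lambda>t. ?W t \<omega>) \<and> cadlag_on {0..T} (\<lambda>t. L t \<omega>) \<and>
                  L 0 \<omega> = 0 \<and> path_sol \<omega> s y {s..T} (\<lambda>t. ?W t \<omega>)"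
      using good strong_AE[OF strong_Z[OF dyadic_in[OF s]], of y]
    proof eventually_elim
      case (elim \<omega>)
      interpret driven_ode T drift "\<lambda>t. M t \<omega>" "\<bar>Kb\<bar>" "onorm ((*v) A)" "\<bar>Cb\<bar>" \<beta>
        using elim(1) by (intro driven) (simp add: good_def)
      have "sol s y {s..T} (\<lambda>t. ?W t \<omega>)"
        by (rule driven_sol_concat[OF driven_sol_subset[OF fl[OF elim(1) s]] fl[OF elim(1) r] \<open>s \<le> r\<close> rT(1)])
          (use rT in auto)
      then show ?case
        using elim sol_cadlag rT by auto
    qed
  qed
qed

lemma AE_dyadic_cocycle:
  assumes m: "2 * CARD('n) < m" and good: "AE \<omega> in P. good m \<omega>"
  shows "AE \<omega> in P. \<forall>s\<in>dyadics T. \<forall>r\<in>dyadics T. \<forall>q\<in>gpoints. s \<le> r \<longrightarrow>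
    (\<forall>t\<in>{r..T}. dyadic_flow s q t \<omega> = dyadic_flow r (dyadic_flow s q r \<omega>) t \<omega>)"
proof (intro AE_ball_countable[THEN iffD2] countable_dyadics countable_gpoints ballI)
  fix s r and q :: "real^'n" assume s: "s \<in> dyadics T" and r: "r \<in> dyadics T"
  show "AE \<omega> in P. s \<le> r \<longrightarrow> (\<forall>t\<in>{r..T}. dyadic_flow s q t \<omega> = dyadic_flow r (dyadic_flow s q r \<omega>) t \<omega>)"
  proof (cases "s \<le> r")
    case True
    from strong_unique[OF dyadic_in[OF s] strong_dyadic_flow[OF m good s] strong_dyadic_concat[OF m good s r True], of q]
    show ?thesis
    proof eventually_elim
      case (elim \<omega>)
      show ?case
      proof (intro impI ballI)
        fix t assume t: "t \<in> {r..T}"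
        show "dyadic_flow s q t \<omega> = dyadic_flow r (dyadic_flow s q r \<omega>) t \<omega>"
        \<comment> \<open>At \<open>t = r\<close> the pasted process is still in its first branch;
          the identity there is the convention that the flow from \<open>r\<close> begins at its
          starting point.\<close>
        proof (cases "t = r")
          case True then show ?thesis by (simp add: dyadic_flow_def[of r])
        next
          case False
          then show ?thesis using bspec[OF elim, of t] t \<open>s \<le> r\<close> by auto
        qed
      qed
    qed
  qed simp
qed

text \<open>(1+\<beta>)(m-2n)/m > 1 amounts to \<beta> m > 2n(1+\<beta>), so any large
  \<open>m\<close> works, and this inequality already forces m > 2n.\<close>

lemma exists_hoelder_index: "\<exists>m. 2 * CARD('n) < m \<and> 1 < (1 + \<beta>) * ks_hol m CARD('n)"
proof -
  define N where "N = real CARD('n)"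
  have N: "1 \<le> N" unfolding N_def by (rule card_ge_1)
  obtain m :: nat where m: "(1 + \<beta>) * (2 * N) / \<beta> < m" using reals_Archimedean2 by blast
  then have 1: "(1 + \<beta>) * (2 * N) < \<beta> * m" using \<beta>_pos by (simp add: field_simps)
  have "(1 + \<beta>) * (2 * N) = 2 * N + \<beta> * (2 * N)" by (simp add: algebra_simps)
  then have "\<beta> * (2 * N) < \<beta> * m" using 1 N by linarith
  then have 2: "2 * N < m" using \<beta>_pos by simp
  then have m0: "0 < real m" using N by linarith
  have "1 * m < (1 + \<beta>) * (m - 2 * N)" using 1 by (simp add: algebra_simps)
  then have "1 < (1 + \<beta>) * ks_hol m N" using m0 by (simp add: ks_hol_def field_simps)
  moreover have "2 * CARD('n) < m" using 2 unfolding N_def by linarith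
  ultimately show ?thesis unfolding N_def by blast
qed

text \<open>On good outcomes the dyadic flow meets the hypotheses of the uniqueness theorem. The
  cocycle identity, so far known for starts in \<open>gpoints\<close>, extends by continuity in the
  starting point, applied twice where two flows are composed.\<close>

theorem AE_driven_flow:
  "AE \<omega> in P. path_flow \<omega>"
proof -
  obtain m where m: "2 * CARD('n) < m" and e: "1 < (1 + \<beta>) * ks_hol m CARD('n)"
    using exists_hoelder_index by blast
  note good = AE_good[OF m e]
  define \<gamma> where "\<gamma> = ks_hol m CARD('n)"
  have \<gamma>: "0 < \<gamma>" using m by (simp add: \<gamma>_def ks_hol_def)
  note fl = dyadic_flow_sol[OF m]
  obtain C w where C: "C \<ge> 0" "\<forall>R. 0 \<le> w R"
    and hoel: "\<forall>\<omega> s t R x y. good m \<omega> \<longrightarrow> s \<in> dyadics T \<longrightarrow>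
       t \<in> {s..T} \<longrightarrow> norm x \<le> R \<longrightarrow> norm y \<le> R \<longrightarrow>
       norm (dyadic_flow s x t \<omega> - dyadic_flow s y t \<omega>) \<le> C * Hol m s \<omega> * w R * norm (x - y) powr \<gamma>"
    unfolding \<gamma>_def using dyadic_flow_hoelder[OF m] by (elim exE conjE)
  show ?thesis
    using good AE_dyadic_cocycle[OF m good]
  proof eventually_elim
    case (elim \<omega>)
    note g = elim(1)
    interpret driven_ode T drift "\<lambda>t. M t \<omega>" "\<bar>Kb\<bar>" "onorm ((*v) A)" "\<bar>Cb\<bar>" \<beta>
      using g by (intro driven) (simp add: good_def)
    have cont: "(\<lambda>j. dyadic_flow s (xk j) t \<omega>) \<longlonglongrightarrow> dyadic_flow s x t \<omega>"
      if s: "s \<in> dyadics T" "t \<in> {s..T}" and x: "xk \<longlonglongrightarrow> x" for s t xk x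
    proof -
      obtain R where R: "\<And>j. norm (xk j) \<le> R" using convergent_imp_bounded[OF x] by (auto simp: bounded_iff)
      have "(\<lambda>j. dyadic_flow s (xk j) t \<omega> - dyadic_flow s x t \<omega>) \<longlonglongrightarrow> 0"
      proof (rule Lim_null_comparison)
        show "\<forall>\<^sub>F j in sequentially. norm (dyadic_flow s (xk j) t \<omega> - dyadic_flow s x t \<omega>)
            \<le> C * Hol m s \<omega> * w (max R (norm x)) * norm (xk j - x) powr \<gamma>"
          using R by (intro always_eventually allI hoel[rule_format, OF g s]) (auto intro: order_trans[OF _ max.cobounded1])
        have "(\<lambda>j. norm (xk j - x)) \<longlonglongrightarrow> 0" using x by (simp add: tendsto_norm_zero LIM_zero)
        then have "(\<lambda>j. norm (xk j - x) powr \<gamma>) \<longlonglongrightarrow> 0"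
          by (rule tendsto_zero_powrI[OF _ tendsto_const]) (use \<gamma> in auto)
        then show "(\<lambda>j. C * Hol m s \<omega> * w (max R (norm x)) * norm (xk j - x) powr \<gamma>) \<longlonglongrightarrow> 0"
          by (rule tendsto_mult_right_zero)
      qed
      then show ?thesis by (rule LIM_zero_cancel)
    qed
    have cocycle: "dyadic_flow s y t \<omega> = dyadic_flow r (dyadic_flow s y r \<omega>) t \<omega>"
      if "s \<in> dyadics T" "r \<in> dyadics T" "s \<le> r" "r \<le> t" "t \<le> T" for s r t y
    proof (rule LIMSEQ_unique)
      have rt: "r \<in> {s..T}" "t \<in> {s..T}" "t \<in> {r..T}" using that by auto
      show "(\<lambda>j. dyadic_flow s (gfloor j y) t \<omega>) \<longlonglongrightarrow> dyadic_flow s y t \<omega>"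
        by (rule cont[OF that(1) rt(2) gfloor_tendsto])
      have "(\<lambda>j. dyadic_flow r (dyadic_flow s (gfloor j y) r \<omega>) t \<omega>) \<longlonglongrightarrow> dyadic_flow r (dyadic_flow s y r \<omega>) t \<omega>"
        by (rule cont[OF that(2) rt(3) cont[OF that(1) rt(1) gfloor_tendsto]])
      moreover have "dyadic_flow s (gfloor j y) t \<omega> = dyadic_flow r (dyadic_flow s (gfloor j y) r \<omega>) t \<omega>" for j
        using elim(2) that(1-3) rt(3) gfloor_in_gpoints by blast
      ultimately show "(\<lambda>j. dyadic_flow s (gfloor j y) t \<omega>) \<longlonglongrightarrow> dyadic_flow r (dyadic_flow s y r \<omega>) t \<omega>"
        by simp
    qed
    have lim: "(\<lambda>k. (\<Sum>i\<le>2^k. C * Hol m (dgrid T k i) \<omega>) * (T / 2 ^ k) powr ((1 + \<beta>) * \<gamma>)) \<longlonglongrightarrow> 0"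
    proof -
      have "(\<lambda>k. (\<Sum>i\<le>2^k. Hol m (dgrid T k i) \<omega>) * (T / 2 ^ k) powr ((1 + \<beta>) * \<gamma>)) \<longlonglongrightarrow> 0"
        using g by (simp add: good_def \<gamma>_def)
      then have "(\<lambda>k. C * ((\<Sum>i\<le>2^k. Hol m (dgrid T k i) \<omega>) * (T / 2 ^ k) powr ((1 + \<beta>) * \<gamma>))) \<longlonglongrightarrow> 0"
        by (rule tendsto_mult_right_zero)
      then show ?thesis by (simp only: sum_distrib_left[symmetric] mult.assoc)
    qed
    have H: "0 \<le> C * Hol m s \<omega>" for s using C(1) by (simp add: Hol_def)
    show ?case
    proof
      fix s t x g h assume st: "0 \<le> s" "s \<le> t" "t \<le> T" "sol s x {s..t} g" "sol s x {s..t} h"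
      show "g t = h t"
        by (rule davie_uniqueness[where \<psi>="\<lambda>s y t. dyadic_flow s y t \<omega>" and H="\<lambda>s. C * Hol m s \<omega>" and w=w and \<alpha>=\<gamma>,
              OF fl[OF g] cocycle hoel[rule_format, OF g] H C(2)[rule_format] \<gamma> lim st])
    next
      fix s x assume s: "s \<in> {0..T}"
      have ex: "\<exists>g. sol r y {r..T} g" if "r \<in> dyadics T" for r y
        by (rule exI, rule fl[OF g that])
      show "\<exists>g. sol s x {s..T} g"
        by (rule exists_sol_of_dyadic[OF ex s])
    qed
  qed
qed

end

section \<open>The stochastic flow\<close>

lemma measurable_dceil [measurable]: "dceil T k \<in> measurable borel (count_space UNIV)"
  unfolding dceil_def[abs_def] by measurable

lemma ks_weight_tendsto:
  fixes x y :: "real^'n"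
  assumes "2 * CARD('n) < m"
  shows "(\<lambda>k. ks_weight m (gfloor k x) (gfloor k y)) \<longlonglongrightarrow> ks_weight m x y"
proof -
  have e: "0 < (real m - 2 * real CARD('n)) / real m" "0 < (2 * real CARD('n) + 1) / real m"
    using assms by auto
  have "(\<lambda>k. norm (gfloor k x - gfloor k y)) \<longlonglongrightarrow> norm (x - y)"
    by (intro tendsto_intros gfloor_tendsto)
  then have 1: "(\<lambda>k. norm (gfloor k x - gfloor k y) powr ((real m - 2 * real CARD('n)) / real m))
      \<longlonglongrightarrow> norm (x - y) powr ((real m - 2 * real CARD('n)) / real m)"
    by (rule tendsto_powr'[OF _ tendsto_const]) (use e in auto)
  have "(\<lambda>k. max (norm (gfloor k x)) (norm (gfloor k y))) \<longlonglongrightarrow> max (norm x) (norm y)"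
    by (intro tendsto_max tendsto_norm gfloor_tendsto)
  then have 2: "(\<lambda>k. max (norm (gfloor k x)) (norm (gfloor k y)) powr ((2 * real CARD('n) + 1) / real m))
      \<longlonglongrightarrow> max (norm x) (norm y) powr ((2 * real CARD('n) + 1) / real m)"
    by (rule tendsto_powr'[OF _ tendsto_const]) (use e in \<open>auto simp: le_max_iff_disj\<close>)
  show ?thesis
    unfolding ks_weight_def by (intro tendsto_mult tendsto_max tendsto_const 1 2)
qed

lemma ks_weight_pos:
  fixes x y :: "real^'n"
  assumes "x \<noteq> y"
  shows "0 < ks_weight m x y"
  unfolding ks_weight_def using assms by (intro mult_pos_pos) auto

context hoelder_sde
begin

definition regular :: "'a \<Rightarrow> bool" where
  "regular \<omega> \<longleftrightarrow> \<omega> \<in> space P \<and> path_flow \<omega>"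

text \<open>Irregular outcomes get the value \<open>x\<close>. The process then rests at its start
  up to time \<open>s\<close> for every outcome, as a strong solution must, and the approximation by
  rounded arguments converges for every outcome.\<close>

definition flow_map :: "real \<Rightarrow> real \<Rightarrow> real^'n \<Rightarrow> 'a \<Rightarrow> real^'n" where
  "flow_map s t x \<omega> = (if regular \<omega> then ode_flow T drift (\<lambda>t. M t \<omega>) s x t else x)"

lemma AE_regular: "AE \<omega> in P. regular \<omega>"
  using AE_driven_flow AE_space by eventually_elim (simp add: regular_def)

text \<open>Uniqueness identifies the flow with the selected solution \<open>Z s x\<close> almost
  surely. Adaptedness is inherited from \<open>Z s x\<close> through the completion, since the
  pathwise definition by choice does not provide it.\<close>

lemma strong_flow_map:
  assumes s: "s \<in> {0..T}"
  shows "strong s x (\<lambda>t. flow_map s t x)"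
proof -
  have eq: "AE \<omega> in P. \<forall>t\<in>{s..T}. Z s x t \<omega> = flow_map s t x \<omega>"
    using AE_regular strong_AE[OF strong_Z[OF s], of x]
  proof eventually_elim
    case (elim \<omega>)
    interpret driven_flow T drift "\<lambda>t. M t \<omega>" "\<bar>Kb\<bar>" "onorm ((*v) A)" "\<bar>Cb\<bar>" \<beta>
      using elim(1) by (simp add: regular_def)
    show ?case
    proof
      fix t assume t: "t \<in> {s..T}"
      have "sol s x {s..t} (\<lambda>t. Z s x t \<omega>)"
        by (rule driven_sol_subset[of _ _ _ _ "{s..T}"]) (use elim(2) t in auto)
      then have "Z s x t \<omega> = \<Phi> s x t" using s t by (intro flow_unique) auto
      then show "Z s x t \<omega> = flow_map s t x \<omega>" using elim(1) by (simp add: flow_map_def)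
    qed
  qed
  obtain N where N: "\<And>\<omega>. \<omega> \<in> space P - N \<Longrightarrow> \<forall>t\<in>{s..T}. Z s x t \<omega> = flow_map s t x \<omega>" "N \<in> null_sets P"
    by (rule AE_E3[OF eq]) blast
  show ?thesis
    unfolding strong_iff
  proof (intro conjI ballI)
    show "flow_map s t x \<omega> = x" if "t \<in> {0..s}" for t \<omega>
      using that by (simp add: flow_map_def ode_flow_def)
    show "flow_map s t x \<in> borel_measurable (FL P L s t)" if t: "t \<in> {s..T}" for t
      by (rule measurable_FL_modify[OF strong_FL[OF strong_Z[OF s] t] N(2)]) (use N(1) t in blast)
    show "AE \<omega> in P. cadlag_on {s..T} (\<lambda>t. flow_map s t x \<omega>) \<and> cadlag_on {0..T} (\<lambda>t. L t \<omega>) \<and>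
                  L 0 \<omega> = 0 \<and> path_sol \<omega> s x {s..T} (\<lambda>t. flow_map s t x \<omega>)"
      using AE_regular strong_AE[OF strong_Z[OF s], of x]
    proof eventually_elim
      case (elim \<omega>)
      interpret driven_flow T drift "\<lambda>t. M t \<omega>" "\<bar>Kb\<bar>" "onorm ((*v) A)" "\<bar>Cb\<bar>" \<beta>
        using elim(1) by (simp add: regular_def)
      have "(\<lambda>t. flow_map s t x \<omega>) = \<Phi> s x" using elim(1) by (simp add: flow_map_def)
      then show ?case
        using elim(2) flow_sol[OF s, of x] sol_cadlag[OF flow_sol[OF s]] s by simp
    qed
  qed
qed

lemma flow_map_borel: "s \<in> {0..T} \<Longrightarrow> t \<in> {0..T} \<Longrightarrow> flow_map s t x \<in> borel_measurable P"
  using strong_measurable[OF strong_flow_map] .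

text \<open>Rounding both times up and the point down leaves countably many random variables, each
  measurable as the value of a strong solution at a fixed time. The rounded maps converge for every
  outcome, so their limit is jointly measurable.\<close>

lemma flow_map_measurable:
  "(\<lambda>((s, t, x), \<omega>). flow_map s t x \<omega>)
     \<in> borel_measurable (restrict_space borel ({0..T} \<times> {0..T} \<times> UNIV) \<Otimes>\<^sub>M P)"
proof -
  let ?X = "restrict_space borel ({0..T} \<times> {0..T} \<times> (UNIV :: (real^'n) set)) \<Otimes>\<^sub>M P"
  define S where "S p = fst (fst p)" for p :: "(real \<times> real \<times> (real^'n)) \<times> 'a"
  define U where "U p = fst (snd (fst p))" for p :: "(real \<times> real \<times> (real^'n)) \<times> 'a"
  define Y where "Y p = snd (snd (fst p))" for p :: "(real \<times> real \<times> (real^'n)) \<times> 'a"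
  have f: "(\<lambda>p. g (fst p)) \<in> borel_measurable ?X" if "continuous_on UNIV g"
    for g :: "real \<times> real \<times> (real^'n) \<Rightarrow> 'z::topological_space"
    by (rule measurable_compose[OF measurable_fst measurable_restrict_space1[OF borel_measurable_continuous_onI[OF that]]])
  have S[measurable]: "S \<in> borel_measurable ?X" unfolding S_def[abs_def] by (rule f) (intro continuous_intros)
  have U[measurable]: "U \<in> borel_measurable ?X" unfolding U_def[abs_def] by (rule f) (intro continuous_intros)
  have Y[measurable]: "Y \<in> borel_measurable ?X" unfolding Y_def[abs_def] by (rule f) (intro continuous_intros)
  have sp: "S p \<in> {0..T}" "U p \<in> {0..T}" "snd p \<in> space P" if "p \<in> space ?X" for p
    using that by (auto simp: space_pair_measure S_def U_def space_restrict_space)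
  define G where "G k p = flow_map (dgrid T k (dceil T k (S p))) (dgrid T k (dceil T k (U p))) (gfloor k (Y p)) (snd p)" for k p
  have G: "G k \<in> borel_measurable ?X" for k
  proof -
    define I where "I = {..(2::nat) ^ k} \<times> {..(2::nat) ^ k} \<times> (gpoints :: (real^'n) set)"
    define idx where "idx p = (dceil T k (S p), dceil T k (U p), gfloor k (Y p))" for p
    have I: "countable I" unfolding I_def by (intro countable_SIGMA countable_finite countable_gpoints) auto
    have idx: "idx \<in> measurable ?X (count_space I)"
      unfolding measurable_count_space_eq_countable[OF I]
    proof (intro conjI ballI funcsetI)
      fix p assume "p \<in> space ?X"
      then show "idx p \<in> I"
        using sp dceil_bounds(1)[OF T_pos] gfloor_in_gpoints by (auto simp: idx_def I_def)
    next
      fix z assume "z \<in> I"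
      obtain i j q where z: "z = (i, j, q)" by (cases z)
      have "(\<lambda>p. gfloor k (Y p)) \<in> borel_measurable ?X" by measurable
      from measurable_sets[OF this, of "{q}"]
      have 1: "(\<lambda>p. gfloor k (Y p)) -` {q} \<inter> space ?X \<in> sets ?X" by simp
      have "(\<lambda>p. dceil T k (S p)) \<in> measurable ?X (count_space UNIV)" "(\<lambda>p. dceil T k (U p)) \<in> measurable ?X (count_space UNIV)"
        by measurable
      from measurable_sets[OF this(1), of "{i}"] measurable_sets[OF this(2), of "{j}"]
      have 2: "(\<lambda>p. dceil T k (S p)) -` {i} \<inter> space ?X \<in> sets ?X" "(\<lambda>p. dceil T k (U p)) -` {j} \<inter> space ?X \<in> sets ?X"
        by auto
      have "idx -` {z} \<inter> space ?X = ((\<lambda>p. dceil T k (S p)) -` {i} \<inter> space ?X) \<inter>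
          (((\<lambda>p. dceil T k (U p)) -` {j} \<inter> space ?X) \<inter> ((\<lambda>p. gfloor k (Y p)) -` {q} \<inter> space ?X))"
        by (auto simp: idx_def z)
      then show "idx -` {z} \<inter> space ?X \<in> sets ?X"
        using sets.Int[OF 2(1) sets.Int[OF 2(2) 1]] by simp
    qed
    define h where "h z p = flow_map (dgrid T k (fst z)) (dgrid T k (fst (snd z))) (snd (snd z)) (snd p)"
      for z :: "nat \<times> nat \<times> (real^'n)" and p :: "(real \<times> real \<times> (real^'n)) \<times> 'a"
    have "(\<lambda>p. h z p) \<in> borel_measurable ?X" if z: "z \<in> I" for z
    proof -
      have "dgrid T k (fst z) \<in> {0..T}" "dgrid T k (fst (snd z)) \<in> {0..T}"
        using z by (auto simp: I_def simp del: atLeastAtMost_iff intro!: dyadic_in dgrid_in_dyadics)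
      from measurable_compose[OF measurable_snd flow_map_borel[OF this]]
      show ?thesis unfolding h_def .
    qed
    from measurable_compose_countable'[where f=h, OF this idx I]
    show ?thesis unfolding h_def idx_def G_def[abs_def] fst_conv snd_conv .
  qed
  have "(\<lambda>p. flow_map (S p) (U p) (Y p) (snd p)) \<in> borel_measurable ?X"
  proof (rule borel_measurable_LIMSEQ_metric[OF G])
    fix p assume p: "p \<in> space ?X"
    show "(\<lambda>k. G k p) \<longlonglongrightarrow> flow_map (S p) (U p) (Y p) (snd p)"
    proof (cases "regular (snd p)")
      case True
      interpret driven_flow T drift "\<lambda>t. M t (snd p)" "\<bar>Kb\<bar>" "onorm ((*v) A)" "\<bar>Cb\<bar>" \<beta>
        using True by (simp add: regular_def)
      show ?thesis
        using flow_dyadic_limit[OF sp(1,2)[OF p] gfloor_tendsto] True by (simp add: G_def flow_map_def)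
    next
      case False
      then show ?thesis using gfloor_tendsto by (simp add: G_def flow_map_def)
    qed
  qed
  then show ?thesis by (simp add: S_def U_def Y_def case_prod_unfold)
qed

lemma flow_map_measurable_start:
  assumes t: "t \<in> {0..T}"
  shows "(\<lambda>(s, \<omega>). flow_map s t x \<omega>) \<in> borel_measurable (restrict_space borel {0..T} \<Otimes>\<^sub>M P)"
proof -
  have "(\<lambda>p. (fst p, t, x)) \<in> measurable (restrict_space borel {0..T} \<Otimes>\<^sub>M P) (restrict_space borel ({0..T} \<times> {0..T} \<times> UNIV))"
  proof (rule measurable_restrict_space2)
    have "(\<lambda>s::real. (s, t, x)) \<in> borel_measurable borel"
      by (intro borel_measurable_continuous_onI continuous_intros)
    from measurable_compose[OF measurable_fst measurable_restrict_space1[OF this]]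
    show "(\<lambda>p. (fst p, t, x)) \<in> borel_measurable (restrict_space borel {0..T} \<Otimes>\<^sub>M P)" .
  qed (use t in \<open>auto simp: space_pair_measure space_restrict_space\<close>)
  then have "(\<lambda>p. ((fst p, t, x), snd p)) \<in> measurable (restrict_space borel {0..T} \<Otimes>\<^sub>M P)
      (restrict_space borel ({0..T} \<times> {0..T} \<times> UNIV) \<Otimes>\<^sub>M P)"
    by (rule measurable_Pair[OF _ measurable_snd])
  from measurable_compose[OF this flow_map_measurable] show ?thesis by (simp add: case_prod_beta)
qed

section \<open>The integrable Hoelder constant of (iii)\<close>

text \<open>The sum \<open>Zsum\<close> formed with the flow in place of \<open>Z\<close>: joint
  measurability of the flow in initial time and outcome is what makes integration over
  \<open>s\<close> meaningful.\<close>

definition flow_ks :: "nat \<Rightarrow> real \<Rightarrow> 'a \<Rightarrow> ennreal" where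
  "flow_ks m s \<omega> = ks_sum m (dyadics T) (\<lambda>x t. flow_map s t x \<omega>)"

lemma flow_ks_measurable:
  "(\<lambda>(s, \<omega>). flow_ks m s \<omega>) \<in> borel_measurable (restrict_space borel {0..T} \<Otimes>\<^sub>M P)"
proof -
  have "(\<lambda>p. ks_sum m (dyadics T) (\<lambda>x t. flow_map (fst p) t x (snd p))) \<in> borel_measurable (restrict_space borel {0..T} \<Otimes>\<^sub>M P)"
    using flow_map_measurable_start[OF dyadic_in]
    by (intro borel_measurable_ks_sum countable_dyadics) (simp add: case_prod_beta)
  then show ?thesis by (simp add: flow_ks_def case_prod_beta)
qed

text \<open>By Tonelli the mean of the time integral is the time integral of the means, each of
  which is at most \<open>1 + C\<close>.\<close>

lemma AE_flow_ks_integrable: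
  assumes m: "2 * CARD('n) < m"
  shows "AE \<omega> in P. (\<integral>\<^sup>+s. (1 + flow_ks m s \<omega>) * indicator {0..T} s \<partial>lborel) < \<infinity>"
proof -
  interpret prob_space P by (rule prob)
  interpret pair_sigma_finite P lborel ..
  obtain C where C0: "C \<ge> 0" and C: "\<forall>s\<in>{0..T}. \<forall>f. (\<forall>x. strong s x (f x)) \<longrightarrow>
     (\<lambda>\<omega>. ks_sum m (dyadics T) (\<lambda>x t. f x t \<omega>)) \<in> borel_measurable P \<and>
     (\<integral>\<^sup>+\<omega>. ks_sum m (dyadics T) (\<lambda>x t. f x t \<omega>) \<partial>P) \<le> ennreal C"
    using strong_ks_sum[OF m] by (elim exE conjE)
  have K: "(\<lambda>\<omega>. flow_ks m s \<omega>) \<in> borel_measurable P" "(\<integral>\<^sup>+\<omega>. flow_ks m s \<omega> \<partial>P) \<le> ennreal C" if s: "s \<in> {0..T}" for s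
    unfolding flow_ks_def[abs_def] using C[rule_format, OF s, of "\<lambda>x t. flow_map s t x"] strong_flow_map[OF s] by blast+
  \<comment> \<open>Joint measurability is available for initial times in \<open>{0..T}\<close>;
    clamping extends the integrand to the whole line, and the indicator hides the change.\<close>
  define c where "c s = max 0 (min T s)" for s
  define u where "u \<omega> s = (1 + flow_ks m (c s) \<omega>) * indicator {0..T} s" for \<omega> s
  have cT: "c s \<in> {0..T}" for s using T_pos by (auto simp: c_def)
  have [measurable]: "c \<in> borel_measurable borel" unfolding c_def[abs_def] by measurable
  have "(\<lambda>p. (c (snd p), fst p)) \<in> measurable (P \<Otimes>\<^sub>M lborel) (restrict_space borel {0..T} \<Otimes>\<^sub>M P)"
  proof (rule measurable_Pair)
    show "(\<lambda>p. c (snd p)) \<in> measurable (P \<Otimes>\<^sub>M lborel) (restrict_space borel {0..T})"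
      by (rule measurable_restrict_space2) (use cT in \<open>auto simp del: atLeastAtMost_iff\<close>)
  qed measurable
  from measurable_compose[OF this flow_ks_measurable[of m]]
  have [measurable]: "(\<lambda>p. flow_ks m (c (snd p)) (fst p)) \<in> borel_measurable (P \<Otimes>\<^sub>M lborel)" by simp
  have um: "case_prod u \<in> borel_measurable (P \<Otimes>\<^sub>M lborel)"
    unfolding u_def case_prod_beta by measurable
  have "(\<integral>\<^sup>+\<omega>. (\<integral>\<^sup>+s. u \<omega> s \<partial>lborel) \<partial>P) = (\<integral>\<^sup>+s. (\<integral>\<^sup>+\<omega>. u \<omega> s \<partial>P) \<partial>lborel)"
    by (rule Fubini'[OF um, symmetric])
  also have "\<dots> \<le> (\<integral>\<^sup>+s. ennreal (1 + C) * indicator {0..T} s \<partial>lborel)"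
  proof (rule nn_integral_mono)
    fix s :: real
    have "(\<integral>\<^sup>+\<omega>. u \<omega> s \<partial>P) = (\<integral>\<^sup>+\<omega>. 1 + flow_ks m (c s) \<omega> \<partial>P) * indicator {0..T} s"
      unfolding u_def using K(1)[OF cT, of s] by (intro nn_integral_multc) simp
    also have "(\<integral>\<^sup>+\<omega>. 1 + flow_ks m (c s) \<omega> \<partial>P) = 1 + (\<integral>\<^sup>+\<omega>. flow_ks m (c s) \<omega> \<partial>P)"
      using K(1)[OF cT, of s] by (subst nn_integral_add) (auto simp: emeasure_space_1)
    also have "(1 + (\<integral>\<^sup>+\<omega>. flow_ks m (c s) \<omega> \<partial>P)) * indicator {0..T} s \<le> ennreal (1 + C) * indicator {0..T} s"
      using K(2)[OF cT, of s] C0 by (intro mult_right_mono) (auto simp: ennreal_plus intro!: add_left_mono)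
    finally show "(\<integral>\<^sup>+\<omega>. u \<omega> s \<partial>P) \<le> ennreal (1 + C) * indicator {0..T} s" .
  qed
  also have "\<dots> = ennreal ((1 + C) * T)"
    using C0 T_pos by (simp add: nn_integral_cmult_indicator ennreal_mult)
  finally have "AE \<omega> in P. (\<integral>\<^sup>+s. u \<omega> s \<partial>lborel) < \<infinity>"
    by (intro AE_finite_of_nn_integral_le lborel.borel_measurable_nn_integral um)
  moreover have "u \<omega> s = (1 + flow_ks m s \<omega>) * indicator {0..T} s" for \<omega> s
    by (auto simp: u_def c_def indicator_def)
  ultimately show ?thesis by simp
qed

text \<open>Two limits extend the bound: right continuity leads from dyadic to all \<open>t\<close>,
  and continuity in the start from \<open>gpoints\<close> to all points. The inequality is
  extended-valued because, for a fixed outcome, the moment sum may be infinite at some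
  \<open>s\<close>.\<close>

lemma flow_map_hoelder:
  assumes m: "2 * CARD('n) < m"
  shows "\<exists>C. \<forall>\<omega> s t x y. regular \<omega> \<longrightarrow> s \<in> {0..T} \<longrightarrow> t \<in> {0..T} \<longrightarrow>
    ennreal (norm (flow_map s t x \<omega> - flow_map s t y \<omega>)) \<le> ennreal C * (1 + flow_ks m s \<omega>) * ennreal (ks_weight m x y)"
proof -
  obtain C where C: "C \<ge> 0" "\<And>D (f :: real^'n \<Rightarrow> real \<Rightarrow> real^'n) x y t. ks_sum m D f < \<infinity> \<Longrightarrow> t \<in> D \<Longrightarrow>
    x \<in> gpoints \<Longrightarrow> y \<in> gpoints \<Longrightarrow> norm (f x t - f y t) \<le> C * (1 + enn2real (ks_sum m D f)) * ks_weight m x y"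
    using ks_sum_bound[OF m, where 'v="real^'n"] by blast
  show ?thesis
  \<comment> \<open>\<open>C + 1\<close> instead of \<open>C\<close>: a positive factor keeps the
    right-hand side infinite where \<open>flow_ks\<close> is infinite and
    \<open>x \<noteq> y\<close>.\<close>
  proof (intro exI[of _ "C + 1"] allI impI)
    fix \<omega> s t and x y :: "real^'n" assume reg: "regular \<omega>" and s: "s \<in> {0..T}" and t: "t \<in> {0..T}"
    interpret driven_flow T drift "\<lambda>t. M t \<omega>" "\<bar>Kb\<bar>" "onorm ((*v) A)" "\<bar>Cb\<bar>" \<beta>
      using reg by (simp add: regular_def)
    have fm: "flow_map s t x \<omega> = \<Phi> s x t" for s t x using reg by (simp add: flow_map_def)
    consider "x = y" | "x \<noteq> y" "flow_ks m s \<omega> = \<infinity>" | "flow_ks m s \<omega> < \<infinity>" by (metis infinity_ennreal_def less_top)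
    then show "ennreal (norm (flow_map s t x \<omega> - flow_map s t y \<omega>)) \<le> ennreal (C + 1) * (1 + flow_ks m s \<omega>) * ennreal (ks_weight m x y)"
    proof cases
      case 1 then show ?thesis by simp
    next
      case 2
      then show ?thesis using C(1) ks_weight_pos[OF 2(1), of m] by (simp add: ennreal_mult_top ennreal_top_mult)
    next
      case 3
      define B where "B = 1 + enn2real (flow_ks m s \<omega>)"
      have B: "0 \<le> B" by (simp add: B_def)
      have dy: "norm (\<Phi> s x t - \<Phi> s y t) \<le> C * B * ks_weight m x y"
        if "t \<in> dyadics T" "x \<in> gpoints" "y \<in> gpoints" for t x y
        using C(2)[of "dyadics T" "\<lambda>x t. flow_map s t x \<omega>", OF _ that] 3 by (simp add: flow_ks_def B_def fm)
      obtain tk where tk: "\<And>k. tk k \<in> dyadics T" and tk': "\<And>k. tk k \<in> {t..T}" and lim: "tk \<longlonglongrightarrow> t"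
        by (rule dyadic_approximation[OF T_pos t]) blast
      have gp: "norm (\<Phi> s x t - \<Phi> s y t) \<le> C * B * ks_weight m x y" if "x \<in> gpoints" "y \<in> gpoints" for x y
      proof (rule LIMSEQ_le_const2)
        show "(\<lambda>k. norm (\<Phi> s x (tk k) - \<Phi> s y (tk k))) \<longlonglongrightarrow> norm (\<Phi> s x t - \<Phi> s y t)"
          by (intro tendsto_intros flow_right_sequentially[OF s t tk' lim])
      qed (use dy[OF tk that] in blast)
      have "norm (\<Phi> s x t - \<Phi> s y t) \<le> C * B * ks_weight m x y"
      proof (rule LIMSEQ_le)
        show "(\<lambda>k. norm (\<Phi> s (gfloor k x) t - \<Phi> s (gfloor k y) t)) \<longlonglongrightarrow> norm (\<Phi> s x t - \<Phi> s y t)"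
          by (intro tendsto_intros tendsto_uniform_limitI[OF flow_limit_init[OF gfloor_tendsto s] t])
        show "(\<lambda>k. C * B * ks_weight m (gfloor k x) (gfloor k y)) \<longlonglongrightarrow> C * B * ks_weight m x y"
          by (intro tendsto_mult_left ks_weight_tendsto m)
      qed (use gp[OF gfloor_in_gpoints gfloor_in_gpoints] in blast)
      also have "\<dots> \<le> (C + 1) * B * ks_weight m x y"
        using B by (intro mult_right_mono) (auto simp: ks_weight_def)
      finally have "ennreal (norm (\<Phi> s x t - \<Phi> s y t)) \<le> ennreal ((C + 1) * B * ks_weight m x y)"
        by (rule ennreal_leI)
      also have "\<dots> = ennreal (C + 1) * ennreal B * ennreal (ks_weight m x y)"
        using B C(1) by (simp add: ennreal_mult ks_weight_def)
      also have "ennreal B = 1 + flow_ks m s \<omega>"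
        using 3 unfolding B_def by (subst ennreal_plus) auto
      finally show ?thesis by (simp add: fm)
    qed
  qed
qed

lemma flow_ks_borel:
  "(\<lambda>s. (1 + flow_ks m s \<omega>) * indicator {0..T} s) \<in> borel_measurable lborel" if \<omega>: "regular \<omega>"
proof -
  define c where "c s = max 0 (min T s)" for s
  have "c \<in> measurable borel (restrict_space borel {0..T})"
    unfolding c_def[abs_def] using T_pos by (intro measurable_restrict_space2) auto
  then have "(\<lambda>s. (c s, \<omega>)) \<in> measurable borel (restrict_space borel {0..T} \<Otimes>\<^sub>M P)"
    using \<omega> by (intro measurable_Pair) (auto simp: regular_def)
  from measurable_compose[OF this flow_ks_measurable[of m]]
  have "(\<lambda>s. (1 + flow_ks m (c s) \<omega>) * indicator {0..T} s) \<in> borel_measurable borel" by simp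
  moreover have "(1 + flow_ks m (c s) \<omega>) * indicator {0..T} s = (1 + flow_ks m s \<omega>) * indicator {0..T} s" for s
    by (auto simp: c_def indicator_def)
  ultimately show ?thesis by simp
qed

end

section \<open>Collecting the properties of the stochastic flow\<close>

theorem theorem3p1:
  fixes P :: "'a measure" and T :: real and \<beta> :: real and \<theta> :: real
    and L :: "real \<Rightarrow> 'a \<Rightarrow> real^'d"
    and Q :: "real^'d^'d" and \<nu> :: "(real^'d) measure"
    and \<sigma> :: "real \<Rightarrow> real^'d^'n" and A :: "real^'n^'n"
    and b :: "real \<Rightarrow> real^'n \<Rightarrow> real^'n"
    and M :: "real \<Rightarrow> 'a \<Rightarrow> real^'n"
  assumes "prob_space P" and "complete_measure P"
    and "T > 0" and "CARD('d) \<le> CARD('n)"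
    and "levy_process P L" and "generating_triplet P L Q 0 \<nu>"
    and "0 < \<theta>" and "\<theta> < 1" and "integrable P (\<lambda>\<omega>. norm (L 1 \<omega>) powr \<theta>)"
    and "0 < \<beta>" and "\<beta> < 1"
    and "(\<lambda>(t, x). b t x) \<in> borel_measurable (restrict_space borel ({0..T} \<times> UNIV))"
    and "\<exists>K. \<forall>t\<in>{0..T}. \<forall>x. norm (b t x) \<le> K"
    and "\<exists>C. \<forall>t\<in>{0..T}. \<forall>x x'. norm (b t x - b t x') \<le> C * norm (x - x') powr \<beta>"
    and "\<sigma> \<in> borel_measurable (restrict_space borel {0..})"
    and "\<forall>R. bounded (\<sigma> ` {0..R})"
    and "cadlag_stoch_integral P L \<sigma> T M"
    and "H1 P L b A M T"
  shows "\<exists>(\<psi> :: real \<Rightarrow> real \<Rightarrow> real^'n \<Rightarrow> 'a \<Rightarrow> real^'n) (V :: nat \<Rightarrow> real \<Rightarrow> 'a \<Rightarrow> ennreal).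
    (\<lambda>((s, t, x), \<omega>). \<psi> s t x \<omega>)
       \<in> borel_measurable (restrict_space borel ({0..T} \<times> {0..T} \<times> UNIV) \<Otimes>\<^sub>M P) \<and>
    (\<forall>s\<in>{0..T}. \<forall>x. strong_solution P L b A M T s x (\<lambda>t. \<psi> s t x)) \<and>
    (\<forall>m. 2 * CARD('n) < m \<longrightarrow>
       (\<lambda>(s, \<omega>). V m s \<omega>) \<in> borel_measurable (restrict_space borel {0..T} \<Otimes>\<^sub>M P)) \<and>
    (\<exists>\<Omega>'\<in>sets P. measure P \<Omega>' = 1 \<and> (\<forall>\<omega>\<in>\<Omega>'.
       \<comment> \<open>(i)\<close>
       (\<forall>s\<in>{0..<T}. \<forall>R>0. uniform_limit ({0..T} \<times> cball 0 R)
            (\<lambda>r (t, x). \<psi> r t x \<omega>) (\<lambda>(t, x). \<psi> s t x \<omega>) (at_right s)) \<and>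
       (\<forall>s\<in>{0<..T}. \<exists>l. \<forall>R>0. uniform_limit ({0..T} \<times> cball 0 R)
            (\<lambda>r (t, x). \<psi> r t x \<omega>) l (at_left s)) \<and>
       \<comment> \<open>(ii)\<close>
       (\<forall>x. \<forall>s\<in>{0..T}. (\<forall>t\<in>{0..s}. \<psi> s t x \<omega> = x) \<and>
            solves_E b A M s x {s..T} (\<lambda>t. \<psi> s t x \<omega>) \<omega>) \<and>
       \<comment> \<open>(iii)\<close>
       (\<forall>s\<in>{0..T}. \<forall>x. \<forall>\<epsilon>>0. \<exists>\<delta>>0. \<forall>y. dist y x < \<delta> \<longrightarrow>
            (\<forall>t\<in>{0..T}. dist (\<psi> s t y \<omega>) (\<psi> s t x \<omega>) < \<epsilon>)) \<and>
       (\<forall>m. 2 * CARD('n) < m \<longrightarrow>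
          (\<integral>\<^sup>+s. V m s \<omega> * indicator {0..T} s \<partial>lborel) < \<infinity> \<and>
          (\<forall>x y. \<forall>s\<in>{0..T}. \<forall>t\<in>{0..T}.
             ennreal (norm (\<psi> s t x \<omega> - \<psi> s t y \<omega>))
               \<le> V m s \<omega> * ennreal (norm (x - y) powr ((real m - 2 * real CARD('n)) / real m)
                    * max ((max (norm x) (norm y)) powr ((2 * real CARD('n) + 1) / real m)) 1))) \<and>
       \<comment> \<open>(iv)\<close>
       (\<forall>s r t x. 0 \<le> s \<and> s < r \<and> r \<le> t \<and> t \<le> T \<longrightarrow> \<psi> s t x \<omega> = \<psi> r t (\<psi> s r x \<omega>) \<omega>) \<and>
       \<comment> \<open>(v)\<close>
       (\<forall>s\<^sub>0\<in>{0..<T}. \<forall>\<tau>\<in>{s\<^sub>0<..T}. \<forall>x (g :: real \<Rightarrow> real^'n).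
          cadlag_on {s\<^sub>0..<\<tau>} g \<and> solves_E b A M s\<^sub>0 x {s\<^sub>0..<\<tau>} g \<omega> \<longrightarrow>
          (\<forall>r\<in>{s\<^sub>0..<\<tau>}. g r = \<psi> s\<^sub>0 r x \<omega>))))"
proof -
  obtain K where K: "\<forall>t\<in>{0..T}. \<forall>x. norm (b t x) \<le> K"
    using assms(13) by blast
  obtain C where C: "\<forall>t\<in>{0..T}. \<forall>x x'. norm (b t x - b t x') \<le> C * norm (x - x') powr \<beta>"
    using assms(14) by blast
  interpret hoelder_sde P L b A M T \<beta> K C
  proof (rule hoelder_sde.intro)
    show "prob_space P" "complete_measure P" "0 < T" "0 < \<beta>" "H1 P L b A M T" by fact+
    show "\<beta> \<le> 1" using assms(11) by simp
    show "L t \<in> borel_measurable P" if "0 \<le> t" for t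
      using assms(5) that unfolding levy_process_def by blast
    show "AE \<omega> in P. cadlag_on {0..T} (\<lambda>t. M t \<omega>)"
      using assms(17) unfolding cadlag_stoch_integral_def by blast
  qed (use K C in blast)+
  \<comment> \<open>The constants are selected for all \<open>m\<close> before any outcome is fixed,
    so each \<open>V m\<close> is a deterministic multiple of a jointly measurable function.\<close>
  have "\<forall>m. \<exists>c. 2 * CARD('n) < m \<longrightarrow> (\<forall>\<omega> s t x y. regular \<omega> \<longrightarrow> s \<in> {0..T} \<longrightarrow> t \<in> {0..T} \<longrightarrow>
    ennreal (norm (flow_map s t x \<omega> - flow_map s t y \<omega>)) \<le> ennreal c * (1 + flow_ks m s \<omega>) * ennreal (ks_weight m x y))"
    using flow_map_hoelder by blast
  then obtain c where c: "\<forall>m. 2 * CARD('n) < m \<longrightarrow> (\<forall>\<omega> s t x y. regular \<omega> \<longrightarrow> s \<in> {0..T} \<longrightarrow> t \<in> {0..T} \<longrightarrow>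
    ennreal (norm (flow_map s t x \<omega> - flow_map s t y \<omega>)) \<le> ennreal (c m) * (1 + flow_ks m s \<omega>) * ennreal (ks_weight m x y))"
    by (rule choice[THEN exE])
  define V where "V m s \<omega> = ennreal (c m) * (1 + flow_ks m s \<omega>)" for m s \<omega>
  have Vmeas: "(\<lambda>(s, \<omega>). V m s \<omega>) \<in> borel_measurable (restrict_space borel {0..T} \<Otimes>\<^sub>M P)" for m
    using flow_ks_measurable[of m] unfolding V_def case_prod_beta
    by (intro borel_measurable_times_ennreal borel_measurable_add borel_measurable_const)
  have "AE \<omega> in P. regular \<omega> \<and> (\<forall>m. 2 * CARD('n) < m \<longrightarrow> (\<integral>\<^sup>+s. V m s \<omega> * indicator {0..T} s \<partial>lborel) < \<infinity>)"
    using AE_regular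
  proof (rule AE_conjI, unfold AE_all_countable, intro allI)
    fix m
    show "AE \<omega> in P. 2 * CARD('n) < m \<longrightarrow> (\<integral>\<^sup>+s. V m s \<omega> * indicator {0..T} s \<partial>lborel) < \<infinity>"
    proof (cases "2 * CARD('n) < m")
      case True
      from AE_flow_ks_integrable[OF True] AE_regular show ?thesis
      proof eventually_elim
        case (elim \<omega>)
        have "(\<integral>\<^sup>+s. V m s \<omega> * indicator {0..T} s \<partial>lborel) = (\<integral>\<^sup>+s. ennreal (c m) * ((1 + flow_ks m s \<omega>) * indicator {0..T} s) \<partial>lborel)"
          by (simp add: V_def mult.assoc)
        also have "\<dots> = ennreal (c m) * (\<integral>\<^sup>+s. (1 + flow_ks m s \<omega>) * indicator {0..T} s \<partial>lborel)"
          using elim(2) by (intro nn_integral_cmult flow_ks_borel)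
        also have "\<dots> < \<infinity>"
          using elim(1) by (simp add: ennreal_mult_less_top)
        finally show ?case by simp
      qed
    qed simp
  qed
  then obtain \<Omega>' where \<Omega>': "\<Omega>' \<in> sets P" "measure P \<Omega>' = 1"
    and reg: "\<And>\<omega>. \<omega> \<in> \<Omega>' \<Longrightarrow> regular \<omega>"
    and Vint: "\<And>\<omega> m. \<omega> \<in> \<Omega>' \<Longrightarrow> 2 * CARD('n) < m \<Longrightarrow> (\<integral>\<^sup>+s. V m s \<omega> * indicator {0..T} s \<partial>lborel) < \<infinity>"
    unfolding prob_space.AE_iff_prob_1[OF assms(1)] by blast
  have path: "driven_flow T (\<lambda>r z. b r z + A *v z) (\<lambda>t. M t \<omega>) \<bar>K\<bar> (onorm ((*v) A)) \<bar>C\<bar> \<beta>"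
    and fm: "\<And>s t x. flow_map s t x \<omega> = ode_flow T (\<lambda>r z. b r z + A *v z) (\<lambda>t. M t \<omega>) s x t"
    if "\<omega> \<in> \<Omega>'" for \<omega>
    using reg[OF that] by (simp_all add: regular_def flow_map_def)
  show ?thesis
  proof (intro exI[of _ flow_map] exI[of _ V] conjI bexI[of _ \<Omega>'] ballI)
    show "(\<lambda>((s, t, x), \<omega>). flow_map s t x \<omega>)
       \<in> borel_measurable (restrict_space borel ({0..T} \<times> {0..T} \<times> UNIV) \<Otimes>\<^sub>M P)"
      by (rule flow_map_measurable)
    show "\<forall>x. strong_solution P L b A M T s x (\<lambda>t. flow_map s t x)" if "s \<in> {0..T}" for s
      using strong_flow_map[OF that] by blast
    show "\<forall>m. 2 * CARD('n) < m \<longrightarrow>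
       (\<lambda>(s, \<omega>). V m s \<omega>) \<in> borel_measurable (restrict_space borel {0..T} \<Otimes>\<^sub>M P)"
      using Vmeas by blast
    show "measure P \<Omega>' = 1" "\<Omega>' \<in> sets P" by fact+
  next
    fix \<omega> s assume \<omega>: "\<omega> \<in> \<Omega>'" and s: "s \<in> {0..<T}"
    show "\<forall>R>0. uniform_limit ({0..T} \<times> cball 0 R)
            (\<lambda>r (t, x). flow_map r t x \<omega>) (\<lambda>(t, x). flow_map s t x \<omega>) (at_right s)"
      unfolding fm[OF \<omega>] using driven_flow.flow_right_uniform[OF path[OF \<omega>] s] by blast
  next
    fix \<omega> s assume \<omega>: "\<omega> \<in> \<Omega>'" and s: "s \<in> {0<..T}"
    show "\<exists>l. \<forall>R>0. uniform_limit ({0..T} \<times> cball 0 R)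
            (\<lambda>r (t, x). flow_map r t x \<omega>) l (at_left s)"
      unfolding fm[OF \<omega>] using driven_flow.flow_left_uniform[OF path[OF \<omega>] s] by blast
  next
    fix \<omega> assume \<omega>: "\<omega> \<in> \<Omega>'"
    show "\<forall>x. \<forall>s\<in>{0..T}. (\<forall>t\<in>{0..s}. flow_map s t x \<omega> = x) \<and>
            solves_E b A M s x {s..T} (\<lambda>t. flow_map s t x \<omega>) \<omega>"
      unfolding fm[OF \<omega>] solves_E_iff_driven_sol
      using driven_flow.flow_sol[OF path[OF \<omega>]] driven_flow.flow_before[OF path[OF \<omega>]] by auto
  next
    fix \<omega> s assume \<omega>: "\<omega> \<in> \<Omega>'" and s: "s \<in> {0..T}"
    show "\<forall>x. \<forall>\<epsilon>>0. \<exists>\<delta>>0. \<forall>y. dist y x < \<delta> \<longrightarrow>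
            (\<forall>t\<in>{0..T}. dist (flow_map s t y \<omega>) (flow_map s t x \<omega>) < \<epsilon>)"
      unfolding fm[OF \<omega>] using driven_flow.flow_continuous[OF path[OF \<omega>] s] by blast
  next
    fix \<omega> assume \<omega>: "\<omega> \<in> \<Omega>'"
    show "\<forall>m. 2 * CARD('n) < m \<longrightarrow>
          (\<integral>\<^sup>+s. V m s \<omega> * indicator {0..T} s \<partial>lborel) < \<infinity> \<and>
          (\<forall>x y. \<forall>s\<in>{0..T}. \<forall>t\<in>{0..T}.
             ennreal (norm (flow_map s t x \<omega> - flow_map s t y \<omega>))
               \<le> V m s \<omega> * ennreal (norm (x - y) powr ((real m - 2 * real CARD('n)) / real m)
                    * max ((max (norm x) (norm y)) powr ((2 * real CARD('n) + 1) / real m)) 1))"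
      using Vint[OF \<omega>] c reg[OF \<omega>] unfolding V_def ks_weight_def by blast
  next
    fix \<omega> assume \<omega>: "\<omega> \<in> \<Omega>'"
    show "\<forall>s r t x. 0 \<le> s \<and> s < r \<and> r \<le> t \<and> t \<le> T \<longrightarrow> flow_map s t x \<omega> = flow_map r t (flow_map s r x \<omega>) \<omega>"
      unfolding fm[OF \<omega>]
      by (intro allI impI, rule driven_flow.flow_cocycle[OF path[OF \<omega>]]) auto
  next
    fix \<omega> s\<^sub>0 \<tau> assume \<omega>: "\<omega> \<in> \<Omega>'" and s: "s\<^sub>0 \<in> {0..<T}" and \<tau>: "\<tau> \<in> {s\<^sub>0<..T}"
    show "\<forall>x (g :: real \<Rightarrow> real^'n). cadlag_on {s\<^sub>0..<\<tau>} g \<and> solves_E b A M s\<^sub>0 x {s\<^sub>0..<\<tau>} g \<omega> \<longrightarrow>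
          (\<forall>r\<in>{s\<^sub>0..<\<tau>}. g r = flow_map s\<^sub>0 r x \<omega>)"
    proof (intro allI impI ballI, elim conjE)
      fix x and g :: "real \<Rightarrow> real^'n" and r
      assume g: "solves_E b A M s\<^sub>0 x {s\<^sub>0..<\<tau>} g \<omega>" and r: "r \<in> {s\<^sub>0..<\<tau>}"
      \<comment> \<open>Uniqueness was proved on closed intervals, and agreement at \<open>r\<close>
        concerns only the restriction to \<open>{s\<^sub>0..r}\<close>, so no behaviour of
        \<open>g\<close> near \<open>\<tau>\<close> enters.\<close>
      have "driven_sol (\<lambda>r z. b r z + A *v z) (\<lambda>t. M t \<omega>) s\<^sub>0 x {s\<^sub>0..r} g"
        by (rule driven_sol_subset[OF g[unfolded solves_E_iff_driven_sol]]) (use r in auto)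
      then show "g r = flow_map s\<^sub>0 r x \<omega>"
        unfolding fm[OF \<omega>] using s \<tau> r by (intro driven_flow.flow_unique[OF path[OF \<omega>]]) auto
    qed
  qed
qed

end
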